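(* Suppose that $\mathfrak Z$ is a (locally) Gorenstein zero-dimensional subscheme of $\mathbb P^n$ of degree $s$, and that $j\ge\max\{\tau(\mathfrak Z)+\alpha(\mathfrak Z),\,2\tau(\mathfrak Z)+1\}$. If $F$ is a general enough element of $((I_{\mathfrak Z})_j)^\perp\subset\Gamma_j$, then $F$ has a unique generalized additive decomposition of length $s$ associated to $\mathfrak Z$, and $F$ has no generalized additive decomposition of length less than $s$.
   Context: $k$ is an algebraically closed field with $\operatorname{char}k=0$ or $\operatorname{char}k>j$. $R=k[x_1,\dots,x_{n+1}]$; $\Gamma=k_{DP}[X_1,\dots,X_{n+1}]$ is the divided power ring with product $X^{[U]}X^{[V]}=\binom{U+V}{U}X^{[U+V]}$, on which $R$ acts by contraction $x^K\circ X^{[U]}=X^{[U-K]}$ ($0$ if an exponent is negative). $I_{\mathfrak Z}$ is the saturated ideal of $\mathfrak Z$; $((I_{\mathfrak Z})_j)^\perp=\{F\in\Gamma_j:h\circ F=0\ \forall h\in (I_{\mathfrak Z})_j\}$; for a graded ideal $I$, $I^\perp=\bigoplus_j (I_j)^\perp$. "General enough" means in some nonempty Zariski-open subset of $((I_{\mathfrak Z})_j)^\perp$. $\tau(\mathfrak Z)=\min\{i:\dim_k(R/I_{\mathfrak Z})_i=s\}$. $\alpha(\mathfrak Z)$ is the maximum over the support points $p$ of the socle degree (largest $i$ with $\mathfrak m^i\ne0$) of the Artinian local ring $\mathcal O_{\mathfrak Z,p}$. A generalized additive decomposition (GAD) of $F\in\Gamma_j$ of length $s=\sum s_i$ and partition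 $(s_1,\dots,s_m)$, associated to $\mathfrak Z$, is an expression $F=F_1+\dots+F_m$ where $\mathfrak Z$ is a degree-$s$ zero-dimensional scheme whose decomposition into irreducible components (schemes each supported at a single point) is $\mathfrak Z=\bigcup_i\mathfrak Z_i$, $\deg\mathfrak Z_i=s_i$, and $F_i\in(I_{\mathfrak Z_i})^\perp$ for each $i$. A GAD is unique if the summands $F_1,\dots,F_m$ are unique. *)

theory Defs
  imports
    "HOL-Library.Poly_Mapping"
    "HOL-Computational_Algebra.Polynomial"
    "HOL-Algebra.Ideal_Product"
begin

section \<open>Polynomials, divided powers and contraction\<close>

text \<open>
  Throughout, the finite type \<open>'n\<close> indexes the variables, so \<open>CARD('n) = n + 1\<close> and the ambient
  projective space is \<open>P\<^sup>n\<close>.  Multiplication of \<open>mpoly\<close> is the usual one of \<open>R = k[x\<^sub>1, \<dots>, x\<^sub>n\<^sub>+\<^sub>1]\<close>.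
\<close>

type_synonym 'v expo = "'v \<Rightarrow>\<^sub>0 nat"
type_synonym ('v, 'k) mpoly = "'v expo \<Rightarrow>\<^sub>0 'k"

text \<open>
  An element of the divided power ring \<open>\<Gamma>\<close> is the family of its coefficients with respect to the
  basis \<open>X\<^bsup>[U]\<^esup>\<close>.  The type happens to be that of \<open>R\<close>, but the multiplication \<open>*\<close> of that type is
  not the product of \<open>\<Gamma>\<close> and is never applied to divided power forms; only the \<open>k\<close>-linear structure
  of \<open>\<Gamma>\<close> and the action of \<open>R\<close> by contraction are needed.
\<close>

type_synonym ('v, 'k) dpoly = "'v expo \<Rightarrow>\<^sub>0 'k"

definition expo_degree :: "'n::finite expo \<Rightarrow> nat" where
  "expo_degree u = (\<Sum>i\<in>UNIV. Poly_Mapping.lookup u i)"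

text \<open>\<open>forms d\<close> is \<open>R\<^sub>d\<close>, and equally \<open>\<Gamma>\<^sub>d\<close>.\<close>

definition forms :: "nat \<Rightarrow> ('n::finite expo \<Rightarrow>\<^sub>0 'k::field) set" where
  "forms d = {f. \<forall>u\<in>Poly_Mapping.keys f. expo_degree u = d}"

definition hom_part :: "nat \<Rightarrow> ('n::finite, 'k::field) mpoly \<Rightarrow> ('n, 'k) mpoly" where
  "hom_part d f = (\<Sum>u\<in>{u\<in>Poly_Mapping.keys f. expo_degree u = d}.
     Poly_Mapping.single u (Poly_Mapping.lookup f u))"

definition peval :: "('v, 'k::field) mpoly \<Rightarrow> ('v \<Rightarrow> 'k) \<Rightarrow> 'k" where
  "peval f p = (\<Sum>u\<in>Poly_Mapping.keys f.
     Poly_Mapping.lookup f u * (\<Prod>i\<in>Poly_Mapping.keys u. p i ^ Poly_Mapping.lookup u i))"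

definition contract :: "('n, 'k::field) mpoly \<Rightarrow> ('n, 'k) dpoly \<Rightarrow> ('n, 'k) dpoly" where
  "contract h F = (\<Sum>K\<in>Poly_Mapping.keys h. \<Sum>U\<in>Poly_Mapping.keys F.
     if \<forall>i. Poly_Mapping.lookup K i \<le> Poly_Mapping.lookup U i
     then Poly_Mapping.single (U - K) (Poly_Mapping.lookup h K * Poly_Mapping.lookup F U) else 0)"

definition cscale :: "'k::field \<Rightarrow> ('a \<Rightarrow>\<^sub>0 'k) \<Rightarrow> ('a \<Rightarrow>\<^sub>0 'k)" where
  "cscale c f = Poly_Mapping.map ((*) c) f"

lemma lookup_cscale [simp]: "Poly_Mapping.lookup (cscale c f) u = c * Poly_Mapping.lookup f u"
  by (simp add: cscale_def map.rep_eq when_def)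

interpretation cvec: vector_space cscale
  by unfold_locales (auto intro!: poly_mapping_eqI simp: Poly_Mapping.lookup_add algebra_simps)


section \<open>Zero-dimensional subschemes of projective space\<close>

text \<open>
  A closed subscheme of \<open>P\<^sup>n\<close> is represented by its saturated homogeneous ideal, to which it
  corresponds bijectively.  Unions of subschemes correspond to intersections of ideals.
\<close>

definition hom_ideal :: "('n::finite, 'k::field) mpoly set \<Rightarrow> bool" where
  "hom_ideal I \<longleftrightarrow>
     0 \<in> I \<and> (\<forall>f\<in>I. \<forall>g\<in>I. f + g \<in> I) \<and> (\<forall>f\<in>I. \<forall>r. r * f \<in> I) \<and>
     (\<forall>f\<in>I. \<forall>d. hom_part d f \<in> I)"

definition saturated :: "('n::finite, 'k::field) mpoly set \<Rightarrow> bool" where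
  "saturated I \<longleftrightarrow> (\<forall>f. (\<exists>N. \<forall>g\<in>forms N. g * f \<in> I) \<longrightarrow> f \<in> I)"

text \<open>The Hilbert function \<open>dim\<^sub>k (R/I)\<^sub>i\<close>; the subtraction does not truncate, as \<open>I\<^sub>i \<subseteq> R\<^sub>i\<close>.\<close>

definition hilbert :: "('n::finite, 'k::field) mpoly set \<Rightarrow> nat \<Rightarrow> nat" where
  "hilbert I i = cvec.dim (forms i :: ('n, 'k) mpoly set) - cvec.dim (I \<inter> forms i)"

text \<open>
  Dimension and degree are read off the Hilbert polynomial: the scheme is zero-dimensional of
  degree \<open>s\<close> iff its Hilbert polynomial is the nonzero constant \<open>s\<close>.
\<close>

definition zero_dim_scheme :: "('n::finite, 'k::field) mpoly set \<Rightarrow> nat \<Rightarrow> bool" where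
  "zero_dim_scheme I s \<longleftrightarrow>
     hom_ideal I \<and> saturated I \<and> s > 0 \<and> (\<forall>\<^sub>F i in sequentially. hilbert I i = s)"

definition scheme_tau :: "('n::finite, 'k::field) mpoly set \<Rightarrow> nat \<Rightarrow> nat" where
  "scheme_tau I s = (LEAST i. hilbert I i = s)"

text \<open>
  Points are given by all their homogeneous coordinate vectors.  Over an algebraically closed
  field these are all the closed points of the scheme.
\<close>

definition support :: "('n::finite, 'k::field) mpoly set \<Rightarrow> ('n \<Rightarrow> 'k) set" where
  "support I = {p. p \<noteq> (\<lambda>_. 0) \<and> (\<forall>f\<in>I. peval f p = 0)}"

definition single_point :: "('n::finite, 'k::field) mpoly set \<Rightarrow> bool" where
  "single_point I \<longleftrightarrow> (\<exists>p. p \<noteq> (\<lambda>_. 0) \<and> support I = {(\<lambda>i. c * p i) | c. c \<noteq> 0})"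


section \<open>The local rings of a subscheme\<close>

text \<open>
  The local ring at the point with coordinates \<open>p\<close> is the homogeneous localization of \<open>R/I\<close> at the
  prime ideal of \<open>p\<close>: fractions \<open>f/g\<close> of forms of the same degree with \<open>g(p) \<noteq> 0\<close>, where
  \<open>f/g = f'/g'\<close> iff \<open>h (f g' - f' g) \<in> I\<close> for some form \<open>h\<close> with \<open>h(p) \<noteq> 0\<close>.
\<close>

definition fracs :: "('n::finite \<Rightarrow> 'k::field) \<Rightarrow> (('n, 'k) mpoly \<times> ('n, 'k) mpoly) set" where
  "fracs p = {(f, g). (\<exists>d. f \<in> forms d \<and> g \<in> forms d) \<and> peval g p \<noteq> 0}"

definition frac_rel ::
  "('n::finite, 'k::field) mpoly set \<Rightarrow> ('n \<Rightarrow> 'k) \<Rightarrow>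
   ((('n, 'k) mpoly \<times> ('n, 'k) mpoly) \<times> (('n, 'k) mpoly \<times> ('n, 'k) mpoly)) set" where
  "frac_rel I p = {((f, g), (f', g')). (f, g) \<in> fracs p \<and> (f', g') \<in> fracs p \<and>
     (\<exists>e. \<exists>h\<in>forms e. peval h p \<noteq> 0 \<and> h * (f * g' - f' * g) \<in> I)}"

definition local_ring ::
  "('n::finite, 'k::field) mpoly set \<Rightarrow> ('n \<Rightarrow> 'k) \<Rightarrow> (('n, 'k) mpoly \<times> ('n, 'k) mpoly) set ring" where
  "local_ring I p = \<lparr>
     carrier = fracs p // frac_rel I p,
     monoid.mult = (\<lambda>A B. \<Union>(f, g)\<in>A. \<Union>(f', g')\<in>B. frac_rel I p `` {(f * f', g * g')}),
     one = frac_rel I p `` {(1, 1)},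
     zero = frac_rel I p `` {(0, 1)},
     add = (\<lambda>A B. \<Union>(f, g)\<in>A. \<Union>(f', g')\<in>B. frac_rel I p `` {(f * g' + f' * g, g * g')})\<rparr>"

text \<open>The following notions are meant for Artinian local rings \<open>A\<close>.\<close>

definition max_ideal :: "('a, 'b) ring_scheme \<Rightarrow> 'a set" where
  "max_ideal A = carrier A - Units A"

definition max_ideal_power :: "('a, 'b) ring_scheme \<Rightarrow> nat \<Rightarrow> 'a set" where
  "max_ideal_power A i = (ideal_prod A (max_ideal A) ^^ i) (carrier A)"

definition socle_degree :: "('a, 'b) ring_scheme \<Rightarrow> nat" where
  "socle_degree A = (GREATEST i. max_ideal_power A i \<noteq> {\<zero>\<^bsub>A\<^esub>})"

definition socle :: "('a, 'b) ring_scheme \<Rightarrow> 'a set" where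
  "socle A = {x \<in> carrier A. \<forall>y\<in>max_ideal A. y \<otimes>\<^bsub>A\<^esub> x = \<zero>\<^bsub>A\<^esub>}"

text \<open>
  An Artinian local ring is Gorenstein iff its socle is a one-dimensional vector space over the
  residue field.  The maximal ideal annihilates the socle, so the lines over the residue field
  in the socle are the sets \<open>A e\<close> with \<open>e \<noteq> 0\<close>.
\<close>

definition artin_gorenstein :: "('a, 'b) ring_scheme \<Rightarrow> bool" where
  "artin_gorenstein A \<longleftrightarrow>
     (\<exists>e\<in>socle A. e \<noteq> \<zero>\<^bsub>A\<^esub> \<and> socle A = {a \<otimes>\<^bsub>A\<^esub> e | a. a \<in> carrier A})"

definition locally_gorenstein :: "('n::finite, 'k::field) mpoly set \<Rightarrow> bool" where
  "locally_gorenstein I \<longleftrightarrow> (\<forall>p\<in>support I. artin_gorenstein (local_ring I p))"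

definition scheme_alpha :: "('n::finite, 'k::field) mpoly set \<Rightarrow> nat" where
  "scheme_alpha I = Max ((\<lambda>p. socle_degree (local_ring I p)) ` support I)"


section \<open>Inverse systems and generalized additive decompositions\<close>

text \<open>\<open>perp I j\<close> is \<open>(I\<^sub>j)\<^sup>\<bottom> \<subseteq> \<Gamma>\<^sub>j\<close>, the degree-\<open>j\<close> part of \<open>I\<^sup>\<bottom>\<close>.\<close>

definition perp :: "('n::finite, 'k::field) mpoly set \<Rightarrow> nat \<Rightarrow> ('n, 'k) dpoly set" where
  "perp I j = {F \<in> forms j. \<forall>h\<in>I \<inter> forms j. contract h F = 0}"

text \<open>
  Zariski topology of a linear subspace \<open>V\<close> of \<open>\<Gamma>\<^sub>j\<close>: the polynomials \<open>q\<close> have one variable for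
  each exponent \<open>U\<close>, which is evaluated at the coefficient of \<open>X\<^bsup>[U]\<^esup>\<close> in \<open>F\<close>.
\<close>

definition zariski_open_in :: "('n, 'k::field) dpoly set \<Rightarrow> ('n, 'k) dpoly set \<Rightarrow> bool" where
  "zariski_open_in V W \<longleftrightarrow> W \<subseteq> V \<and>
     (\<exists>P :: ('n expo, 'k) mpoly set. V - W = {F \<in> V. \<forall>q\<in>P. peval q (Poly_Mapping.lookup F) = 0})"

definition irreducible_components ::
  "('n::finite, 'k::field) mpoly set \<Rightarrow> ('n, 'k) mpoly set list \<Rightarrow> bool" where
  "irreducible_components I Qs \<longleftrightarrow>
     I = \<Inter> (set Qs) \<and>
     (\<forall>Q\<in>set Qs. hom_ideal Q \<and> saturated Q \<and> single_point Q) \<and>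
     sorted_wrt (\<lambda>Q Q'. support Q \<inter> support Q' = {}) Qs"

text \<open>
  \<open>gad F j I ss Qs Fs\<close>: the list \<open>Fs\<close> of summands in \<open>\<Gamma>\<^sub>j\<close> is a generalized additive decomposition
  of \<open>F\<close> of partition \<open>ss\<close>, hence of length \<open>sum_list ss\<close>, associated to the scheme with ideal \<open>I\<close>
  and irreducible components \<open>Qs\<close>.
\<close>

definition gad ::
  "('n::finite, 'k::field) dpoly \<Rightarrow> nat \<Rightarrow> ('n, 'k) mpoly set \<Rightarrow> nat list \<Rightarrow>
   ('n, 'k) mpoly set list \<Rightarrow> ('n, 'k) dpoly list \<Rightarrow> bool" where
  "gad F j I ss Qs Fs \<longleftrightarrow>
     zero_dim_scheme I (sum_list ss) \<and>
     irreducible_components I Qs \<and>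
     list_all2 zero_dim_scheme Qs ss \<and>
     list_all2 (\<lambda>G Q. G \<in> perp Q j) Fs Qs \<and>
     F = sum_list Fs"

end

theory Submission
  imports Defs "Jordan_Normal_Form.Determinant"
begin

text \<open>
  Let \<open>\<tau>\<close> be the first degree in which the Hilbert function of \<open>I\<close> is \<open>s\<close>.  Choose a linear form \<open>l\<close>
  that vanishes at no point of the scheme.  It is regular modulo \<open>I\<close>, so multiplication by \<open>l\<close> embeds
  \<open>R\<^sub>i/I\<^sub>i\<close> into \<open>R\<^bsub>i+1\<^esub>/I\<^bsub>i+1\<^esub>\<close>, the Hilbert function is nondecreasing, and from degree \<open>\<tau>\<close> on all pieces
  are identified with one algebra \<open>A\<close> of dimension \<open>s\<close>, the ring of functions of the scheme.  An
  element \<open>F\<close> of \<open>(I\<^sub>j)\<^sup>\<bottom>\<close> is a linear functional on \<open>A\<close>.  Call \<open>F\<close> nondegenerate if this functional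
  vanishes on no nonzero ideal of \<open>A\<close>.  The open set of the theorem consists of the nondegenerate \<open>F\<close>;
  it is the nonvanishing locus of a determinant (\<open>nondegenerate_open\<close>).

  It is not empty (\<open>nondegenerate_exists\<close>).  Over an algebraically closed field each nonzero ideal
  of \<open>A\<close> contains a common eigenvector of the multiplications by the coordinates
  (\<open>eigenvector_exists\<close>).  Its eigenvalues form a point of the support, and it lies in the socle of the
  local ring there.  By the Gorenstein property each point has only one line of eigenvectors
  (\<open>gorenstein_eigenvectors_proportional\<close>), so a functional is nondegenerate as soon as it avoids
  finitely many hyperplanes.

  A nondegenerate \<open>F\<close> remembers the scheme (\<open>nondegenerate_determines_scheme\<close>).  For
  \<open>\<tau> \<le> i \<le> j - \<tau>\<close>, a form of degree \<open>i\<close> that annihilates \<open>F\<close> is in \<open>I\<close>.  If \<open>F\<close> has a decomposition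
  associated to a scheme with ideal \<open>I'\<close> of degree at most \<open>s\<close>, then \<open>I'\<close> annihilates \<open>F\<close>, so
  \<open>I'\<^sub>i \<subseteq> I\<^sub>i\<close>, and comparing Hilbert functions gives equality of degrees and of these pieces of the
  ideals.  As \<open>j \<ge> 2\<tau> + 1\<close>, the pieces of degree \<open>\<tau>\<close> and \<open>\<tau> + 1\<close> agree.  Above them both ideals are
  generated by linear multiples (\<open>generated_in_lower_degree\<close>), and by saturation \<open>I' = I\<close>.

  The decompositions of \<open>F\<close> associated to \<open>I\<close> itself are governed by the Chinese remainder theorem.
  The irreducible components are the kernels of the localizations at the points of the support
  (\<open>irreducible_components_exist\<close>, \<open>irreducible_component_unique\<close>); their degrees sum to \<open>s\<close>, which
  makes them comaximal already in degree \<open>j\<close> (\<open>components_comaximal\<close>), and so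
  \<open>(I\<^sub>j)\<^sup>\<bottom>\<close> is the direct sum of the orthogonal spaces of the components
  (\<open>perp_summands_exist\<close>, \<open>perp_summands_unique\<close>).
\<close>

section \<open>Monomials\<close>

abbreviation coef :: "('a \<Rightarrow>\<^sub>0 'b::zero) \<Rightarrow> 'a \<Rightarrow> 'b" where
  "coef \<equiv> Poly_Mapping.lookup"

abbreviation monomial :: "'a \<Rightarrow> 'b::zero \<Rightarrow> ('a \<Rightarrow>\<^sub>0 'b)" where
  "monomial \<equiv> Poly_Mapping.single"

definition var :: "'v \<Rightarrow> ('v, 'k::field) mpoly" where
  "var i = monomial (monomial i 1) 1"

lemma sum_monomials:
  fixes f :: "'a \<Rightarrow>\<^sub>0 'b::comm_monoid_add"
  shows "f = (\<Sum>u\<in>Poly_Mapping.keys f. monomial u (coef f u))"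
proof (rule poly_mapping_eqI)
  fix v
  show "coef f v = coef (\<Sum>u\<in>Poly_Mapping.keys f. monomial u (coef f u)) v"
    by (cases "v \<in> Poly_Mapping.keys f")
      (auto simp: lookup_sum lookup_single when_def in_keys_iff)
qed

lemma monomials_induct [case_names monomial add]:
  fixes f :: "'a \<Rightarrow>\<^sub>0 'b::comm_monoid_add"
  assumes m: "\<And>u c. P (monomial u c)" and a: "\<And>f g. P f \<Longrightarrow> P g \<Longrightarrow> P (f + g)"
  shows "P f"
proof -
  have "P (\<Sum>u\<in>A. monomial u (coef f u))" if "finite A" for A
    using that
  proof induction
    case empty
    show ?case using m[of undefined 0] by simp
  qed (simp add: m a)
  from this[OF finite_keys[of f]] show ?thesis
    by (metis sum_monomials)
qed

lemma cscale_eq_mult: "cscale c f = monomial (0 :: 'v expo) c * f"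
  by (simp add: cscale_def mult_map_scale_conv_mult)

lemma cscale_mult_left: "cscale c f * g = cscale c (f * (g :: ('v, 'k::field) mpoly))"
  by (simp add: cscale_eq_mult mult.assoc)

lemma cscale_mult_right: "f * cscale c g = cscale c (f * (g :: ('v, 'k::field) mpoly))"
  by (simp add: cscale_eq_mult mult_ac)


section \<open>Evaluation of polynomials\<close>

definition expo_eval :: "'v expo \<Rightarrow> ('v \<Rightarrow> 'k::field) \<Rightarrow> 'k" where
  "expo_eval u p = (\<Prod>i\<in>Poly_Mapping.keys u. p i ^ coef u i)"

lemma expo_eval_superset:
  assumes "finite A" "Poly_Mapping.keys u \<subseteq> A"
  shows "expo_eval u p = (\<Prod>i\<in>A. p i ^ coef u i)"
  unfolding expo_eval_def by (rule prod.mono_neutral_left) (use assms in \<open>auto simp: in_keys_iff\<close>)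

lemma expo_eval_add: "expo_eval (u + v) p = expo_eval u p * expo_eval v p"
proof -
  let ?A = "Poly_Mapping.keys u \<union> Poly_Mapping.keys v"
  have "Poly_Mapping.keys (u + v) \<subseteq> ?A" by (rule keys_add)
  then have "expo_eval (u + v) p = (\<Prod>i\<in>?A. p i ^ coef (u + v) i)"
    by (intro expo_eval_superset) auto
  also have "\<dots> = (\<Prod>i\<in>?A. p i ^ coef u i) * (\<Prod>i\<in>?A. p i ^ coef v i)"
    by (simp add: lookup_add power_add prod.distrib)
  also have "\<dots> = expo_eval u p * expo_eval v p"
    by (subst (1 2) expo_eval_superset[of ?A]) auto
  finally show ?thesis .
qed

lemma peval_eq_sum:
  assumes "finite A" "Poly_Mapping.keys f \<subseteq> A"
  shows "peval f p = (\<Sum>u\<in>A. coef f u * expo_eval u p)"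
  unfolding peval_def expo_eval_def[symmetric]
  by (rule sum.mono_neutral_left) (use assms in \<open>auto simp: in_keys_iff\<close>)

lemma peval_0 [simp]: "peval 0 p = 0"
  by (simp add: peval_def)

lemma peval_monomial: "peval (monomial u c) p = c * expo_eval u p"
  by (subst peval_eq_sum[of "{u}"]) auto

lemma peval_1 [simp]: "peval 1 p = 1"
  using peval_monomial[of 0 1 p] by (simp add: expo_eval_def)

lemma peval_add: "peval (f + g) p = peval f p + peval g p"
proof -
  let ?A = "Poly_Mapping.keys f \<union> Poly_Mapping.keys g"
  have "Poly_Mapping.keys (f + g) \<subseteq> ?A" by (rule keys_add)
  then have "peval (f + g) p = (\<Sum>u\<in>?A. coef (f + g) u * expo_eval u p)"
    by (intro peval_eq_sum) auto
  also have "\<dots> = (\<Sum>u\<in>?A. coef f u * expo_eval u p) + (\<Sum>u\<in>?A. coef g u * expo_eval u p)"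
    by (simp add: lookup_add distrib_right sum.distrib)
  also have "\<dots> = peval f p + peval g p"
    by (subst (1 2) peval_eq_sum[of ?A]) auto
  finally show ?thesis .
qed

lemma peval_mult: "peval (f * g) p = peval f p * peval g p"
proof (induction f rule: monomials_induct)
  case (monomial u c)
  show ?case
  proof (induction g rule: monomials_induct)
    case (monomial v d)
    show ?case by (simp add: mult_single peval_monomial expo_eval_add)
  next
    case (add f g)
    then show ?case by (simp add: distrib_left peval_add)
  qed
next
  case (add f g)
  then show ?case by (simp add: distrib_right peval_add)
qed

lemma peval_var [simp]: "peval (var i) p = p i"
  by (simp add: var_def peval_monomial expo_eval_def)

lemma peval_cscale [simp]: "peval (cscale c f) p = c * peval f p"
  by (simp add: cscale_eq_mult peval_mult peval_monomial expo_eval_def)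

lemma peval_minus: "peval (f - g) p = peval f p - peval g p"
  by (metis add_diff_cancel_right' diff_add_cancel peval_add)

lemma peval_sum: "peval (sum f A) p = (\<Sum>a\<in>A. peval (f a) p)"
  by (induction A rule: infinite_finite_induct) (auto simp: peval_add)

lemma peval_prod: "peval (prod f A) p = (\<Prod>a\<in>A. peval (f a) p)"
  by (induction A rule: infinite_finite_induct) (auto simp: peval_mult)

lemma peval_power: "peval (f ^ m) p = peval f p ^ m"
  by (induction m) (auto simp: peval_mult)


section \<open>Forms and homogeneous ideals\<close>

lemma expo_degree_add: "expo_degree (u + v) = expo_degree u + expo_degree v"
  by (simp add: expo_degree_def lookup_add sum.distrib)

lemma expo_degree_single [simp]: "expo_degree (monomial i n) = n"
  by (simp add: expo_degree_def lookup_single when_def)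

lemma expo_degree_0 [simp]: "expo_degree 0 = 0"
  by (simp add: expo_degree_def)

lemma forms_iff: "f \<in> forms d \<longleftrightarrow> (\<forall>u. coef f u \<noteq> 0 \<longrightarrow> expo_degree u = d)"
  by (auto simp: forms_def in_keys_iff)

lemma subspace_forms: "cvec.subspace (forms d)"
  by (rule cvec.subspaceI) (auto simp: forms_iff lookup_add, metis add_0)

lemmas forms_0 [simp] = cvec.subspace_0[OF subspace_forms]
lemmas forms_add = cvec.subspace_add[OF subspace_forms]
lemmas forms_diff = cvec.subspace_diff[OF subspace_forms]
lemmas forms_cscale = cvec.subspace_scale[OF subspace_forms]
lemmas forms_sum = cvec.subspace_sum[OF subspace_forms]

lemma forms_monomial: "expo_degree u = d \<Longrightarrow> monomial u c \<in> forms d"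
  by (auto simp: forms_iff lookup_single when_def)

lemma forms_mult: "f \<in> forms d \<Longrightarrow> g \<in> forms e \<Longrightarrow> f * g \<in> forms (d + e)"
  using keys_mult[of f g] by (fastforce simp: forms_def expo_degree_add)

lemma forms_1 [simp]: "1 \<in> forms 0"
  using forms_monomial[of 0 0 1] by simp

lemma forms_var [simp]: "var i \<in> forms 1"
  unfolding var_def by (rule forms_monomial) simp

lemma forms_power: "f \<in> forms d \<Longrightarrow> f ^ m \<in> forms (m * d)"
  by (induction m) (auto intro: forms_mult)

lemma forms_linear_power: "f \<in> forms 1 \<Longrightarrow> f ^ m \<in> forms m"
  using forms_power[of f 1 m] by simp

lemma forms_prod: "finite A \<Longrightarrow> (\<And>a. a \<in> A \<Longrightarrow> f a \<in> forms 1) \<Longrightarrow> prod f A \<in> forms (card A)"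
  by (induction A rule: finite_induct) (auto intro: forms_mult[of _ 1, simplified])

lemma coef_hom_part: "coef (hom_part d f) u = (if expo_degree u = d then coef f u else 0)"
proof -
  have "coef (hom_part d f) u
      = (\<Sum>v\<in>{v \<in> Poly_Mapping.keys f. expo_degree v = d}. if v = u then coef f v else 0)"
    unfolding hom_part_def by (simp add: lookup_sum lookup_single when_def)
  also have "\<dots> = (if expo_degree u = d then coef f u else 0)"
    by (subst sum.delta) (auto simp: in_keys_iff)
  finally show ?thesis .
qed

lemma hom_part_in_forms [simp]: "hom_part d f \<in> forms d"
  by (auto simp: forms_iff coef_hom_part split: if_splits)

lemma hom_part_add: "hom_part d (f + g) = hom_part d f + hom_part d g"
  by (rule poly_mapping_eqI) (simp add: coef_hom_part lookup_add)

lemma hom_part_form: "f \<in> forms e \<Longrightarrow> hom_part d f = (if d = e then f else 0)"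
  by (rule poly_mapping_eqI) (auto simp: coef_hom_part forms_iff)

lemma sum_hom_parts:
  obtains N where "f = (\<Sum>d<N. hom_part d f)"
proof -
  define N where "N = Suc (Max (insert 0 (expo_degree ` Poly_Mapping.keys f)))"
  have N: "expo_degree u < N" if "coef f u \<noteq> 0" for u
    using that unfolding N_def by (intro le_imp_less_Suc Max_ge) (auto simp: in_keys_iff)
  have "f = (\<Sum>d<N. hom_part d f)"
  proof (rule poly_mapping_eqI)
    fix u
    have "coef (\<Sum>d<N. hom_part d f) u = (\<Sum>d<N. if expo_degree u = d then coef f u else 0)"
      by (simp add: lookup_sum coef_hom_part)
    then show "coef f u = coef (\<Sum>d<N. hom_part d f) u"
      using N[of u] by auto
  qed
  then show thesis by (rule that)
qed

lemma hom_part_mult_form: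
  assumes g: "g \<in> forms e"
  shows "hom_part (e + d) (g * f) = g * hom_part d f"
proof (induction f rule: monomials_induct)
  case (monomial u c)
  have m: "monomial u c \<in> forms (expo_degree u)" by (simp add: forms_monomial)
  have "g * monomial u c \<in> forms (e + expo_degree u)" by (rule forms_mult[OF g m])
  then show ?case using hom_part_form[OF m, of d] by (simp add: hom_part_form)
next
  case (add f g)
  then show ?case by (simp add: distrib_left hom_part_add)
qed

lemma forms_Suc_induct [consumes 1, case_names zero add mult]:
  assumes "f \<in> forms (Suc d)" and "P 0" and "\<And>f g. P f \<Longrightarrow> P g \<Longrightarrow> P (f + g)"
    and m: "\<And>k h. h \<in> forms d \<Longrightarrow> P (var k * h)"
  shows "P f"
proof -
  have mono: "P (monomial u c)" if "expo_degree u = Suc d" for u c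
  proof -
    have "\<exists>k. coef u k \<noteq> 0"
      using that unfolding expo_degree_def by (metis nat.distinct(1) sum.neutral)
    then obtain k where k: "coef u k \<noteq> 0" ..
    define v where "v = u - monomial k 1"
    have u: "u = monomial k 1 + v"
      by (rule poly_mapping_eqI) (use k in \<open>auto simp: v_def lookup_add lookup_minus lookup_single when_def\<close>)
    then have "expo_degree v = d" using that by (simp add: expo_degree_add)
    then have "P (var k * monomial v c)" by (intro m forms_monomial)
    then show ?thesis by (simp add: u var_def mult_single)
  qed
  have "P (\<Sum>u\<in>A. monomial u (coef f u))" if "finite A" "A \<subseteq> Poly_Mapping.keys f" for A
    using that
  proof (induction A rule: finite_induct)
    case (insert u A)
    then have "expo_degree u = Suc d" using assms(1) by (auto simp: forms_def)
    with insert show ?case by (simp add: assms(3) mono)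
  qed (simp add: assms(2))
  from this[OF finite_keys[of f]] show ?thesis
    by (metis sum_monomials subset_refl)
qed

lemma forms_0_const:
  assumes "f \<in> forms 0" shows "f = monomial 0 (coef f 0)"
proof (rule poly_mapping_eqI)
  fix u
  have "u = 0" if "coef f u \<noteq> 0"
    using assms that by (auto simp: forms_iff expo_degree_def intro!: poly_mapping_eqI)
  then show "coef f u = coef (monomial 0 (coef f 0)) u"
    by (auto simp: lookup_single when_def)
qed

context
  fixes I :: "('n::finite, 'k::field) mpoly set"
  assumes I: "hom_ideal I"
begin

lemma ideal_0: "0 \<in> I"
  using I by (simp add: hom_ideal_def)

lemma ideal_add: "f \<in> I \<Longrightarrow> g \<in> I \<Longrightarrow> f + g \<in> I"
  using I by (simp add: hom_ideal_def)

lemma ideal_mult: "f \<in> I \<Longrightarrow> r * f \<in> I"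
  using I by (simp add: hom_ideal_def)

lemma ideal_mult_right: "f \<in> I \<Longrightarrow> f * r \<in> I"
  using ideal_mult[of f r] by (simp add: mult.commute)

lemma ideal_hom_part: "f \<in> I \<Longrightarrow> hom_part d f \<in> I"
  using I by (simp add: hom_ideal_def)

lemma ideal_cscale: "f \<in> I \<Longrightarrow> cscale c f \<in> I"
  by (simp add: cscale_eq_mult ideal_mult)

lemma subspace_ideal: "cvec.subspace I"
  by (rule cvec.subspaceI) (auto simp: ideal_0 ideal_add ideal_cscale)

lemmas ideal_diff = cvec.subspace_diff[OF subspace_ideal]
lemmas ideal_sum = cvec.subspace_sum[OF subspace_ideal]

lemma ideal_add_iff: "f - g \<in> I \<Longrightarrow> f \<in> I \<longleftrightarrow> g \<in> I"
  using ideal_add[of "f - g" g] ideal_diff[of f "f - g"] by auto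

lemma ideal_cscale_iff: "c \<noteq> 0 \<Longrightarrow> cscale c f \<in> I \<longleftrightarrow> f \<in> I"
  using ideal_cscale[of "cscale c f" "inverse c"] ideal_cscale[of f c] by auto

lemma ideal_by_hom_parts: "(\<And>d. hom_part d f \<in> I) \<Longrightarrow> f \<in> I"
  using sum_hom_parts[of f] ideal_sum by metis

lemma ideal_all_iff: "1 \<in> I \<longleftrightarrow> I = UNIV"
  using ideal_mult[of 1] by auto

lemma form_not_in_ideal:
  assumes J: "hom_ideal J" and "\<not> J \<subseteq> I"
  obtains f d where "f \<in> J" "f \<in> forms d" "f \<notin> I"
proof -
  from assms obtain f where f: "f \<in> J" "f \<notin> I" by auto
  then obtain d where "hom_part d f \<notin> I" using ideal_by_hom_parts by blast
  moreover have "hom_part d f \<in> J" using J f by (simp add: hom_ideal_def)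
  ultimately show thesis by (intro that[of "hom_part d f" d]) auto
qed

end

lemma hom_ideal_UNIV: "hom_ideal UNIV"
  by (simp add: hom_ideal_def)

lemma hom_ideal_Inter: "(\<And>Q. Q \<in> S \<Longrightarrow> hom_ideal Q) \<Longrightarrow> hom_ideal (\<Inter>S)"
  unfolding hom_ideal_def by blast

lemma hom_ideal_Int: "hom_ideal A \<Longrightarrow> hom_ideal B \<Longrightarrow> hom_ideal (A \<inter> B)"
  unfolding hom_ideal_def by blast

definition ideal_plus :: "('n::finite, 'k::field) mpoly set \<Rightarrow> ('n, 'k) mpoly set \<Rightarrow> ('n, 'k) mpoly set" where
  "ideal_plus A B = {a + b | a b. a \<in> A \<and> b \<in> B}"

lemma hom_ideal_plus:
  assumes A: "hom_ideal A" and B: "hom_ideal B" shows "hom_ideal (ideal_plus A B)"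
  unfolding hom_ideal_def
proof (intro conjI ballI allI)
  show "0 \<in> ideal_plus A B"
    unfolding ideal_plus_def using ideal_0[OF A] ideal_0[OF B] by force
next
  fix f g assume "f \<in> ideal_plus A B" "g \<in> ideal_plus A B"
  then obtain a b a' b' where "a \<in> A" "b \<in> B" "a' \<in> A" "b' \<in> B" "f = a + b" "g = a' + b'"
    by (auto simp: ideal_plus_def)
  moreover have "a + b + (a' + b') = (a + a') + (b + b')" by (simp add: ac_simps)
  ultimately show "f + g \<in> ideal_plus A B"
    unfolding ideal_plus_def using ideal_add[OF A] ideal_add[OF B] by blast
next
  fix f r assume "f \<in> ideal_plus A B"
  then show "r * f \<in> ideal_plus A B"
    unfolding ideal_plus_def using ideal_mult[OF A] ideal_mult[OF B] by (fastforce simp: distrib_left)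
next
  fix f d assume "f \<in> ideal_plus A B"
  then show "hom_part d f \<in> ideal_plus A B"
    unfolding ideal_plus_def using ideal_hom_part[OF A] ideal_hom_part[OF B]
    by (fastforce simp: hom_part_add)
qed

lemma ideal_plus_superset:
  assumes A: "hom_ideal A" and B: "hom_ideal B"
  shows "A \<subseteq> ideal_plus A B" "B \<subseteq> ideal_plus A B"
  unfolding ideal_plus_def using ideal_0[OF A] ideal_0[OF B] by force+

lemma peval_form_scale:
  assumes "g \<in> forms d" shows "peval g (\<lambda>i. c * p i) = c ^ d * peval g p"
proof -
  have "coef g u * expo_eval u (\<lambda>i. c * p i) = c ^ d * (coef g u * expo_eval u p)" for u
  proof (cases "coef g u = 0")
    case False
    then have "expo_degree u = d" using assms by (auto simp: forms_iff)
    then have "(\<Prod>i\<in>UNIV. c ^ coef u i) = c ^ d"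
      by (metis expo_degree_def power_sum)
    then show ?thesis
      by (simp add: expo_eval_superset[of UNIV] power_mult_distrib prod.distrib)
  qed simp
  then show ?thesis
    unfolding peval_eq_sum[OF finite_keys subset_refl] sum_distrib_left by (intro sum.cong) auto
qed

section \<open>Codimension by families of vectors\<close>

text \<open>
  The Hilbert function is a difference of two dimensions.  Counting families that are independent or
  spanning modulo a subspace avoids quotient spaces, and the index set, rather than a set of vectors,
  carries the count, so that repetitions need no attention.
\<close>

definition indep_mod :: "('a \<Rightarrow>\<^sub>0 'k::field) set \<Rightarrow> 'i set \<Rightarrow> ('i \<Rightarrow> ('a \<Rightarrow>\<^sub>0 'k)) \<Rightarrow> bool" where
  "indep_mod U A b \<longleftrightarrow> (\<forall>c. (\<Sum>a\<in>A. cscale (c a) (b a)) \<in> U \<longrightarrow> (\<forall>a\<in>A. c a = 0))"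

definition spans_mod ::
  "('a \<Rightarrow>\<^sub>0 'k::field) set \<Rightarrow> 'i set \<Rightarrow> ('i \<Rightarrow> ('a \<Rightarrow>\<^sub>0 'k)) \<Rightarrow> ('a \<Rightarrow>\<^sub>0 'k) set \<Rightarrow> bool" where
  "spans_mod U A b V \<longleftrightarrow> (\<forall>v\<in>V. \<exists>c. v - (\<Sum>a\<in>A. cscale (c a) (b a)) \<in> U)"

definition fin_dim :: "('a \<Rightarrow>\<^sub>0 'k::field) set \<Rightarrow> bool" where
  "fin_dim V \<longleftrightarrow> (\<exists>T. finite T \<and> V \<subseteq> cvec.span T)"

lemma fin_dim_subset: "fin_dim V \<Longrightarrow> U \<subseteq> V \<Longrightarrow> fin_dim U"
  by (auto simp: fin_dim_def)

lemma fin_dim_independent_finite: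
  assumes "fin_dim V" "B \<subseteq> V" "cvec.independent B" shows "finite B"
  using assms cvec.independent_span_bound unfolding fin_dim_def by (meson subset_trans)

lemma span_family:
  assumes "finite A" "v \<in> cvec.span (f ` A)"
  obtains c where "v = (\<Sum>a\<in>A. cscale (c a) (f a))"
proof -
  let ?S = "{\<Sum>a\<in>A. cscale (c a) (f a) | c. True}"
  have "cvec.subspace ?S"
  proof (rule cvec.subspaceI)
    show "0 \<in> ?S" by (auto intro!: exI[of _ "\<lambda>_. 0"])
  next
    fix x y assume "x \<in> ?S" "y \<in> ?S"
    then obtain c d where "x = (\<Sum>a\<in>A. cscale (c a) (f a))" "y = (\<Sum>a\<in>A. cscale (d a) (f a))"
      by auto
    then have "x + y = (\<Sum>a\<in>A. cscale (c a + d a) (f a))"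
      by (simp add: cvec.scale_left_distrib sum.distrib)
    then show "x + y \<in> ?S" by auto
  next
    fix e x assume "x \<in> ?S"
    then obtain c where "x = (\<Sum>a\<in>A. cscale (c a) (f a))" by auto
    then have "cscale e x = (\<Sum>a\<in>A. cscale (e * c a) (f a))"
      by (simp add: cvec.scale_sum_right)
    then show "cscale e x \<in> ?S" by auto
  qed
  moreover have "f ` A \<subseteq> ?S"
  proof
    fix x assume "x \<in> f ` A"
    then obtain a where a: "a \<in> A" "x = f a" by auto
    have "(\<Sum>a'\<in>A. cscale (if a' = a then 1 else 0) (f a')) = (\<Sum>a'\<in>A. if a' = a then f a' else 0)"
      by (rule sum.cong) auto
    then have "f a = (\<Sum>a'\<in>A. cscale (if a' = a then 1 else 0) (f a'))"
      using assms(1) a by simp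
    then show "x \<in> ?S" using a by auto
  qed
  ultimately have "cvec.span (f ` A) \<subseteq> ?S" by (rule cvec.span_minimal[rotated])
  with assms(2) that show thesis by auto
qed

lemma indep_mod_subset:
  assumes "indep_mod U A b" "B \<subseteq> A" "finite A"
  shows "indep_mod U B b"
  unfolding indep_mod_def
proof (intro allI impI)
  fix c assume c: "(\<Sum>a\<in>B. cscale (c a) (b a)) \<in> U"
  define d where "d a = (if a \<in> B then c a else 0)" for a
  have "(\<Sum>a\<in>A. cscale (d a) (b a)) = (\<Sum>a\<in>B. cscale (c a) (b a))"
    by (rule sum.mono_neutral_cong_right) (use assms in \<open>auto simp: d_def\<close>)
  with assms(1) c have "\<forall>a\<in>A. d a = 0" unfolding indep_mod_def by metis
  with assms(2) show "\<forall>a\<in>B. c a = 0" unfolding d_def by (metis subsetD)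
qed

lemma indep_mod_not_span:
  assumes U: "cvec.subspace U" and "finite A" "a \<notin> A" and i: "indep_mod U (insert a A) b"
  shows "b a - (\<Sum>a\<in>A. cscale (c a) (b a)) \<notin> U"
proof
  assume m: "b a - (\<Sum>a\<in>A. cscale (c a) (b a)) \<in> U"
  define d where "d = (\<lambda>x. if x = a then 1 else - c x)"
  have "(\<Sum>x\<in>A. cscale (d x) (b x)) = (\<Sum>x\<in>A. - cscale (c x) (b x))"
    by (rule sum.cong) (use assms in \<open>auto simp: d_def\<close>)
  then have "(\<Sum>x\<in>insert a A. cscale (d x) (b x)) = b a - (\<Sum>a\<in>A. cscale (c a) (b a))"
    using assms by (simp add: d_def sum_negf)
  with i m have "d a = 0" unfolding indep_mod_def by (metis insertI1)
  then show False by (simp add: d_def)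
qed

lemma indep_mod_extends_basis:
  assumes U: "cvec.subspace U" and U0: "cvec.independent U0" "cvec.span U0 = U" "finite U0"
    and "finite A" "indep_mod U A b"
  shows "cvec.independent (U0 \<union> b ` A) \<and> card (U0 \<union> b ` A) = card U0 + card A"
  using assms(5,6)
proof (induction A rule: finite_induct)
  case (insert a A)
  then have "indep_mod U A b" by (blast intro: indep_mod_subset)
  with insert have IH: "cvec.independent (U0 \<union> b ` A)" "card (U0 \<union> b ` A) = card U0 + card A"
    by auto
  have "b a \<notin> cvec.span (U0 \<union> b ` A)"
  proof
    assume "b a \<in> cvec.span (U0 \<union> b ` A)"
    then obtain x y where "b a = x + y" "x \<in> U" "y \<in> cvec.span (b ` A)"
      unfolding cvec.span_Un U0(2) by auto
    moreover from this(3) obtain c where "y = (\<Sum>a\<in>A. cscale (c a) (b a))"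
      using insert(1) by (auto elim: span_family)
    ultimately show False
      using indep_mod_not_span[OF U insert(1,2,4), of c] by simp
  qed
  moreover from this have "b a \<notin> U0 \<union> b ` A" using cvec.span_base by metis
  moreover have "finite (U0 \<union> b ` A)" using insert U0 by auto
  ultimately show ?case
    using IH insert(1,2) by (simp add: cvec.independent_insertI)
qed (use U0 in auto)

lemma basis_of_fin_dim:
  assumes "cvec.subspace U" "fin_dim U"
  obtains B where "B \<subseteq> U" "cvec.independent B" "cvec.span B = U" "finite B" "card B = cvec.dim U"
proof -
  obtain B where B: "B \<subseteq> U" "cvec.independent B" "U \<subseteq> cvec.span B" "card B = cvec.dim U"
    using cvec.basis_exists[of U] by blast
  moreover have "cvec.span B = U"
    using B assms(1) by (intro cvec.span_subspace)
  moreover have "finite B" using fin_dim_independent_finite[OF assms(2)] B by blast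
  ultimately show thesis using that by blast
qed

context
  fixes U V :: "('a \<Rightarrow>\<^sub>0 'k::field) set"
  assumes U: "cvec.subspace U" and V: "cvec.subspace V" and fin: "fin_dim V" and UV: "U \<subseteq> V"
begin

text \<open>
  Extend a basis of the smaller space to one of the larger space; the added vectors are the family.
\<close>

lemma relative_basis:
  obtains b :: "nat \<Rightarrow> ('a \<Rightarrow>\<^sub>0 'k)" and m
  where "\<And>i. i < m \<Longrightarrow> b i \<in> V" "indep_mod U {..<m} b" "spans_mod U {..<m} b V"
    "cvec.dim V = cvec.dim U + m"
proof -
  obtain U0 where U0: "U0 \<subseteq> U" "cvec.independent U0" "cvec.span U0 = U" "finite U0" "card U0 = cvec.dim U"
    using basis_of_fin_dim[OF U fin_dim_subset[OF fin UV]] by blast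
  obtain B where B: "U0 \<subseteq> B" "B \<subseteq> V" "cvec.independent B" "V \<subseteq> cvec.span B"
    using cvec.maximal_independent_subset_extend[of U0 V] U0 UV by (metis subset_trans)
  have finB: "finite B" using fin_dim_independent_finite[OF fin] B by blast
  define m where "m = card (B - U0)"
  obtain b where b: "bij_betw b {..<m} (B - U0)"
    using ex_bij_betw_nat_finite[of "B - U0"] finB unfolding m_def by (auto simp: lessThan_atLeast0)
  then have im: "b ` {..<m} = B - U0" and inj: "inj_on b {..<m}" by (auto simp: bij_betw_def)
  have "cvec.dim V = card B" using B by (simp add: cvec.basis_card_eq_dim)
  then have d: "cvec.dim V = cvec.dim U + m"
    using B(1) finB U0 card_mono[of B U0] by (simp add: m_def card_Diff_subset)
  have "indep_mod U {..<m} b"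
    unfolding indep_mod_def
  proof (intro allI impI ballI, rule ccontr)
    fix c i assume c: "(\<Sum>i<m. cscale (c i) (b i)) \<in> U" and i: "i \<in> {..<m}" "c i \<noteq> 0"
    let ?S = "cvec.span (B - {b i})"
    have bi: "b i \<in> B - U0" using im i by auto
    have "(\<Sum>i<m. cscale (c i) (b i)) \<in> ?S"
      using c U0(3) cvec.span_mono[of U0 "B - {b i}"] bi B(1) by auto
    moreover have "(\<Sum>k\<in>{..<m}-{i}. cscale (c k) (b k)) \<in> ?S"
    proof (intro cvec.span_sum cvec.span_scale cvec.span_base)
      fix k assume "k \<in> {..<m} - {i}"
      then show "b k \<in> B - {b i}" using im inj i by (auto dest: inj_onD)
    qed
    ultimately have "(\<Sum>i<m. cscale (c i) (b i)) - (\<Sum>k\<in>{..<m}-{i}. cscale (c k) (b k)) \<in> ?S"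
      by (rule cvec.span_diff)
    also have "(\<Sum>i<m. cscale (c i) (b i)) - (\<Sum>k\<in>{..<m}-{i}. cscale (c k) (b k)) = cscale (c i) (b i)"
      using i by (simp add: sum.remove[of "{..<m}" i])
    finally have "cscale (inverse (c i)) (cscale (c i) (b i)) \<in> ?S" by (rule cvec.span_scale)
    then have "b i \<in> ?S" using i by simp
    then show False using B(3) bi by (auto simp: cvec.dependent_def)
  qed
  moreover have "spans_mod U {..<m} b V"
    unfolding spans_mod_def
  proof
    fix v assume "v \<in> V"
    moreover have "B = U0 \<union> b ` {..<m}" using im B(1) by auto
    ultimately have "v \<in> cvec.span (U0 \<union> b ` {..<m})" using B(4) by auto
    then obtain x y where xy: "v = x + y" "x \<in> U" "y \<in> cvec.span (b ` {..<m})"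
      unfolding cvec.span_Un U0(3) by auto
    moreover from xy(3) obtain c where "y = (\<Sum>a<m. cscale (c a) (b a))"
      using span_family[OF finite_lessThan] by metis
    ultimately have "v - (\<Sum>a<m. cscale (c a) (b a)) \<in> U" by simp
    then show "\<exists>c. v - (\<Sum>a<m. cscale (c a) (b a)) \<in> U" by blast
  qed
  moreover have "b i \<in> V" if "i < m" for i using im B(2) that by auto
  ultimately show thesis using that d by blast
qed

lemma card_indep_mod_le:
  assumes "finite A" "b ` A \<subseteq> V" "indep_mod U A b"
  shows "cvec.dim U + card A \<le> cvec.dim V"
proof -
  obtain U0 where U0: "U0 \<subseteq> U" "cvec.independent U0" "cvec.span U0 = U" "finite U0" "card U0 = cvec.dim U"
    using basis_of_fin_dim[OF U fin_dim_subset[OF fin UV]] by blast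
  obtain B where B: "cvec.span B = V" "finite B" "card B = cvec.dim V"
    using basis_of_fin_dim[OF V fin] by blast
  have "cvec.independent (U0 \<union> b ` A) \<and> card (U0 \<union> b ` A) = card U0 + card A"
    by (rule indep_mod_extends_basis[OF U U0(2,3,4) assms(1,3)])
  moreover have "U0 \<union> b ` A \<subseteq> cvec.span B" using B(1) U0(1) UV assms(2) by auto
  ultimately show ?thesis
    using cvec.independent_span_bound[OF B(2), of "U0 \<union> b ` A"] B(3) U0(5) by auto
qed

lemma card_spans_mod_ge:
  assumes "finite A" "spans_mod U A b V"
  shows "cvec.dim V \<le> cvec.dim U + card A"
proof -
  obtain U0 where U0: "U0 \<subseteq> U" "cvec.independent U0" "cvec.span U0 = U" "finite U0" "card U0 = cvec.dim U"
    using basis_of_fin_dim[OF U fin_dim_subset[OF fin UV]] by blast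
  have "V \<subseteq> cvec.span (U0 \<union> b ` A)"
  proof
    fix v assume "v \<in> V"
    then obtain c where c: "v - (\<Sum>a\<in>A. cscale (c a) (b a)) \<in> cvec.span U0"
      using assms(2) U0(3) unfolding spans_mod_def by blast
    have "(\<Sum>a\<in>A. cscale (c a) (b a)) \<in> cvec.span (b ` A)"
      by (intro cvec.span_sum cvec.span_scale cvec.span_base) auto
    with c have "(v - (\<Sum>a\<in>A. cscale (c a) (b a))) + (\<Sum>a\<in>A. cscale (c a) (b a)) \<in> cvec.span (U0 \<union> b ` A)"
      unfolding cvec.span_Un by blast
    then show "v \<in> cvec.span (U0 \<union> b ` A)" by simp
  qed
  then have "cvec.dim V \<le> card (U0 \<union> b ` A)"
    using assms(1) U0(4) by (intro cvec.dim_le_card) auto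
  also have "\<dots> \<le> card U0 + card (b ` A)" by (rule card_Un_le)
  also have "\<dots> \<le> card U0 + card A" using card_image_le[OF assms(1)] by auto
  finally show ?thesis using U0(5) by simp
qed

lemma dim_le_fin_dim: "cvec.dim U \<le> cvec.dim V"
  using relative_basis by (metis le_add1)

lemma dim_eq_fin_dim:
  assumes "cvec.dim U = cvec.dim V" shows "U = V"
proof -
  obtain b :: "nat \<Rightarrow> ('a \<Rightarrow>\<^sub>0 'k)" and m
    where "indep_mod U {..<m} b" "spans_mod U {..<m} b V" "cvec.dim V = cvec.dim U + m"
    using relative_basis by metis
  with assms have "spans_mod U {} b V" by simp
  with UV show ?thesis by (auto simp: spans_mod_def)
qed

end

text \<open>
  A basis of \<open>S\<close> modulo \<open>S \<inter> T\<close> is also one of \<open>S + T\<close> modulo \<open>T\<close>, by the second isomorphism theorem.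
\<close>

lemma dim_plus_Int:
  fixes S T :: "('a \<Rightarrow>\<^sub>0 'k::field) set"
  assumes S: "cvec.subspace S" and T: "cvec.subspace T" and fin: "fin_dim V" "S \<subseteq> V" "T \<subseteq> V"
    and V: "cvec.subspace V"
  shows "cvec.dim {x + y |x y. x \<in> S \<and> y \<in> T} + cvec.dim (S \<inter> T) = cvec.dim S + cvec.dim T"
proof -
  let ?P = "{x + y |x y. x \<in> S \<and> y \<in> T}"
  have P: "cvec.subspace ?P" by (rule cvec.subspace_sums[OF S T])
  have "?P \<subseteq> V" using cvec.subspace_add[OF V] fin by auto
  then have Pfin: "fin_dim ?P" using fin_dim_subset fin by blast
  have Sfin: "fin_dim S" using fin_dim_subset fin by blast
  have TP: "T \<subseteq> ?P" using cvec.subspace_0[OF S] by force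
  have SP: "S \<subseteq> ?P" using cvec.subspace_0[OF T] by force
  have ST: "cvec.subspace (S \<inter> T)" using S T by (rule cvec.subspace_inter)
  obtain b :: "nat \<Rightarrow> ('a \<Rightarrow>\<^sub>0 'k)" and m
    where b: "\<And>i. i < m \<Longrightarrow> b i \<in> S" "indep_mod (S \<inter> T) {..<m} b" "spans_mod (S \<inter> T) {..<m} b S"
      "cvec.dim S = cvec.dim (S \<inter> T) + m"
    using relative_basis[OF ST S Sfin Int_lower1] by metis
  have lc: "(\<Sum>i<m. cscale (c i) (b i)) \<in> S" for c
    using b(1) S by (intro cvec.subspace_sum cvec.subspace_scale) auto
  have "indep_mod T {..<m} b"
    using b(2) lc unfolding indep_mod_def by blast
  then have 1: "cvec.dim T + m \<le> cvec.dim ?P"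
    using card_indep_mod_le[OF T P Pfin TP, of "{..<m}" b] b(1) SP by auto
  have "spans_mod T {..<m} b ?P"
    unfolding spans_mod_def
  proof
    fix v assume "v \<in> ?P"
    then obtain x y where xy: "v = x + y" "x \<in> S" "y \<in> T" by auto
    then obtain c where "x - (\<Sum>i<m. cscale (c i) (b i)) \<in> T"
      using b(3) unfolding spans_mod_def by blast
    then have "x - (\<Sum>i<m. cscale (c i) (b i)) + y \<in> T" using xy T by (intro cvec.subspace_add)
    also have "x - (\<Sum>i<m. cscale (c i) (b i)) + y = v - (\<Sum>i<m. cscale (c i) (b i))"
      by (simp add: xy)
    finally show "\<exists>c. v - (\<Sum>i<m. cscale (c i) (b i)) \<in> T" by blast
  qed
  then have "cvec.dim ?P \<le> cvec.dim T + m"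
    using card_spans_mod_ge[OF T P Pfin TP, of "{..<m}" b] by simp
  with 1 b(4) show ?thesis by simp
qed


section \<open>The Hilbert function\<close>

lemma finite_expo_degree: "finite {u :: 'n::finite expo. expo_degree u = d}"
proof (induction d)
  case 0
  have "u = 0" if "expo_degree u = 0" for u :: "'n expo"
    using that by (auto simp: expo_degree_def intro!: poly_mapping_eqI)
  then have "{u :: 'n expo. expo_degree u = 0} \<subseteq> {0}" by auto
  then show ?case by (rule finite_subset) simp
next
  case (Suc d)
  have "{u :: 'n expo. expo_degree u = Suc d} \<subseteq> (\<Union>k. (\<lambda>v. monomial k 1 + v) ` {v. expo_degree v = d})"
  proof
    fix u :: "'n expo" assume u: "u \<in> {u. expo_degree u = Suc d}"
    then have "\<exists>k. coef u k \<noteq> 0"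
      unfolding expo_degree_def by (metis (mono_tags) mem_Collect_eq nat.distinct(1) sum.neutral)
    then obtain k where k: "coef u k \<noteq> 0" ..
    have e: "u = monomial k 1 + (u - monomial k 1)"
      by (rule poly_mapping_eqI) (use k in \<open>auto simp: lookup_add lookup_minus lookup_single when_def\<close>)
    then have "expo_degree u = Suc (expo_degree (u - monomial k 1))"
      by (metis One_nat_def expo_degree_add expo_degree_single plus_1_eq_Suc)
    with u e show "u \<in> (\<Union>k. (\<lambda>v. monomial k 1 + v) ` {v. expo_degree v = d})" by auto
  qed
  then show ?case by (rule finite_subset) (use Suc in auto)
qed

lemma fin_dim_forms: "fin_dim (forms d :: ('n::finite, 'k::field) mpoly set)"
  unfolding fin_dim_def
proof (intro exI conjI subsetI)
  let ?T = "(\<lambda>u. monomial u 1) ` {u :: 'n expo. expo_degree u = d} :: ('n, 'k) mpoly set"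
  show "finite ?T" using finite_expo_degree by blast
  fix f :: "('n, 'k) mpoly" assume f: "f \<in> forms d"
  have "(\<Sum>u\<in>Poly_Mapping.keys f. cscale (coef f u) (monomial u 1)) \<in> cvec.span ?T"
    by (intro cvec.span_sum cvec.span_scale cvec.span_base) (use f in \<open>auto simp: forms_def\<close>)
  also have "(\<Sum>u\<in>Poly_Mapping.keys f. cscale (coef f u) (monomial u 1)) = f"
    by (subst (3) sum_monomials) (simp add: cscale_eq_mult mult_single)
  finally show "f \<in> cvec.span ?T" .
qed

context
  fixes I :: "('n::finite, 'k::field) mpoly set"
  assumes I: "hom_ideal I"
begin

lemma subspace_Int_forms: "cvec.subspace (I \<inter> forms d)"
  by (intro cvec.subspace_inter subspace_ideal[OF I] subspace_forms)

lemma lincomb_forms: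
  assumes "\<And>a. a \<in> A \<Longrightarrow> b a \<in> forms d" shows "(\<Sum>a\<in>A. cscale (c a) (b a)) \<in> forms d"
  by (rule forms_sum, rule forms_cscale, rule assms)

lemma indep_mod_Int_forms:
  assumes "b ` A \<subseteq> forms d"
  shows "indep_mod (I \<inter> forms d) A b \<longleftrightarrow> indep_mod I A b"
proof -
  have "(\<Sum>a\<in>A. cscale (c a) (b a)) \<in> forms d" for c
    using assms by (intro lincomb_forms) auto
  then show ?thesis by (simp add: indep_mod_def)
qed

lemma spans_mod_Int_forms:
  assumes "b ` A \<subseteq> forms d"
  shows "spans_mod (I \<inter> forms d) A b (forms d) \<longleftrightarrow> spans_mod I A b (forms d)"
proof -
  have "v - (\<Sum>a\<in>A. cscale (c a) (b a)) \<in> forms d" if "v \<in> forms d" for v c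
    using assms that by (intro forms_diff lincomb_forms) auto
  then show ?thesis unfolding spans_mod_def by blast
qed

lemma dim_forms_eq: "cvec.dim (forms d :: ('n, 'k) mpoly set) = cvec.dim (I \<inter> forms d) + hilbert I d"
proof -
  have "cvec.dim (I \<inter> forms d) \<le> cvec.dim (forms d :: ('n, 'k) mpoly set)"
    by (rule dim_le_fin_dim[OF subspace_Int_forms subspace_forms fin_dim_forms Int_lower2])
  then show ?thesis unfolding hilbert_def by simp
qed

lemma hilbert_basis:
  obtains b where "\<And>i. i < hilbert I d \<Longrightarrow> b i \<in> forms d" "indep_mod I {..<hilbert I d} b"
    "spans_mod I {..<hilbert I d} b (forms d)"
proof -
  obtain b :: "nat \<Rightarrow> ('n, 'k) mpoly" and m
    where b: "\<And>i. i < m \<Longrightarrow> b i \<in> forms d" "indep_mod (I \<inter> forms d) {..<m} b"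
      "spans_mod (I \<inter> forms d) {..<m} b (forms d)"
      "cvec.dim (forms d :: ('n, 'k) mpoly set) = cvec.dim (I \<inter> forms d) + m"
    using relative_basis[OF subspace_Int_forms[of d] subspace_forms[of d] fin_dim_forms[of d] Int_lower2]
    by metis
  then have "m = hilbert I d" using dim_forms_eq[of d] by simp
  moreover have "b ` {..<m} \<subseteq> forms d" using b(1) by auto
  ultimately show thesis
    using that[of b] b indep_mod_Int_forms spans_mod_Int_forms by metis
qed

lemma indep_card_le_hilbert:
  assumes "finite A" "b ` A \<subseteq> forms d" "indep_mod I A b"
  shows "card A \<le> hilbert I d"
proof -
  have "cvec.dim (I \<inter> forms d) + card A \<le> cvec.dim (forms d :: ('n, 'k) mpoly set)"
    by (rule card_indep_mod_le[OF subspace_Int_forms subspace_forms fin_dim_forms Int_lower2 assms(1,2)])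
      (use indep_mod_Int_forms[OF assms(2)] assms(3) in blast)
  then show ?thesis using dim_forms_eq[of d] by simp
qed

text \<open>
  A vector outside the span modulo \<open>I\<close> would enlarge the independent family beyond the codimension.
  The index \<open>None\<close> stands for this vector.
\<close>

lemma indep_imp_spans:
  assumes A: "finite A" "b ` A \<subseteq> forms d" "indep_mod I A b" and c: "hilbert I d \<le> card A"
  shows "spans_mod I A b (forms d)"
  unfolding spans_mod_def
proof (intro ballI, rule ccontr)
  fix v assume v: "v \<in> forms d" and n: "\<nexists>c. v - (\<Sum>a\<in>A. cscale (c a) (b a)) \<in> I"
  let ?A = "insert None (Some ` A)" and ?b = "\<lambda>x. case x of None \<Rightarrow> v | Some a \<Rightarrow> b a"
  have S: "(\<Sum>x\<in>?A. cscale (c x) (?b x)) = cscale (c None) v + (\<Sum>a\<in>A. cscale (c (Some a)) (b a))" for c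
    using A(1) by (simp add: sum.reindex)
  have "indep_mod I ?A ?b"
    unfolding indep_mod_def S
  proof (intro allI impI)
    fix c assume m: "cscale (c None) v + (\<Sum>a\<in>A. cscale (c (Some a)) (b a)) \<in> I"
    have "c None = 0"
    proof (rule ccontr)
      assume "c None \<noteq> 0"
      let ?d = "\<lambda>a. - inverse (c None) * c (Some a)"
      have "cscale (inverse (c None)) (cscale (c None) v + (\<Sum>a\<in>A. cscale (c (Some a)) (b a))) \<in> I"
        using m by (rule ideal_cscale[OF I])
      also have "cscale (inverse (c None)) (cscale (c None) v + (\<Sum>a\<in>A. cscale (c (Some a)) (b a)))
          = v - (\<Sum>a\<in>A. cscale (?d a) (b a))"
        using \<open>c None \<noteq> 0\<close> by (simp add: cvec.scale_right_distrib cvec.scale_sum_right sum_negf)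
      finally show False using n by metis
    qed
    moreover from this have "\<forall>a\<in>A. c (Some a) = 0"
      using A(3) m unfolding indep_mod_def by (auto dest: spec[of _ "\<lambda>a. c (Some a)"])
    ultimately show "\<forall>x\<in>?A. c x = 0" by auto
  qed
  then have "card ?A \<le> hilbert I d"
    using A v by (intro indep_card_le_hilbert[of _ ?b]) auto
  then show False using c A(1) by (simp add: card_image)
qed

lemma hilbert_antimono:
  assumes J: "hom_ideal J" "I \<subseteq> J" shows "hilbert J d \<le> hilbert I d"
proof -
  have "cvec.dim (I \<inter> forms d) \<le> cvec.dim (J \<inter> forms d)"
    using J by (intro dim_le_fin_dim cvec.subspace_inter subspace_forms subspace_ideal I
        fin_dim_subset[OF fin_dim_forms Int_lower2]) auto
  then show ?thesis unfolding hilbert_def by simp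
qed

lemma hilbert_eq_imp_eq:
  assumes J: "hom_ideal J" "I \<inter> forms d \<subseteq> J" and "hilbert I d \<le> hilbert J d"
  shows "J \<inter> forms d = I \<inter> forms d"
proof -
  have f: "fin_dim (J \<inter> forms d)" using fin_dim_subset[OF fin_dim_forms] by blast
  have s: "cvec.subspace (J \<inter> forms d)" by (intro cvec.subspace_inter subspace_forms subspace_ideal J)
  have i: "I \<inter> forms d \<subseteq> J \<inter> forms d" using J by auto
  have "cvec.dim (J \<inter> forms d) + hilbert J d = cvec.dim (I \<inter> forms d) + hilbert I d"
    using dim_forms_eq[of d] dim_le_fin_dim[OF s subspace_forms fin_dim_forms]
    unfolding hilbert_def by simp
  with dim_le_fin_dim[OF subspace_Int_forms s f i] assms(3)
  have "cvec.dim (I \<inter> forms d) = cvec.dim (J \<inter> forms d)" by simp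
  from dim_eq_fin_dim[OF subspace_Int_forms s f i this] show ?thesis by simp
qed

lemma hilbert_eq_0_iff: "hilbert I d = 0 \<longleftrightarrow> forms d \<subseteq> I"
proof
  assume "hilbert I d = 0"
  moreover obtain b where "spans_mod I {..<hilbert I d} b (forms d)"
    using hilbert_basis[of d] by metis
  ultimately have "spans_mod I {} b (forms d)" by simp
  then show "forms d \<subseteq> I" by (auto simp: spans_mod_def)
next
  assume "forms d \<subseteq> I"
  then have "I \<inter> forms d = forms d" by auto
  then show "hilbert I d = 0" by (simp add: hilbert_def)
qed

end

lemma ideal_plus_forms_split:
  assumes A: "hom_ideal A" and B: "hom_ideal B" and f: "f \<in> ideal_plus A B" "f \<in> forms d"
  obtains a b where "a \<in> A" "a \<in> forms d" "b \<in> B" "b \<in> forms d" "f = a + b"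
proof -
  obtain a b where ab: "a \<in> A" "b \<in> B" "f = a + b"
    using f(1) by (auto simp: ideal_plus_def)
  have "hom_part d f = hom_part d a + hom_part d b"
    unfolding ab(3) by (rule hom_part_add)
  moreover have "hom_part d f = f" using hom_part_form[OF f(2), of d] by simp
  ultimately have "f = hom_part d a + hom_part d b" by simp
  then show thesis
    by (rule that[OF ideal_hom_part[OF A ab(1)] hom_part_in_forms
          ideal_hom_part[OF B ab(2)] hom_part_in_forms])
qed

text \<open>
  This is the exactness of \<open>0 \<rightarrow> R/(A \<inter> B) \<rightarrow> R/A \<oplus> R/B \<rightarrow> R/(A + B) \<rightarrow> 0\<close> in degree \<open>d\<close>.
\<close>

lemma hilbert_plus_Int:
  fixes A B :: "('n::finite, 'k::field) mpoly set"
  assumes A: "hom_ideal A" and B: "hom_ideal B"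
  shows "hilbert (ideal_plus A B) d + hilbert (A \<inter> B) d = hilbert A d + hilbert B d"
proof -
  note P = hom_ideal_plus[OF A B] and AB = hom_ideal_Int[OF A B]
  have "ideal_plus A B \<inter> forms d = {x + y |x y. x \<in> A \<inter> forms d \<and> y \<in> B \<inter> forms d}"
  proof (intro equalityI subsetI)
    fix f assume "f \<in> ideal_plus A B \<inter> forms d"
    then show "f \<in> {x + y |x y. x \<in> A \<inter> forms d \<and> y \<in> B \<inter> forms d}"
    proof (elim IntE)
      assume "f \<in> ideal_plus A B" "f \<in> forms d"
      then obtain a b where "a \<in> A" "a \<in> forms d" "b \<in> B" "b \<in> forms d" "f = a + b"
        by (rule ideal_plus_forms_split[OF A B])
      then show ?thesis by (intro CollectI exI[of _ a] exI[of _ b]) auto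
    qed
  next
    fix f assume "f \<in> {x + y |x y. x \<in> A \<inter> forms d \<and> y \<in> B \<inter> forms d}"
    then show "f \<in> ideal_plus A B \<inter> forms d"
      by (auto simp: ideal_plus_def intro: forms_add)
  qed
  moreover have "(A \<inter> B) \<inter> forms d = (A \<inter> forms d) \<inter> (B \<inter> forms d)" by auto
  ultimately have "cvec.dim (ideal_plus A B \<inter> forms d) + cvec.dim ((A \<inter> B) \<inter> forms d)
      = cvec.dim (A \<inter> forms d) + cvec.dim (B \<inter> forms d)"
    using dim_plus_Int[OF subspace_Int_forms[OF A, of d] subspace_Int_forms[OF B, of d]
        fin_dim_forms[of d] Int_lower2 Int_lower2 subspace_forms[of d]] by simp
  with dim_forms_eq[OF A, of d] dim_forms_eq[OF B, of d] dim_forms_eq[OF P, of d] dim_forms_eq[OF AB, of d]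
  show ?thesis by linarith
qed

section \<open>Simultaneous eigenvectors\<close>

text \<open>
  The homogenization of degree \<open>N\<close> of the univariate polynomial \<open>P\<close>, evaluated at the forms \<open>x\<close> and
  \<open>y\<close>.  It stands for \<open>P(x/y)\<close>, where \<open>x/y\<close> is an operator on high degree pieces of \<open>R/I\<close>, without
  any division; \<open>N\<close> must be at least the degree of \<open>P\<close>.
\<close>

definition homogenize ::
  "('n, 'k::field) mpoly \<Rightarrow> ('n, 'k) mpoly \<Rightarrow> nat \<Rightarrow> 'k poly \<Rightarrow> ('n, 'k) mpoly" where
  "homogenize x y N P = (\<Sum>a\<le>N. cscale (Polynomial.coeff P a) (x ^ a * y ^ (N - a)))"

lemma homogenize_form:
  assumes "x \<in> forms 1" "y \<in> forms 1" shows "homogenize x y N P \<in> forms N"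
  unfolding homogenize_def
proof (intro forms_sum forms_cscale)
  fix a assume "a \<in> {..N}"
  then show "x ^ a * y ^ (N - a) \<in> forms N"
    using forms_mult[OF forms_linear_power[OF assms(1), of a] forms_linear_power[OF assms(2), of "N - a"]]
    by simp
qed

lemma homogenize_raise:
  assumes "Polynomial.degree P \<le> N"
  shows "homogenize x y (N + m) P = y ^ m * homogenize x y N P"
proof -
  have "homogenize x y (N + m) P = (\<Sum>a\<le>N. cscale (Polynomial.coeff P a) (x ^ a * y ^ (N + m - a)))"
    unfolding homogenize_def
    by (rule sum.mono_neutral_right) (use assms in \<open>auto intro: coeff_eq_0\<close>)
  also have "\<dots> = (\<Sum>a\<le>N. y ^ m * cscale (Polynomial.coeff P a) (x ^ a * y ^ (N - a)))"
  proof (rule sum.cong)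
    fix a assume "a \<in> {..N}"
    then have "N + m - a = m + (N - a)" by simp
    then have "y ^ (N + m - a) = y ^ m * y ^ (N - a)" by (simp only: power_add)
    then show "cscale (Polynomial.coeff P a) (x ^ a * y ^ (N + m - a))
        = y ^ m * cscale (Polynomial.coeff P a) (x ^ a * y ^ (N - a))"
      by (simp add: cscale_mult_right mult_ac)
  qed simp
  finally show ?thesis by (simp add: homogenize_def sum_distrib_left)
qed

lemma homogenize_linear_factor:
  assumes "Polynomial.degree P \<le> N"
  shows "homogenize x y (Suc N) ([:-c, 1:] * P) = (x - cscale c y) * homogenize x y N P"
proof -
  have "homogenize x y (Suc N) ([:-c, 1:] * P)
      = homogenize x y (Suc N) (pCons 0 P) - cscale c (homogenize x y (Suc N) P)"
    unfolding homogenize_def cvec.scale_sum_right sum_subtractf[symmetric]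
    by (rule sum.cong) (simp_all add: algebra_simps cvec.scale_left_diff_distrib)
  also have "homogenize x y (Suc N) (pCons 0 P) = x * homogenize x y N P"
    unfolding homogenize_def sum.atMost_Suc_shift
    by (simp add: sum_distrib_left cscale_mult_right mult.assoc)
  also have "homogenize x y (Suc N) P = y * homogenize x y N P"
    using homogenize_raise[OF assms, of x y 1] by simp
  finally show ?thesis by (simp add: algebra_simps cscale_mult_left)
qed

text \<open>
  The \<open>N + 1\<close> products \<open>x\<^sup>a y\<^bsup>N-a\<^esup> w\<close> lie in a space of dimension at most \<open>N\<close> modulo \<open>I\<close>.
\<close>

lemma homogenize_relation:
  fixes I :: "('n::finite, 'k::field) mpoly set"
  assumes I: "hom_ideal I" and xy: "x \<in> forms 1" "y \<in> forms 1" and w: "w \<in> forms d"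
    and h: "hilbert I (N + d) \<le> N"
  obtains P where "P \<noteq> 0" "Polynomial.degree P \<le> N" "homogenize x y N P * w \<in> I"
proof -
  let ?b = "\<lambda>a. x ^ a * y ^ (N - a) * w"
  have "?b a \<in> forms (N + d)" if "a \<le> N" for a
    using forms_mult[OF forms_mult[OF forms_linear_power[OF xy(1), of a] forms_linear_power[OF xy(2), of "N - a"]] w] that
    by simp
  then have "?b ` {..N} \<subseteq> forms (N + d)" by auto
  then have "\<not> indep_mod I {..N} ?b"
    using indep_card_le_hilbert[OF I, of "{..N}" ?b "N + d"] h by auto
  then obtain c a where c: "(\<Sum>a\<le>N. cscale (c a) (?b a)) \<in> I" "a \<le> N" "c a \<noteq> 0"
    unfolding indep_mod_def by auto
  define P where "P = (\<Sum>a\<le>N. Polynomial.monom (c a) a)"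
  have P: "Polynomial.coeff P a = (if a \<le> N then c a else 0)" for a
    by (simp add: P_def Polynomial.coeff_sum)
  show thesis
  proof
    show "P \<noteq> 0" using c P by (metis coeff_0)
    show "Polynomial.degree P \<le> N" by (rule degree_le) (simp add: P)
    show "homogenize x y N P * w \<in> I"
      using c(1) by (simp add: homogenize_def sum_distrib_right cscale_mult_left P mult.assoc)
  qed
qed

definition bounded_hilbert :: "('n::finite, 'k::field) mpoly set \<Rightarrow> bool" where
  "bounded_hilbert I \<longleftrightarrow> (\<exists>s N. \<forall>d\<ge>N. hilbert I d \<le> s)"

text \<open>
  This is the existence of an eigenvector of \<open>x/y\<close>.  Take a polynomial of minimal degree whose
  homogenization annihilates \<open>w\<close> modulo \<open>I\<close> and split off a root \<open>c\<close>: by minimality the cofactor does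
  not annihilate \<open>w\<close>, and it maps \<open>w\<close> to an eigenvector of eigenvalue \<open>c\<close>.  The operators are
  multiplications, so the eigenvector is again a multiple of \<open>w\<close>; this is why later steps keep
  the relations already achieved.
\<close>

lemma common_eigenvector_step:
  fixes I :: "('n::finite, 'k::alg_closed_field) mpoly set"
  assumes I: "hom_ideal I" and b: "bounded_hilbert I" and xy: "x \<in> forms 1" "y \<in> forms 1"
    and w: "w \<in> forms d" and y: "\<And>m. y ^ m * w \<notin> I"
  obtains c r N where "r \<in> forms N" "\<And>m. y ^ m * (r * w) \<notin> I" "(x - cscale c y) * (r * w) \<in> I"
proof -
  define good where
    "good P \<longleftrightarrow> P \<noteq> 0 \<and> (\<exists>N\<ge>Polynomial.degree P. homogenize x y N P * w \<in> I)" for P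
  from b obtain s N where "\<forall>d\<ge>N. hilbert I d \<le> s" unfolding bounded_hilbert_def by blast
  then have "hilbert I (max s N + d) \<le> max s N" by (simp add: max.coboundedI1 trans_le_add1)
  then have "\<exists>P. good P"
    using homogenize_relation[OF I xy w, of "max s N"] unfolding good_def by blast
  then obtain P where P: "good P" and min: "\<And>Q. good Q \<Longrightarrow> Polynomial.degree P \<le> Polynomial.degree Q"
    by (metis arg_min_natI arg_min_nat_le)
  from P obtain N where N: "P \<noteq> 0" "Polynomial.degree P \<le> N" "homogenize x y N P * w \<in> I"
    unfolding good_def by blast
  have "Polynomial.degree P > 0"
  proof (rule ccontr)
    assume "\<not> Polynomial.degree P > 0"
    then have d0: "Polynomial.degree P = 0" by simp
    have "homogenize x y 0 P = cscale (Polynomial.coeff P 0) 1" by (simp add: homogenize_def)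
    then have "homogenize x y N P * w = cscale (Polynomial.coeff P 0) (y ^ N * w)"
      using homogenize_raise[of P 0 x y N] d0 by (simp add: cscale_mult_left cscale_mult_right)
    moreover have "Polynomial.coeff P 0 \<noteq> 0" using N(1) d0 by (metis leading_coeff_neq_0)
    ultimately show False using N(3) y ideal_cscale_iff[OF I] by metis
  qed
  then obtain c where "poly P c = 0" using alg_closed_imp_poly_has_root by blast
  then obtain Q where Q: "P = [:-c, 1:] * Q" by (auto simp: poly_eq_0_iff_dvd dvd_def)
  then have Q0: "Q \<noteq> 0" using N(1) by auto
  have degP: "Polynomial.degree P = Suc (Polynomial.degree Q)"
    unfolding Q using Q0 by (subst degree_mult_eq) auto
  then have "\<not> good Q" using min[of Q] by auto
  with Q0 have nQ: "homogenize x y M Q * w \<notin> I" if "M \<ge> Polynomial.degree Q" for M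
    using that unfolding good_def by blast
  obtain M where M: "N = Suc M" using N(2) degP by (cases N) auto
  then have dM: "Polynomial.degree Q \<le> M" using N(2) degP by simp
  show thesis
  proof
    show "homogenize x y M Q \<in> forms M" by (rule homogenize_form[OF xy])
    show "y ^ m * (homogenize x y M Q * w) \<notin> I" for m
      using nQ[of "M + m"] dM homogenize_raise[OF dM, of x y m] by (simp add: mult.assoc)
    show "(x - cscale c y) * (homogenize x y M Q * w) \<in> I"
      using N(3) homogenize_linear_factor[OF dM, of x y c] by (simp add: M Q mult.assoc)
  qed
qed

lemma common_eigenvector_powers:
  fixes I :: "('n::finite, 'k::alg_closed_field) mpoly set"
  assumes I: "hom_ideal I" and b: "bounded_hilbert I" and y: "y \<in> forms 1"
    and w: "w \<in> forms d" "\<And>m. y ^ m * w \<notin> I" and "finite S"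
  obtains p r N where "r \<in> forms N" "\<And>m. y ^ m * (r * w) \<notin> I"
    "\<And>i. i \<in> S \<Longrightarrow> (var i - cscale (p i) y) * (r * w) \<in> I"
  using \<open>finite S\<close>
proof (induction S arbitrary: thesis)
  case empty
  show ?case by (rule empty[of 1 0]) (use w in auto)
next
  case (insert k S)
  obtain r N p where r: "r \<in> forms N" "\<And>m. y ^ m * (r * w) \<notin> I"
    "\<And>i. i \<in> S \<Longrightarrow> (var i - cscale (p i) y) * (r * w) \<in> I"
    using insert.IH by metis
  obtain c r' N' where r': "r' \<in> forms N'" "\<And>m. y ^ m * (r' * (r * w)) \<notin> I"
    "(var k - cscale c y) * (r' * (r * w)) \<in> I"
    using common_eigenvector_step[OF I b forms_var y forms_mult[OF r(1) w(1)] r(2)] by metis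
  show ?case
  proof (rule insert.prems)
    show "r' * r \<in> forms (N' + N)" by (rule forms_mult[OF r'(1) r(1)])
    show "y ^ m * (r' * r * w) \<notin> I" for m using r'(2) by (simp add: mult.assoc)
    fix i assume i: "i \<in> insert k S"
    show "(var i - cscale ((p(k := c)) i) y) * (r' * r * w) \<in> I"
    proof (cases "i = k")
      case False
      then have "r' * ((var i - cscale (p i) y) * (r * w)) \<in> I" using i r(3) ideal_mult[OF I] by blast
      then show ?thesis using False by (simp add: mult_ac)
    qed (use r'(3) in \<open>simp add: mult.assoc\<close>)
  qed
qed

text \<open>
  By the pigeonhole principle a monomial of large degree contains a high power of some variable.
\<close>

lemma powers_kill_imp_forms_kill:
  fixes I :: "('n::finite, 'k::field) mpoly set"
  assumes I: "hom_ideal I" and k: "\<And>k. \<exists>m. var k ^ m * w \<in> I"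
  obtains N where "\<And>g. g \<in> forms N \<Longrightarrow> g * w \<in> I"
proof -
  from k obtain m where m: "\<And>k. var k ^ m k * w \<in> I" by metis
  \<comment> \<open>One exponent that works for all variables.\<close>
  define M where "M = Suc (\<Sum>k\<in>UNIV. m k)"
  have var_power: "var k ^ e = monomial (monomial k e) 1" for k :: 'n and e
    by (induction e) (auto simp: var_def mult_single single_add[symmetric])
  have "monomial u c * w \<in> I" if "expo_degree u = card (UNIV :: 'n set) * M" for u and c :: 'k
  proof -
    have "\<exists>k. coef u k \<ge> M"
    proof (rule ccontr)
      assume "\<nexists>k. coef u k \<ge> M"
      then have "expo_degree u < (\<Sum>k\<in>(UNIV :: 'n set). M)"
        unfolding expo_degree_def by (intro sum_strict_mono) (auto simp: not_le)
      with that show False by simp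
    qed
    then obtain k where k: "coef u k \<ge> M" ..
    have "m k \<le> (\<Sum>k\<in>UNIV. m k)" by (rule member_le_sum) auto
    then have mk: "coef u k \<ge> m k" using k by (simp add: M_def)
    have u: "u = (u - monomial k (m k)) + monomial k (m k)"
      by (rule poly_mapping_eqI) (use mk in \<open>auto simp: lookup_add lookup_minus lookup_single when_def\<close>)
    have "monomial (u - monomial k (m k)) c * (var k ^ m k * w) \<in> I" using m by (rule ideal_mult[OF I])
    also have "monomial (u - monomial k (m k)) c * (var k ^ m k * w) = monomial u c * w"
      by (subst (2) u) (simp add: var_power mult_single mult.assoc[symmetric])
    finally show ?thesis .
  qed
  then have "g * w \<in> I" if "g \<in> forms (card (UNIV :: 'n set) * M)" for g
    using that by (subst sum_monomials) (auto simp: sum_distrib_right forms_def intro!: ideal_sum[OF I])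
  then show thesis by (rule that)
qed

text \<open>
  The form \<open>u\<close> represents a common eigenvector of the multiplications by the coordinates in a high
  degree piece of \<open>R/I\<close>; only ratios of eigenvalues make sense, and they form the point \<open>p\<close>.
  Instead of \<open>u \<notin> I\<close> it is demanded that \<open>u\<close> is outside the saturation of \<open>I\<close>, so that the notion
  also serves ideals that are not known to be saturated.
\<close>

definition eigenvector ::
  "('n::finite, 'k::field) mpoly set \<Rightarrow> ('n \<Rightarrow> 'k) \<Rightarrow> nat \<Rightarrow> ('n, 'k) mpoly \<Rightarrow> bool" where
  "eigenvector I p d u \<longleftrightarrow> p \<noteq> (\<lambda>_. 0) \<and> u \<in> forms d \<and> (\<forall>N. \<exists>g\<in>forms N. g * u \<notin> I) \<and>
     (\<forall>i k. cscale (p i) (var k * u) - cscale (p k) (var i * u) \<in> I)"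

text \<open>
  The relations say \<open>x\<^sub>k u = (p\<^sub>k/p\<^sub>i) x\<^sub>i u\<close>, so a form \<open>g\<close> of degree \<open>e\<close> acts as \<open>g(p) (x\<^sub>i/p\<^sub>i)\<^sup>e\<close>.
  Cleared of denominators, this holds for every index \<open>i\<close>, also where \<open>p\<^sub>i = 0\<close>.
\<close>

lemma eigenvector_mult_form:
  fixes I :: "('n::finite, 'k::field) mpoly set"
  assumes I: "hom_ideal I"
    and u: "\<And>i k. cscale (p i) (var k * u) - cscale (p k) (var i * u) \<in> I"
    and g: "g \<in> forms e"
  shows "cscale (p i ^ e) (g * u) - cscale (peval g p) (var i ^ e * u) \<in> I"
  using g
proof (induction e arbitrary: g)
  case 0
  then obtain c where "g = monomial 0 c" using forms_0_const by blast
  then have "g * u = cscale (peval g p) u"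
    by (simp add: cscale_eq_mult peval_monomial expo_eval_def)
  then show ?case by (simp add: ideal_0[OF I])
next
  case (Suc e)
  from Suc.prems show ?case
  proof (induction rule: forms_Suc_induct)
    case zero
    then show ?case by (simp add: ideal_0[OF I])
  next
    case (add f g)
    from ideal_add[OF I this] show ?case
      by (simp add: peval_add algebra_simps cvec.scale_right_distrib cvec.scale_left_distrib)
  next
    case (mult k h)
    have "cscale (p i) (var k * (cscale (p i ^ e) (h * u) - cscale (peval h p) (var i ^ e * u)))
      + cscale (peval h p) (var i ^ e * (cscale (p i) (var k * u) - cscale (p k) (var i * u))) \<in> I"
      by (intro ideal_add[OF I] ideal_cscale[OF I] ideal_mult[OF I] Suc.IH[OF mult] u)
    also have "cscale (p i) (var k * (cscale (p i ^ e) (h * u) - cscale (peval h p) (var i ^ e * u)))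
      + cscale (peval h p) (var i ^ e * (cscale (p i) (var k * u) - cscale (p k) (var i * u)))
      = cscale (p i ^ Suc e) (var k * h * u) - cscale (peval (var k * h) p) (var i ^ Suc e * u)"
      by (simp add: right_diff_distrib cscale_mult_right cvec.scale_right_diff_distrib peval_mult mult_ac)
    finally show ?case .
  qed
qed

context
  fixes I :: "('n::finite, 'k::field) mpoly set" and p d u
  assumes I: "hom_ideal I" and ev: "eigenvector I p d u"
begin

lemma eigenvector_rel: "cscale (p i) (var k * u) - cscale (p k) (var i * u) \<in> I"
  using ev by (simp add: eigenvector_def)

lemma eigenvector_point: obtains i where "p i \<noteq> 0"
  using ev unfolding eigenvector_def by (meson ext)

lemma eigenvector_not_in: "u \<notin> I"
  using ev ideal_mult[OF I] by (auto simp: eigenvector_def)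

lemma eigenvector_vanish:
  assumes g: "g \<in> forms e" "peval g p = 0" shows "g * u \<in> I"
proof -
  obtain i where i: "p i \<noteq> 0" by (rule eigenvector_point)
  have "cscale (p i ^ e) (g * u) \<in> I"
    using eigenvector_mult_form[OF I eigenvector_rel g(1), of i] g(2) by simp
  then show ?thesis using ideal_cscale_iff[OF I] i by simp
qed

lemma eigenvector_nonvanish:
  assumes g: "g \<in> forms e" "peval g p \<noteq> 0" shows "g * u \<notin> I"
proof
  assume m: "g * u \<in> I"
  have x: "var i ^ e * u \<in> I" for i
  proof -
    have "cscale (p i ^ e) (g * u) - (cscale (p i ^ e) (g * u) - cscale (peval g p) (var i ^ e * u)) \<in> I"
      by (intro ideal_diff[OF I] ideal_cscale[OF I] m eigenvector_mult_form[OF I eigenvector_rel g(1)])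
    then show ?thesis using ideal_cscale_iff[OF I] g(2) by simp
  qed
  obtain i where i: "p i \<noteq> 0" by (rule eigenvector_point)
  have "h * u \<in> I" if "h \<in> forms e" for h
  proof -
    have "cscale (p i ^ e) (h * u) - cscale (peval h p) (var i ^ e * u) + cscale (peval h p) (var i ^ e * u) \<in> I"
      by (intro ideal_add[OF I] ideal_cscale[OF I] x eigenvector_mult_form[OF I eigenvector_rel that])
    then show ?thesis using ideal_cscale_iff[OF I] i by simp
  qed
  with ev show False unfolding eigenvector_def by blast
qed

lemma eigenvector_times:
  assumes g: "g \<in> forms e" "peval g p \<noteq> 0" shows "eigenvector I p (e + d) (g * u)"
  unfolding eigenvector_def
proof (intro conjI allI)
  show "p \<noteq> (\<lambda>_. 0)" using ev by (simp add: eigenvector_def)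
  show "g * u \<in> forms (e + d)" using ev g by (simp add: eigenvector_def forms_mult)
  obtain i where i: "p i \<noteq> 0" by (rule eigenvector_point)
  fix N
  have "var i ^ N * g \<in> forms (N + e)" by (intro forms_mult forms_linear_power g forms_var)
  then have "var i ^ N * g * u \<notin> I"
    by (rule eigenvector_nonvanish) (use i g in \<open>simp add: peval_mult peval_power\<close>)
  then show "\<exists>h\<in>forms N. h * (g * u) \<notin> I"
    by (intro bexI[of _ "var i ^ N"] forms_linear_power forms_var) (simp add: mult.assoc)
next
  fix i k
  have "g * (cscale (p i) (var k * u) - cscale (p k) (var i * u)) \<in> I"
    by (rule ideal_mult[OF I eigenvector_rel])
  then show "cscale (p i) (var k * (g * u)) - cscale (p k) (var i * (g * u)) \<in> I"
    by (simp add: right_diff_distrib cscale_mult_right mult_ac)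
qed

text \<open>
  A form of \<open>I\<close> that did not vanish at \<open>p\<close> would act injectively on \<open>u\<close>, but it kills \<open>u\<close>.
\<close>

lemma eigenvector_support: "p \<in> support I"
  unfolding support_def
proof (intro CollectI conjI ballI)
  show "p \<noteq> (\<lambda>_. 0)" using ev by (simp add: eigenvector_def)
  fix f assume f: "f \<in> I"
  have "peval (hom_part e f) p = 0" for e
  proof (rule ccontr)
    assume "peval (hom_part e f) p \<noteq> 0"
    then have "hom_part e f * u \<notin> I" by (intro eigenvector_nonvanish[of _ e]) auto
    then show False using ideal_mult_right[OF I ideal_hom_part[OF I f]] by blast
  qed
  moreover obtain N where "f = (\<Sum>e<N. hom_part e f)" by (rule sum_hom_parts)
  ultimately show "peval f p = 0" by (metis (mono_tags, lifting) peval_sum sum.neutral)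
qed

end

lemma eigenvector_exists:
  fixes I :: "('n::finite, 'k::alg_closed_field) mpoly set"
  assumes I: "hom_ideal I" and b: "bounded_hilbert I"
    and w: "w \<in> forms d" "\<And>N. \<exists>g\<in>forms N. g * w \<notin> I"
  obtains p r N where "r \<in> forms N" "eigenvector I p (N + d) (r * w)"
proof -
  obtain k where k: "\<And>m. var k ^ m * w \<notin> I"
    using powers_kill_imp_forms_kill[OF I, of w] w(2) by metis
  obtain p r N where r: "r \<in> forms N" "\<And>m. var k ^ m * (r * w) \<notin> I"
    and p: "\<And>i. (var i - cscale (p i) (var k)) * (r * w) \<in> I"
    using common_eigenvector_powers[OF I b forms_var w(1) k finite_UNIV] UNIV_I by metis
  let ?u = "r * w"
  have "eigenvector I p (N + d) ?u"
    unfolding eigenvector_def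
  proof (intro conjI allI)
    show "?u \<in> forms (N + d)" by (rule forms_mult[OF r(1) w(1)])
    show "p \<noteq> (\<lambda>_. 0)" using p[of k] r(2)[of 1] by auto
    show "\<exists>g\<in>forms M. g * ?u \<notin> I" for M
      using r(2)[of M] forms_linear_power[OF forms_var] by blast
    fix i j
    have "cscale (p i) ((var j - cscale (p j) (var k)) * ?u) - cscale (p j) ((var i - cscale (p i) (var k)) * ?u) \<in> I"
      by (intro ideal_diff[OF I] ideal_cscale[OF I] p)
    also have "cscale (p i) ((var j - cscale (p j) (var k)) * ?u) - cscale (p j) ((var i - cscale (p i) (var k)) * ?u)
      = cscale (p i) (var j * ?u) - cscale (p j) (var i * ?u)"
      by (simp add: left_diff_distrib cscale_mult_left cvec.scale_right_diff_distrib mult.commute[of "p i"])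
    finally show "cscale (p i) (var j * ?u) - cscale (p j) (var i * ?u) \<in> I" .
  qed
  with r(1) show thesis by (rule that)
qed

lemma saturated_nonmember:
  "saturated I \<Longrightarrow> w \<notin> I \<Longrightarrow> \<exists>g\<in>forms N. g * w \<notin> I"
  unfolding saturated_def by blast

text \<open>
  Eigenvectors are found among the multiples of a given form, hence inside every ideal that is
  nonzero modulo \<open>I\<close>.  This replaces the statement that every nonzero ideal of an Artinian ring
  meets the socle.
\<close>

lemma eigenvector_in_ideal:
  fixes I :: "('n::finite, 'k::alg_closed_field) mpoly set"
  assumes I: "hom_ideal I" "saturated I" "bounded_hilbert I" and J: "hom_ideal J" "\<not> J \<subseteq> I"
  obtains p d u where "u \<in> J" "eigenvector I p d u"
proof -
  obtain w d where w: "w \<in> J" "w \<in> forms d" "w \<notin> I" by (rule form_not_in_ideal[OF I(1) J])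
  then show thesis
    using eigenvector_exists[OF I(1,3) w(2) saturated_nonmember[OF I(2) w(3)]] that ideal_mult[OF J(1)]
    by metis
qed

text \<open>
  A version of Hilbert's Nullstellensatz.  If the saturation of \<open>J\<close> were proper, then \<open>1\<close> would have
  a multiple that is an eigenvector, and its point would be a zero of \<open>J\<close>.
\<close>

lemma no_zeros_imp_all_large_forms:
  fixes J :: "('n::finite, 'k::alg_closed_field) mpoly set"
  assumes J: "hom_ideal J" "bounded_hilbert J" and "support J = {}"
  obtains N where "\<And>d. d \<ge> N \<Longrightarrow> forms d \<subseteq> J"
proof (cases "\<exists>N. \<forall>g\<in>forms N. g * 1 \<in> J")
  case True
  then obtain N where N: "forms N \<subseteq> J" by auto
  have "forms (N + m) \<subseteq> J" for m
  proof (induction m)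
    case (Suc m)
    show ?case
    proof
      fix f :: "('n, 'k) mpoly" assume "f \<in> forms (N + Suc m)"
      then have "f \<in> forms (Suc (N + m))" by simp
      then show "f \<in> J"
        by (induction rule: forms_Suc_induct)
          (use Suc ideal_0[OF J(1)] ideal_add[OF J(1)] ideal_mult[OF J(1)] in auto)
    qed
  qed (use N in simp)
  then show thesis using that[of N] by (metis le_add_diff_inverse)
next
  case False
  then obtain p r N where "eigenvector J p (N + 0) (r * 1)"
    using eigenvector_exists[OF J forms_1] by metis
  then have "p \<in> support J" by (rule eigenvector_support[OF J(1)])
  with assms(3) show thesis by simp
qed

section \<open>Points of the support and regular linear forms\<close>

definition proportional :: "('n \<Rightarrow> 'k::field) \<Rightarrow> ('n \<Rightarrow> 'k) \<Rightarrow> bool" where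
  "proportional p q \<longleftrightarrow> (\<exists>c. c \<noteq> 0 \<and> q = (\<lambda>i. c * p i))"

lemma proportional_refl [simp]: "proportional p p"
  unfolding proportional_def by (rule exI[of _ 1]) simp

lemma proportional_sym: "proportional p q \<Longrightarrow> proportional q p"
  unfolding proportional_def
proof (elim exE conjE)
  fix c assume "c \<noteq> 0" "q = (\<lambda>i. c * p i)"
  then show "\<exists>c. c \<noteq> 0 \<and> p = (\<lambda>i. c * q i)" by (intro exI[of _ "inverse c"]) auto
qed

lemma proportional_trans: "proportional p q \<Longrightarrow> proportional q r \<Longrightarrow> proportional p r"
  unfolding proportional_def
proof (elim exE conjE)
  fix c d assume "c \<noteq> 0" "q = (\<lambda>i. c * p i)" "d \<noteq> 0" "r = (\<lambda>i. d * q i)"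
  then show "\<exists>c. c \<noteq> 0 \<and> r = (\<lambda>i. c * p i)" by (intro exI[of _ "d * c"]) auto
qed

lemma proportional_nonvanish:
  assumes "proportional p q" "g \<in> forms d" shows "peval g p \<noteq> 0 \<longleftrightarrow> peval g q \<noteq> 0"
  using assms peval_form_scale unfolding proportional_def by fastforce

lemma support_nonzero: "p \<in> support I \<Longrightarrow> p \<noteq> (\<lambda>_. 0)"
  by (simp add: support_def)

lemma nonzero_coordinate: assumes "p \<noteq> (\<lambda>_. 0)" obtains i where "p i \<noteq> 0"
  using assms by (meson ext)

lemma support_vanish: "p \<in> support I \<Longrightarrow> f \<in> I \<Longrightarrow> peval f p = 0"
  by (simp add: support_def)

lemma support_form_vanish:
  assumes I: "hom_ideal I" and p: "p \<noteq> (\<lambda>_. 0)" and f: "\<And>f d. f \<in> I \<Longrightarrow> f \<in> forms d \<Longrightarrow> peval f p = 0"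
  shows "p \<in> support I"
  unfolding support_def
proof (intro CollectI conjI ballI p)
  fix g assume "g \<in> I"
  then have "peval (hom_part d g) p = 0" for d
    using f[of "hom_part d g" d] ideal_hom_part[OF I] by simp
  moreover obtain N where "g = (\<Sum>d<N. hom_part d g)" by (rule sum_hom_parts)
  ultimately show "peval g p = 0" by (metis (mono_tags, lifting) peval_sum sum.neutral)
qed

lemma support_form_nonvanish:
  assumes "hom_ideal I" "p \<noteq> (\<lambda>_. 0)" "p \<notin> support I"
  obtains f d where "f \<in> I" "f \<in> forms d" "peval f p \<noteq> 0"
  using support_form_vanish assms by blast

lemma support_proportional:
  assumes I: "hom_ideal I" and p: "p \<in> support I" and q: "proportional p q"
  shows "q \<in> support I"
proof (rule support_form_vanish[OF I])
  obtain i where "p i \<noteq> 0" using support_nonzero[OF p] by (rule nonzero_coordinate)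
  then show "q \<noteq> (\<lambda>_. 0)" using q unfolding proportional_def by (metis mult_eq_0_iff)
  show "peval f q = 0" if "f \<in> I" "f \<in> forms d" for f d
    using proportional_nonvanish[OF q that(2)] support_vanish[OF p that(1)] by simp
qed

lemma separating_linear_form:
  assumes "p \<noteq> (\<lambda>_. 0)" "q \<noteq> (\<lambda>_. 0)" "\<not> proportional p q"
  obtains f where "f \<in> forms 1" "peval f q = 0" "peval f p \<noteq> 0"
proof (cases "\<exists>i k. q i * p k \<noteq> q k * p i")
  case True
  then obtain i k where ik: "q i * p k \<noteq> q k * p i" by blast
  show thesis
    by (rule that[of "cscale (q i) (var k) - cscale (q k) (var i)"])
      (use ik in \<open>auto simp: peval_minus intro!: forms_diff forms_cscale forms_var[simplified]\<close>)
next
  case False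
  obtain i where i: "q i \<noteq> 0" using nonzero_coordinate[OF assms(2)] .
  have e: "p k = p i / q i * q k" for k
    using False i by (simp add: field_simps)
  moreover obtain k where "p k \<noteq> 0" using nonzero_coordinate[OF assms(1)] .
  ultimately have "p i / q i \<noteq> 0" by (metis mult_zero_left)
  then have "proportional q p" using e unfolding proportional_def by blast
  then show thesis using assms(3) proportional_sym by blast
qed

text \<open>
  Products of separating linear forms give, for each point of \<open>P\<close>, a form that vanishes at exactly the
  other points of \<open>P\<close>.  These forms are independent modulo \<open>I\<close>.  A power of a coordinate brings
  them to the common degree \<open>D\<close>.
\<close>

lemma card_points_le_hilbert:
  fixes I :: "('n::finite, 'k::field) mpoly set"
  assumes I: "hom_ideal I" and P: "finite P" "P \<subseteq> support I"
    and pw: "\<And>p q. p \<in> P \<Longrightarrow> q \<in> P \<Longrightarrow> p \<noteq> q \<Longrightarrow> \<not> proportional p q"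
    and D: "card P \<le> D"
  shows "card P \<le> hilbert I D"
proof -
  have "\<exists>f. f \<in> forms 1 \<and> peval f q = 0 \<and> peval f p \<noteq> 0" if "p \<in> P" "q \<in> P - {p}" for p q
    using separating_linear_form[of p q] pw that P(2) support_nonzero by (metis Diff_iff insertI1 subsetD)
  then obtain f where f: "\<And>p q. p \<in> P \<Longrightarrow> q \<in> P - {p} \<Longrightarrow> f p q \<in> forms 1"
    "\<And>p q. p \<in> P \<Longrightarrow> q \<in> P - {p} \<Longrightarrow> peval (f p q) q = 0"
    "\<And>p q. p \<in> P \<Longrightarrow> q \<in> P - {p} \<Longrightarrow> peval (f p q) p \<noteq> 0"
    by metis
  have "\<exists>i. p i \<noteq> 0" if "p \<in> P" for p
    using that P(2) support_nonzero by (metis ext subsetD)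
  then obtain i where i: "\<And>p. p \<in> P \<Longrightarrow> p (i p) \<noteq> 0" by metis
  \<comment> \<open>A form of degree \<open>D\<close> that vanishes at the points of \<open>P\<close> other than \<open>p\<close>; \<open>P\<close> gives \<open>card P - 1\<close> factors.\<close>
  define h where "h p = prod (f p) (P - {p}) * var (i p) ^ (D - (card P - 1))" for p
  have hD: "h p \<in> forms D" if p: "p \<in> P" for p
  proof -
    have "h p \<in> forms (card (P - {p}) + (D - (card P - 1)))"
      unfolding h_def using P f(1)[OF p]
      by (intro forms_mult forms_linear_power forms_var forms_prod) auto
    then show ?thesis using D p P(1) by simp
  qed
  have h0: "peval (h p) q = 0" if "p \<in> P" "q \<in> P" "p \<noteq> q" for p q
  proof -
    have "(\<Prod>a\<in>P - {p}. peval (f p a) q) = 0"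
      by (rule prod_zero) (use P that f(2)[of p q] in auto)
    then show ?thesis by (simp add: h_def peval_mult peval_prod)
  qed
  have h1: "peval (h p) p \<noteq> 0" if "p \<in> P" for p
    using P(1) f(3)[OF that] i[OF that] by (simp add: h_def peval_mult peval_prod peval_power)
  have "indep_mod I P h"
    unfolding indep_mod_def
  proof (intro allI impI ballI)
    fix c q assume m: "(\<Sum>p\<in>P. cscale (c p) (h p)) \<in> I" and q: "q \<in> P"
    have "(\<Sum>p\<in>P. c p * peval (h p) q) = 0"
      using support_vanish[OF _ m, of q] q P(2) by (auto simp: peval_sum)
    also have "(\<Sum>p\<in>P. c p * peval (h p) q) = (\<Sum>p\<in>P. if p = q then c q * peval (h q) q else 0)"
      using h0 q by (intro sum.cong) auto
    finally show "c q = 0" using P(1) q h1[OF q] by simp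
  qed
  then show ?thesis using hD by (intro indep_card_le_hilbert[OF I P(1)]) auto
qed

text \<open>
  Choose a set of pairwise different points of maximal cardinality.
\<close>

lemma finitely_many_points:
  fixes I :: "('n::finite, 'k::field) mpoly set"
  assumes I: "hom_ideal I" and b: "bounded_hilbert I"
  obtains P where "finite P" "P \<subseteq> support I"
    "\<And>p q. p \<in> P \<Longrightarrow> q \<in> P \<Longrightarrow> p \<noteq> q \<Longrightarrow> \<not> proportional p q"
    "\<And>q. q \<in> support I \<Longrightarrow> \<exists>p\<in>P. proportional p q"
proof -
  define good where "good P \<longleftrightarrow> finite P \<and> P \<subseteq> support I \<and>
    (\<forall>p\<in>P. \<forall>q\<in>P. p \<noteq> q \<longrightarrow> \<not> proportional p q)" for P
  from b obtain s N where sN: "\<And>d. d \<ge> N \<Longrightarrow> hilbert I d \<le> s" unfolding bounded_hilbert_def by blast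
  have "card P \<le> s" if "good P" for P
  proof -
    have "card P \<le> hilbert I (max N (card P))"
      using that unfolding good_def by (intro card_points_le_hilbert[OF I]) auto
    also have "\<dots> \<le> s" by (rule sN) simp
    finally show ?thesis .
  qed
  moreover have "good {}" by (simp add: good_def)
  ultimately obtain P where P: "good P" and max: "\<And>Q. good Q \<Longrightarrow> card Q \<le> card P"
    using ex_has_greatest_nat[of good "{}" card "Suc s"] by (metis less_Suc_eq_le)
  have "\<exists>p\<in>P. proportional p q" if q: "q \<in> support I" for q
  proof (rule ccontr)
    assume n: "\<not> (\<exists>p\<in>P. proportional p q)"
    then have "q \<notin> P" by (auto intro: bexI[of _ q])
    moreover have "good (insert q P)"
      using P n q proportional_sym unfolding good_def by blast
    ultimately show False using max[of "insert q P"] P by (simp add: good_def)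
  qed
  then show thesis using that[of P] P unfolding good_def by blast
qed

lemma infinite_alg_closed_field: "infinite (UNIV :: 'k::alg_closed_field set)"
proof
  assume fin: "finite (UNIV :: 'k set)"
  \<comment> \<open>If the field were finite, \<open>P + 1\<close> would have no root.\<close>
  define P :: "'k poly" where "P = (\<Prod>a\<in>UNIV. [:-a, 1:])"
  have "Polynomial.degree P = card (UNIV :: 'k set)"
    unfolding P_def by (subst degree_prod_eq_sum_degree) auto
  then have dP: "Polynomial.degree P > 0" using fin by (simp add: finite_UNIV_card_ge_0)
  have "Polynomial.degree (P + 1) = Polynomial.degree P"
    using dP by (intro degree_add_eq_left) auto
  then obtain x where "poly (P + 1) x = 0" using dP alg_closed_imp_poly_has_root[of "P + 1"] by auto
  moreover have "poly P x = 0"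
    using fin unfolding P_def poly_prod by (intro prod_zero bexI[of _ x]) auto
  ultimately show False by simp
qed

text \<open>
  A vector space over an infinite field is not a finite union of proper subspaces.  In the step, the
  vector \<open>v + t w\<close> works unless \<open>t\<close> is one of finitely many excluded values.
\<close>

lemma common_nonzero_vector:
  fixes V :: "('a \<Rightarrow>\<^sub>0 'k::alg_closed_field) set" and \<phi> :: "'i \<Rightarrow> ('a \<Rightarrow>\<^sub>0 'k) \<Rightarrow> 'k"
  assumes V: "cvec.subspace V" and "finite A"
    and lin: "\<And>a v t w. a \<in> A \<Longrightarrow> \<phi> a (v + cscale t w) = \<phi> a v + t * \<phi> a w"
    and nz: "\<And>a. a \<in> A \<Longrightarrow> \<exists>v\<in>V. \<phi> a v \<noteq> 0"
  obtains v where "v \<in> V" "\<And>a. a \<in> A \<Longrightarrow> \<phi> a v \<noteq> 0"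
  using \<open>finite A\<close> lin nz
proof (induction A arbitrary: thesis rule: finite_induct)
  case empty
  show ?case by (rule empty(1)[OF cvec.subspace_0[OF V]]) simp
next
  case (insert b A)
  obtain v where v: "v \<in> V" "\<And>a. a \<in> A \<Longrightarrow> \<phi> a v \<noteq> 0"
    using insert.IH insert.prems(2,3) by (metis insertI2)
  obtain w where w: "w \<in> V" "\<phi> b w \<noteq> 0" using insert.prems(3) by blast
  let ?X = "(\<lambda>a. - \<phi> a v / \<phi> a w) ` insert b A"
  have "finite ?X" using insert.hyps(1) by simp
  then obtain t where t: "t \<notin> ?X" using infinite_alg_closed_field ex_new_if_finite by blast
  show ?case
  proof (rule insert.prems(1)[of "v + cscale t w"])
    show "v + cscale t w \<in> V" using V v w by (intro cvec.subspace_add cvec.subspace_scale)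
    fix a assume a: "a \<in> insert b A"
    have e: "\<phi> a (v + cscale t w) = \<phi> a v + t * \<phi> a w" using insert.prems(2) a by blast
    show "\<phi> a (v + cscale t w) \<noteq> 0"
    proof (cases "\<phi> a w = 0")
      case True
      then have "a \<in> A" using a w by auto
      then show ?thesis using True v(2) e by simp
    next
      case False
      have "t \<noteq> - \<phi> a v / \<phi> a w" using t a by blast
      then show ?thesis using False unfolding e by (auto simp: field_simps add_eq_0_iff)
    qed
  qed
qed

lemma nonvanishing_linear_form:
  fixes I :: "('n::finite, 'k::alg_closed_field) mpoly set"
  assumes I: "hom_ideal I" and b: "bounded_hilbert I"
  obtains l where "l \<in> forms 1" "\<And>p. p \<in> support I \<Longrightarrow> peval l p \<noteq> 0"
proof -
  obtain P where P: "finite P" "P \<subseteq> support I" "\<And>q. q \<in> support I \<Longrightarrow> \<exists>p\<in>P. proportional p q"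
    using finitely_many_points[OF I b] by metis
  have "\<exists>v\<in>forms 1. peval v p \<noteq> 0" if "p \<in> P" for p
    using P(2) that support_nonzero nonzero_coordinate by (metis forms_var peval_var subsetD)
  then obtain l where l: "l \<in> forms 1" "\<And>p. p \<in> P \<Longrightarrow> peval l p \<noteq> 0"
    using common_nonzero_vector[OF subspace_forms P(1), of "\<lambda>p v. peval v p" 1]
    by (auto simp: peval_add)
  have "peval l q \<noteq> 0" if "q \<in> support I" for q
    using P(3)[OF that] proportional_nonvanish l by blast
  with l(1) show thesis by (rule that)
qed

lemma hom_ideal_quotient_form:
  assumes I: "hom_ideal I" and l: "l \<in> forms e" shows "hom_ideal {f. l * f \<in> I}"
  unfolding hom_ideal_def mem_Collect_eq
proof (intro conjI ballI allI)
  show "l * 0 \<in> I" by (simp add: ideal_0[OF I])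
next
  fix f g assume "f \<in> {f. l * f \<in> I}" "g \<in> {f. l * f \<in> I}"
  then show "l * (f + g) \<in> I" by (simp add: distrib_left ideal_add[OF I])
next
  fix f r assume "f \<in> {f. l * f \<in> I}"
  then have "r * (l * f) \<in> I" by (simp add: ideal_mult[OF I])
  then show "l * (r * f) \<in> I" by (simp add: mult_ac)
next
  fix f d assume "f \<in> {f. l * f \<in> I}"
  then show "l * hom_part d f \<in> I"
    using ideal_hom_part[OF I, of "l * f" "e + d"] by (simp add: hom_part_mult_form[OF l])
qed

text \<open>
  The elements killed by \<open>l\<close> modulo \<open>I\<close> form an ideal.  If it were larger than \<open>I\<close>, it would contain
  an eigenvector at some point \<open>p\<close> of the support, which \<open>l\<close> cannot kill because \<open>l(p) \<noteq> 0\<close>.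
\<close>

lemma nonvanishing_form_regular:
  fixes I :: "('n::finite, 'k::alg_closed_field) mpoly set"
  assumes I: "hom_ideal I" "saturated I" "bounded_hilbert I"
    and l: "l \<in> forms e" "\<And>p. p \<in> support I \<Longrightarrow> peval l p \<noteq> 0" and m: "l * f \<in> I"
  shows "f \<in> I"
proof (rule ccontr)
  assume "f \<notin> I"
  with m have "\<not> {f. l * f \<in> I} \<subseteq> I" by auto
  then obtain p d u where u: "l * u \<in> I" "eigenvector I p d u"
    using eigenvector_in_ideal[OF I hom_ideal_quotient_form[OF I(1) l(1)]] by blast
  then have "p \<in> support I" using eigenvector_support[OF I(1)] by blast
  then show False using eigenvector_nonvanish[OF I(1) u(2) l(1)] l(2) u(1) by blast
qed

text \<open>
  The bound on the Hilbert function says that the scheme is empty or zero-dimensional.  Then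
  nonvanishing on the support makes \<open>l\<close> regular modulo \<open>I\<close>.
\<close>

locale graded_regular =
  fixes I :: "('n::finite, 'k::alg_closed_field) mpoly set" and l :: "('n, 'k) mpoly"
  assumes I: "hom_ideal I" and sat: "saturated I" and bounded: "bounded_hilbert I"
    and l: "l \<in> forms 1" and l_nz: "\<And>p. p \<in> support I \<Longrightarrow> peval l p \<noteq> 0"
begin

lemma l_power_form: "l ^ m \<in> forms m"
  by (rule forms_linear_power[OF l])

lemma regular_iff: "l ^ m * f \<in> I \<longleftrightarrow> f \<in> I"
  using nonvanishing_form_regular[OF I sat bounded l_power_form, of m f] l_nz ideal_mult[OF I]
  by (auto simp: peval_power)

lemma raise_indep:
  assumes "indep_mod I A b" shows "indep_mod I A (\<lambda>a. l ^ m * b a)"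
proof -
  have "(\<Sum>a\<in>A. cscale (c a) (l ^ m * b a)) = l ^ m * (\<Sum>a\<in>A. cscale (c a) (b a))" for c
    by (simp add: sum_distrib_left cscale_mult_right)
  then show ?thesis using assms by (simp add: indep_mod_def regular_iff)
qed

lemma hilbert_mono:
  assumes "d \<le> e" shows "hilbert I d \<le> hilbert I e"
proof -
  obtain b where b: "\<And>i. i < hilbert I d \<Longrightarrow> b i \<in> forms d" "indep_mod I {..<hilbert I d} b"
    using hilbert_basis[OF I] by metis
  have "l ^ (e - d) * b i \<in> forms e" if "i < hilbert I d" for i
    using forms_mult[OF l_power_form[of "e - d"] b(1)[OF that]] assms by simp
  then have "card {..<hilbert I d} \<le> hilbert I e"
    by (intro indep_card_le_hilbert[OF I _ _ raise_indep[OF b(2), of "e - d"]]) auto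
  then show ?thesis by simp
qed

lemma hilbert_eventually_const:
  obtains s N where "\<And>d. d \<ge> N \<Longrightarrow> hilbert I d = s" "\<And>d. hilbert I d \<le> s"
proof -
  from bounded obtain s N where sN: "\<And>d. d \<ge> N \<Longrightarrow> hilbert I d \<le> s"
    unfolding bounded_hilbert_def by blast
  have b: "hilbert I d \<le> s" for d
    using hilbert_mono[of d "max d N"] sN[of "max d N"] by simp
  then obtain D where D: "\<And>d. hilbert I d \<le> hilbert I D"
    using ex_has_greatest_nat[of "\<lambda>_. True" 0 "hilbert I" "Suc s"] by (metis less_Suc_eq_le)
  show thesis by (rule that[of D "hilbert I D"]) (use D hilbert_mono in \<open>auto intro: antisym\<close>)
qed

text \<open>
  The Hilbert function is nondecreasing and bounded, hence finally constant.
\<close>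

lemma zero_dim_scheme_exists:
  assumes "I \<noteq> UNIV"
  obtains s where "zero_dim_scheme I s"
proof -
  obtain s N where s: "\<And>d. d \<ge> N \<Longrightarrow> hilbert I d = s" "\<And>d. hilbert I d \<le> s"
    by (rule hilbert_eventually_const) blast
  have "\<not> forms 0 \<subseteq> I" using assms ideal_all_iff[OF I] forms_1 by blast
  then have "hilbert I 0 \<noteq> 0" using hilbert_eq_0_iff[OF I] by auto
  then have "s > 0" using s(2)[of 0] by auto
  then have "zero_dim_scheme I s"
    unfolding zero_dim_scheme_def eventually_sequentially using I sat s(1) by auto
  then show thesis by (rule that)
qed

text \<open>
  Multiplication by \<open>l\<^sup>m\<close> is injective modulo \<open>I\<close>, hence bijective between pieces of the same dimension.
\<close>

lemma lower_degree:
  assumes "hilbert I (d + m) \<le> hilbert I d" and v: "v \<in> forms (d + m)"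
  obtains w where "w \<in> forms d" "v - l ^ m * w \<in> I"
proof -
  obtain b where b: "\<And>i. i < hilbert I d \<Longrightarrow> b i \<in> forms d" "indep_mod I {..<hilbert I d} b"
    using hilbert_basis[OF I] by metis
  have "l ^ m * b i \<in> forms (d + m)" if "i < hilbert I d" for i
    using forms_mult[OF l_power_form[of m] b(1)[OF that]] by (simp add: add.commute)
  then have "spans_mod I {..<hilbert I d} (\<lambda>i. l ^ m * b i) (forms (d + m))"
    using assms(1) by (intro indep_imp_spans[OF I _ _ raise_indep[OF b(2)]]) auto
  then obtain c where c: "v - (\<Sum>i<hilbert I d. cscale (c i) (l ^ m * b i)) \<in> I"
    using v unfolding spans_mod_def by blast
  show thesis
  proof
    show "(\<Sum>i<hilbert I d. cscale (c i) (b i)) \<in> forms d" by (rule lincomb_forms[OF I]) (use b in auto)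
    show "v - l ^ m * (\<Sum>i<hilbert I d. cscale (c i) (b i)) \<in> I"
      using c by (simp add: sum_distrib_left cscale_mult_right)
  qed
qed

end

lemma zero_dim_schemeD:
  assumes "zero_dim_scheme I s"
  shows "hom_ideal I" "saturated I" "bounded_hilbert I" "s > 0" "I \<noteq> UNIV"
proof -
  show I: "hom_ideal I" "saturated I" "s > 0" using assms by (auto simp: zero_dim_scheme_def)
  from assms obtain N where N: "\<And>d. d \<ge> N \<Longrightarrow> hilbert I d = s"
    by (auto simp: zero_dim_scheme_def eventually_sequentially)
  then show "bounded_hilbert I" unfolding bounded_hilbert_def by (metis order_refl)
  show "I \<noteq> UNIV" using hilbert_eq_0_iff[OF I(1), of N] N[of N] I(3) by auto
qed

lemma bounded_hilbert_superset:
  assumes "hom_ideal I" "bounded_hilbert I" "hom_ideal J" "I \<subseteq> J" shows "bounded_hilbert J"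
  using assms hilbert_antimono unfolding bounded_hilbert_def by (meson order_trans)

locale zero_dim = graded_regular +
  fixes s :: nat
  assumes zd: "zero_dim_scheme I s"
begin

lemma hilbert_le: "hilbert I d \<le> s"
proof -
  from zd obtain N where N: "\<And>d. d \<ge> N \<Longrightarrow> hilbert I d = s"
    by (auto simp: zero_dim_scheme_def eventually_sequentially)
  show ?thesis using hilbert_mono[of d "max d N"] N[of "max d N"] by simp
qed

lemma hilbert_eq_degree:
  assumes "scheme_tau I s \<le> d" shows "hilbert I d = s"
proof -
  from zd obtain N where "hilbert I N = s"
    by (auto simp: zero_dim_scheme_def eventually_sequentially)
  then have "hilbert I (scheme_tau I s) = s" unfolding scheme_tau_def by (rule LeastI)
  then show ?thesis using hilbert_mono[OF assms] hilbert_le[of d] by simp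
qed

end

lemma zero_dim_exists:
  fixes I :: "('n::finite, 'k::alg_closed_field) mpoly set"
  assumes "zero_dim_scheme I s"
  obtains l where "zero_dim I l s"
proof -
  note D = zero_dim_schemeD[OF assms]
  obtain l where l: "l \<in> forms 1" "\<And>p. p \<in> support I \<Longrightarrow> peval l p \<noteq> 0"
    using nonvanishing_linear_form[OF D(1,3)] by blast
  show thesis by (rule that[of l], unfold_locales) (use D l assms in auto)
qed

section \<open>Decomposition into components supported at a point\<close>

lemma forms_prod_ex:
  assumes "finite A" "\<And>a. a \<in> A \<Longrightarrow> \<exists>d. f a \<in> forms d"
  obtains e where "prod f A \<in> forms e"
proof -
  have "\<exists>e. prod f A \<in> forms e"
    using assms
  proof (induction A rule: finite_induct)
    case (insert a A)
    then obtain d e where "f a \<in> forms d" "prod f A \<in> forms e" by (metis insertI1 insertI2)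
    then have "f a * prod f A \<in> forms (d + e)" by (rule forms_mult)
    then show ?case using insert(1,2) by auto
  qed (auto intro: exI[of _ 0])
  then show thesis using that by blast
qed

text \<open>
  The kernel of the map from \<open>R\<close> to the localization of \<open>R/I\<close> by the forms that do not vanish at \<open>p\<close>.
  For \<open>p\<close> in the support of a zero-dimensional scheme it is the ideal of the part of the scheme at \<open>p\<close>.
\<close>

definition component ::
  "('n::finite, 'k::field) mpoly set \<Rightarrow> ('n \<Rightarrow> 'k) \<Rightarrow> ('n, 'k) mpoly set" where
  "component I p = {f. \<exists>e. \<exists>h\<in>forms e. peval h p \<noteq> 0 \<and> h * f \<in> I}"

lemma componentI: "h \<in> forms e \<Longrightarrow> peval h p \<noteq> 0 \<Longrightarrow> h * f \<in> I \<Longrightarrow> f \<in> component I p"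
  by (auto simp: component_def)

lemma componentE:
  assumes "f \<in> component I p"
  obtains e h where "h \<in> forms e" "peval h p \<noteq> 0" "h * f \<in> I"
  using assms by (auto simp: component_def)

context
  fixes I :: "('n::finite, 'k::field) mpoly set" and p :: "'n \<Rightarrow> 'k"
  assumes I: "hom_ideal I" and p: "p \<noteq> (\<lambda>_. 0)"
begin

lemma component_superset: "I \<subseteq> component I p"
  by (auto intro!: componentI[of 1 0])

lemma hom_ideal_component: "hom_ideal (component I p)"
  unfolding hom_ideal_def
proof (intro conjI ballI allI)
  show "0 \<in> component I p" using component_superset ideal_0[OF I] by blast
next
  fix f g assume "f \<in> component I p" "g \<in> component I p"
  then obtain d e h k where h: "h \<in> forms d" "peval h p \<noteq> 0" "h * f \<in> I"
    and k: "k \<in> forms e" "peval k p \<noteq> 0" "k * g \<in> I" by (metis componentE)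
  have "k * (h * f) + h * (k * g) \<in> I" by (intro ideal_add[OF I] ideal_mult[OF I] h k)
  then have "(h * k) * (f + g) \<in> I" by (simp add: algebra_simps)
  then show "f + g \<in> component I p"
    by (intro componentI[OF forms_mult[OF h(1) k(1)]]) (use h k in \<open>auto simp: peval_mult\<close>)
next
  fix f r assume "f \<in> component I p"
  then obtain e h where h: "h \<in> forms e" "peval h p \<noteq> 0" "h * f \<in> I" by (rule componentE)
  have "r * (h * f) \<in> I" by (rule ideal_mult[OF I h(3)])
  then show "r * f \<in> component I p"
    by (intro componentI[OF h(1,2)]) (simp add: mult_ac)
next
  fix f d assume "f \<in> component I p"
  then obtain e h where h: "h \<in> forms e" "peval h p \<noteq> 0" "h * f \<in> I" by (rule componentE)
  then show "hom_part d f \<in> component I p"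
    using ideal_hom_part[OF I h(3), of "e + d"]
    by (intro componentI[OF h(1,2)]) (simp add: hom_part_mult_form[OF h(1)])
qed

lemma component_cancel:
  assumes "h \<in> forms e" "peval h p \<noteq> 0" "h * f \<in> component I p"
  shows "f \<in> component I p"
proof -
  from assms(3) obtain d k where k: "k \<in> forms d" "peval k p \<noteq> 0" "k * (h * f) \<in> I"
    by (rule componentE)
  then show ?thesis
    by (intro componentI[OF forms_mult[OF k(1) assms(1)]]) (use assms in \<open>auto simp: peval_mult mult.assoc\<close>)
qed

lemma saturated_component: "saturated (component I p)"
  unfolding saturated_def
proof (intro allI impI)
  fix f assume "\<exists>N. \<forall>g\<in>forms N. g * f \<in> component I p"
  then obtain N where N: "\<forall>g\<in>forms N. g * f \<in> component I p" ..
  obtain i where i: "p i \<noteq> 0" using p by (rule nonzero_coordinate)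
  have "var i ^ N * f \<in> component I p" using N forms_linear_power[OF forms_var] by blast
  then show "f \<in> component I p"
    using component_cancel[OF forms_linear_power[OF forms_var[of i], of N]] i by (simp add: peval_power)
qed

text \<open>
  A form that does not vanish at \<open>p\<close> is regular modulo the component at \<open>p\<close>, but a linear form through
  \<open>q\<close> kills an eigenvector at \<open>q\<close>.
\<close>

lemma eigenvector_component:
  assumes u: "eigenvector (component I p) q d u" shows "proportional p q"
proof (rule ccontr)
  assume "\<not> proportional p q"
  moreover have "q \<noteq> (\<lambda>_. 0)" using u by (simp add: eigenvector_def)
  ultimately obtain f where f: "f \<in> forms 1" "peval f q = 0" "peval f p \<noteq> 0"
    using separating_linear_form[OF p] by blast
  have "f * u \<in> component I p" by (rule eigenvector_vanish[OF hom_ideal_component u f(1,2)])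
  then have "u \<in> component I p" by (rule component_cancel[OF f(1,3)])
  then show False using eigenvector_not_in[OF hom_ideal_component u] by blast
qed

lemma component_proper:
  assumes "p \<in> support I" shows "component I p \<noteq> UNIV"
proof
  assume "component I p = UNIV"
  then obtain e h where "peval h p \<noteq> 0" "h * 1 \<in> I" by (metis UNIV_I componentE)
  then show False using support_vanish[OF assms, of h] by simp
qed

lemma component_support: "p \<in> support I \<Longrightarrow> p \<in> support (component I p)"
  unfolding support_def[of "component I p"]
proof (intro CollectI conjI ballI p)
  fix f assume "p \<in> support I" "f \<in> component I p"
  then obtain e h where "peval h p \<noteq> 0" "peval (h * f) p = 0"
    using support_vanish by (metis componentE)
  then show "peval f p = 0" by (simp add: peval_mult)
qed

end

text \<open>
  The component at \<open>p\<close> is proper and all its eigenvectors are at \<open>p\<close>.  The finitely many denominators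
  in the relations of such an eigenvector can be cleared by one form, which turns it into an
  eigenvector modulo \<open>I\<close> itself.
\<close>

lemma support_eigenvector:
  fixes I :: "('n::finite, 'k::alg_closed_field) mpoly set"
  assumes I: "hom_ideal I" "saturated I" "bounded_hilbert I" and p: "p \<in> support I"
  obtains q d u where "proportional p q" "eigenvector I q d u"
proof -
  have p0: "p \<noteq> (\<lambda>_. 0)" using p by (rule support_nonzero)
  let ?C = "component I p"
  note C = hom_ideal_component[OF I(1) p0]
  have "bounded_hilbert ?C"
    by (rule bounded_hilbert_superset[OF I(1,3) C component_superset[OF I(1) p0]])
  moreover have "\<not> UNIV \<subseteq> ?C" using component_proper[OF I(1) p0 p] by auto
  ultimately obtain q d v where v: "eigenvector ?C q d v"
    using eigenvector_in_ideal[OF C saturated_component[OF I(1) p0] _ hom_ideal_UNIV] by metis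
  have pq: "proportional p q" by (rule eigenvector_component[OF I(1) p0 v])
  let ?r = "\<lambda>(i, k). cscale (q i) (var k * v) - cscale (q k) (var i * v)"
  have "\<exists>h e. h \<in> forms e \<and> peval h p \<noteq> 0 \<and> h * ?r x \<in> I" for x
  proof -
    have "?r x \<in> ?C" using eigenvector_rel[OF C v] by (cases x) simp
    then obtain e h where "h \<in> forms e" "peval h p \<noteq> 0" "h * ?r x \<in> I" by (rule componentE)
    then show ?thesis by (intro exI conjI)
  qed
  then have "\<forall>x. \<exists>h. (\<exists>e. h \<in> forms e) \<and> peval h p \<noteq> 0 \<and> h * ?r x \<in> I" by blast
  from choice[OF this] obtain h where h: "\<And>x. \<exists>e. h x \<in> forms e"
    "\<And>x. peval (h x) p \<noteq> 0" "\<And>x. h x * ?r x \<in> I"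
    by blast
  define H where "H = (\<Prod>x\<in>UNIV. h x)"
  obtain e where H: "H \<in> forms e"
    unfolding H_def using h(1) by (rule forms_prod_ex[OF finite_UNIV])
  have Hp: "peval H p \<noteq> 0" unfolding H_def by (simp add: peval_prod h(2))
  have Hr: "H * ?r x \<in> I" for x
  proof -
    have "H = (\<Prod>y\<in>UNIV - {x}. h y) * h x"
      unfolding H_def by (subst prod.remove[of _ x]) (auto simp: mult.commute)
    then show ?thesis using ideal_mult[OF I(1) h(3)[of x]] by (simp add: mult.assoc)
  qed
  have "H * v \<notin> I"
    using componentI[OF H Hp] eigenvector_not_in[OF C v] by blast
  then have "\<exists>g\<in>forms N. g * (H * v) \<notin> I" for N by (rule saturated_nonmember[OF I(2)])
  moreover have "v \<in> forms d" "q \<noteq> (\<lambda>_. 0)" using v by (auto simp: eigenvector_def)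
  moreover have "cscale (q i) (var k * (H * v)) - cscale (q k) (var i * (H * v)) \<in> I" for i k
    using Hr[of "(i, k)"] by (simp add: right_diff_distrib cscale_mult_right mult_ac)
  ultimately have "eigenvector I q (e + d) (H * v)"
    unfolding eigenvector_def using H by (auto intro: forms_mult)
  with pq show thesis by (rule that)
qed

text \<open>
  A point of the support of the component carries an eigenvector of the component, which must be at \<open>p\<close>.
\<close>

lemma support_component:
  fixes I :: "('n::finite, 'k::alg_closed_field) mpoly set"
  assumes I: "hom_ideal I" "bounded_hilbert I" and p: "p \<in> support I"
  shows "support (component I p) = {q. proportional p q}"
proof (intro equalityI subsetI CollectI)
  have p0: "p \<noteq> (\<lambda>_. 0)" using p by (rule support_nonzero)
  note C = hom_ideal_component[OF I(1) p0]
  fix q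
  show "q \<in> support (component I p)" if "q \<in> {q. proportional p q}"
    using support_proportional[OF C component_support[OF I(1) p0 p]] that by blast
  assume q: "q \<in> support (component I p)"
  have "bounded_hilbert (component I p)"
    by (rule bounded_hilbert_superset[OF I C component_superset[OF I(1) p0]])
  then obtain q' d u where "proportional q q'" "eigenvector (component I p) q' d u"
    using support_eigenvector[OF C saturated_component[OF I(1) p0] _ q] by metis
  then show "proportional p q"
    using eigenvector_component[OF I(1) p0] proportional_sym proportional_trans by blast
qed

lemma single_point_iff: "single_point Q \<longleftrightarrow> (\<exists>p. p \<noteq> (\<lambda>_. 0) \<and> support Q = {q. proportional p q})"
  unfolding single_point_def proportional_def by (simp add: conj_commute)

lemma single_point_component_eq:
  fixes Q :: "('n::finite, 'k::alg_closed_field) mpoly set"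
  assumes Q: "hom_ideal Q" "saturated Q" "bounded_hilbert Q" "single_point Q" and p: "p \<in> support Q"
  shows "component Q p = Q"
proof
  show "Q \<subseteq> component Q p" using component_superset[OF Q(1) support_nonzero[OF p]] .
  show "component Q p \<subseteq> Q"
  proof
    fix f assume "f \<in> component Q p"
    then obtain e h where h: "h \<in> forms e" "peval h p \<noteq> 0" "h * f \<in> Q" by (rule componentE)
    have "peval h q \<noteq> 0" if "q \<in> support Q" for q
    proof -
      have "proportional p q"
        using that p Q(4) proportional_sym proportional_trans unfolding single_point_iff by blast
      then show ?thesis using proportional_nonvanish h by blast
    qed
    then show "f \<in> Q" using nonvanishing_form_regular[OF Q(1-3) h(1) _ h(3)] by blast
  qed
qed

lemma support_antimono: "I \<subseteq> J \<Longrightarrow> support J \<subseteq> support I"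
  by (auto simp: support_def)

text \<open>
  Multiply forms of the individual ideals that do not vanish at \<open>p\<close>.
\<close>

lemma common_nonvanishing_form:
  assumes "finite S" "\<And>Q. Q \<in> S \<Longrightarrow> hom_ideal Q" "p \<noteq> (\<lambda>_. 0)" "\<And>Q. Q \<in> S \<Longrightarrow> p \<notin> support Q"
  obtains h e where "h \<in> forms e" "h \<in> \<Inter>S" "peval h p \<noteq> 0"
proof -
  have "\<forall>Q\<in>S. \<exists>f d. f \<in> Q \<and> f \<in> forms d \<and> peval f p \<noteq> 0"
    using assms support_form_nonvanish by metis
  then obtain f where f: "\<And>Q. Q \<in> S \<Longrightarrow> f Q \<in> Q" "\<And>Q. Q \<in> S \<Longrightarrow> \<exists>d. f Q \<in> forms d"
    "\<And>Q. Q \<in> S \<Longrightarrow> peval (f Q) p \<noteq> 0" by metis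
  obtain e where e: "prod f S \<in> forms e" using f(2) by (rule forms_prod_ex[OF assms(1)])
  have "prod f S \<in> Q" if "Q \<in> S" for Q
    using f(1)[OF that] assms(2)[OF that] that assms(1)
    by (simp add: prod.remove[of S Q] ideal_mult_right)
  then show thesis using that[of "prod f S" e] e f(3) assms(1) by (simp add: peval_prod)
qed

lemma support_Inter:
  assumes "finite S" "\<And>Q. Q \<in> S \<Longrightarrow> hom_ideal Q"
  shows "support (\<Inter>S) = (\<Union>Q\<in>S. support Q)"
proof
  show "(\<Union>Q\<in>S. support Q) \<subseteq> support (\<Inter>S)"
    using support_antimono[of "\<Inter>S"] by (meson Inter_lower UN_least)
  show "support (\<Inter>S) \<subseteq> (\<Union>Q\<in>S. support Q)"
  proof (rule ccontr)
    assume "\<not> ?thesis"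
    then obtain p where p: "p \<in> support (\<Inter>S)" "\<And>Q. Q \<in> S \<Longrightarrow> p \<notin> support Q" by blast
    obtain h e where "h \<in> \<Inter>S" "peval h p \<noteq> 0"
      using common_nonvanishing_form[OF assms support_nonzero[OF p(1)] p(2)] by blast
    then show False using support_vanish[OF p(1)] by blast
  qed
qed

text \<open>
  Multiplying an element of \<open>Q\<close> by a form of all other ideals that does not vanish at \<open>p\<close> brings it into
  the intersection.  Conversely, forms that do not
  vanish at \<open>p\<close> are regular modulo \<open>Q\<close>, whose support is the single point \<open>p\<close>.
\<close>

lemma irreducible_component_unique:
  fixes S :: "('n::finite, 'k::alg_closed_field) mpoly set set"
  assumes S: "finite S" "\<And>Q. Q \<in> S \<Longrightarrow> hom_ideal Q"
    and dis: "\<And>Q'. Q' \<in> S \<Longrightarrow> Q' \<noteq> Q \<Longrightarrow> support Q \<inter> support Q' = {}"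
    and Q: "Q \<in> S" "saturated Q" "bounded_hilbert Q" "single_point Q" and p: "p \<in> support Q"
  shows "Q = component (\<Inter>S) p"
proof
  have Qh: "hom_ideal Q" using S Q by blast
  have p0: "p \<noteq> (\<lambda>_. 0)" using p by (rule support_nonzero)
  have "component (\<Inter>S) p \<subseteq> component Q p" using Q(1) by (auto simp: component_def)
  then show "component (\<Inter>S) p \<subseteq> Q"
    using single_point_component_eq[OF Qh Q(2-4) p] by simp
  have "p \<notin> support Q'" if "Q' \<in> S - {Q}" for Q' using dis[of Q'] p that by auto
  then obtain h e where h: "h \<in> forms e" "h \<in> \<Inter>(S - {Q})" "peval h p \<noteq> 0"
    using common_nonvanishing_form[of "S - {Q}" p] S p0 by (metis DiffD1 finite_Diff)
  show "Q \<subseteq> component (\<Inter>S) p"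
  proof
    fix f assume f: "f \<in> Q"
    have "h * f \<in> Q'" if "Q' \<in> S" for Q'
      using that f h(2) ideal_mult[OF Qh f] ideal_mult_right[OF S(2)[OF that]] by (cases "Q' = Q") auto
    then show "f \<in> component (\<Inter>S) p" by (intro componentI[OF h(1,3)]) auto
  qed
qed

lemma support_ideal_plus:
  assumes "hom_ideal A" "hom_ideal B" shows "support (ideal_plus A B) \<subseteq> support A \<inter> support B"
  using ideal_plus_superset[OF assms] support_antimono by blast

section \<open>Chinese remaindering\<close>

lemma hilbert_UNIV: "hilbert UNIV d = 0"
  by (simp add: hilbert_def)

lemma hilbert_Inter_le:
  assumes "finite S" "\<And>Q. Q \<in> S \<Longrightarrow> hom_ideal Q"
  shows "hilbert (\<Inter>S) d \<le> (\<Sum>Q\<in>S. hilbert Q d)"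
  using assms
proof (induction S rule: finite_induct)
  case (insert Q S)
  then have "hilbert (Q \<inter> \<Inter>S) d \<le> hilbert Q d + hilbert (\<Inter>S) d"
    using hilbert_plus_Int[of Q "\<Inter>S" d] hom_ideal_Inter[of S] by auto
  with insert show ?case by fastforce
qed (simp add: hilbert_UNIV)

text \<open>
  An ideal with support disjoint from the others is comaximal with their intersection in large degrees,
  by the Nullstellensatz, and then the Hilbert functions add.
\<close>

lemma sum_hilbert_components:
  fixes I :: "('n::finite, 'k::alg_closed_field) mpoly set"
  assumes I: "hom_ideal I" "bounded_hilbert I"
    and S: "finite S" "\<And>Q. Q \<in> S \<Longrightarrow> hom_ideal Q" "\<And>Q. Q \<in> S \<Longrightarrow> I \<subseteq> Q"
    and dis: "\<And>Q Q'. Q \<in> S \<Longrightarrow> Q' \<in> S \<Longrightarrow> Q \<noteq> Q' \<Longrightarrow> support Q \<inter> support Q' = {}"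
  obtains N where "\<And>d. d \<ge> N \<Longrightarrow> hilbert (\<Inter>S) d = (\<Sum>Q\<in>S. hilbert Q d)"
proof -
  have "\<exists>N. \<forall>d\<ge>N. hilbert (\<Inter>S) d = (\<Sum>Q\<in>S. hilbert Q d)"
    using S dis
  proof (induction S rule: finite_induct)
    case (insert Q S)
    then obtain N where N: "\<And>d. d \<ge> N \<Longrightarrow> hilbert (\<Inter>S) d = (\<Sum>Q\<in>S. hilbert Q d)"
      by (metis insertI2)
    have Q: "hom_ideal Q" and Sh: "hom_ideal (\<Inter>S)" using insert hom_ideal_Inter[of S] by auto
    let ?J = "ideal_plus Q (\<Inter>S)"
    note J = hom_ideal_plus[OF Q Sh]
    have "support (\<Inter>S) = (\<Union>Q\<in>S. support Q)" using insert by (intro support_Inter) auto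
    moreover have "support Q \<inter> support Q' = {}" if "Q' \<in> S" for Q'
      using insert(2,6) that by blast
    ultimately have "support ?J = {}" using support_ideal_plus[OF Q Sh] by blast
    moreover have "I \<subseteq> ?J" using insert(5) ideal_plus_superset(1)[OF Q Sh] by blast
    then have "bounded_hilbert ?J" by (rule bounded_hilbert_superset[OF I J])
    ultimately obtain M where M: "\<And>d. d \<ge> M \<Longrightarrow> forms d \<subseteq> ?J"
      using no_zeros_imp_all_large_forms[OF J] by blast
    have "hilbert (\<Inter>(insert Q S)) d = (\<Sum>Q\<in>insert Q S. hilbert Q d)" if "d \<ge> max M N" for d
      using hilbert_plus_Int[OF Q Sh, of d] M[of d] N[of d] hilbert_eq_0_iff[OF J, of d] that insert(1,2)
      by simp
    then show ?case by blast
  qed (simp add: hilbert_UNIV)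
  then show thesis using that by blast
qed

text \<open>
  Here the low degree \<open>d\<close> matters: the Nullstellensatz only gives comaximality in large degrees, but
  additivity of the Hilbert functions in degree \<open>d\<close> leaves no room for the quotient by the sum.
\<close>

lemma comaximal_if_hilbert_sum:
  assumes S: "finite S" "\<And>Q. Q \<in> S \<Longrightarrow> hom_ideal Q"
    and h: "(\<Sum>Q\<in>S. hilbert Q d) \<le> hilbert (\<Inter>S) d" and Q: "Q \<in> S"
  shows "forms d \<subseteq> ideal_plus Q (\<Inter>(S - {Q}))"
proof -
  have Qh: "hom_ideal Q" and R: "hom_ideal (\<Inter>(S - {Q}))" using S Q by (auto intro: hom_ideal_Inter)
  have "Q \<inter> \<Inter>(S - {Q}) = \<Inter>S" using Q by auto
  then have "hilbert (ideal_plus Q (\<Inter>(S - {Q}))) d + hilbert (\<Inter>S) d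
      = hilbert Q d + hilbert (\<Inter>(S - {Q})) d"
    using hilbert_plus_Int[OF Qh R, of d] by simp
  moreover have "hilbert (\<Inter>(S - {Q})) d \<le> (\<Sum>Q\<in>S - {Q}. hilbert Q d)"
    using S by (intro hilbert_Inter_le) auto
  moreover have "(\<Sum>Q\<in>S. hilbert Q d) = hilbert Q d + (\<Sum>Q\<in>S - {Q}. hilbert Q d)"
    using S(1) Q by (rule sum.remove)
  ultimately have "hilbert (ideal_plus Q (\<Inter>(S - {Q}))) d = 0" using h by simp
  then show ?thesis using hilbert_eq_0_iff[OF hom_ideal_plus[OF Qh R]] by blast
qed

text \<open>
  An element of all components that is not in \<open>I\<close> would have a multiple that is an eigenvector at some
  \<open>q\<close>, but a form that does not vanish at \<open>q\<close> kills this multiple.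
\<close>

lemma Inter_components:
  fixes I :: "('n::finite, 'k::alg_closed_field) mpoly set"
  assumes I: "hom_ideal I" "saturated I" "bounded_hilbert I"
    and P: "P \<subseteq> support I" "\<And>q. q \<in> support I \<Longrightarrow> \<exists>p\<in>P. proportional p q"
  shows "I = \<Inter>(component I ` P)"
proof
  have P0: "p \<noteq> (\<lambda>_. 0)" if "p \<in> P" for p using P(1) that support_nonzero by blast
  show "I \<subseteq> \<Inter>(component I ` P)" using component_superset[OF I(1) P0] by blast
  have J: "hom_ideal (\<Inter>(component I ` P))"
    using hom_ideal_component[OF I(1) P0] by (intro hom_ideal_Inter) auto
  show "\<Inter>(component I ` P) \<subseteq> I"
  proof (rule ccontr)
    assume n: "\<not> \<Inter>(component I ` P) \<subseteq> I"
    obtain q d u where u: "u \<in> \<Inter>(component I ` P)" "eigenvector I q d u"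
      by (rule eigenvector_in_ideal[OF I J n])
    obtain p where p: "p \<in> P" "proportional p q"
      using P(2)[OF eigenvector_support[OF I(1) u(2)]] by blast
    then have "u \<in> component I p" using u(1) by blast
    then obtain e h where h: "h \<in> forms e" "peval h p \<noteq> 0" "h * u \<in> I" by (rule componentE)
    then have "peval h q \<noteq> 0" using proportional_nonvanish p by blast
    then show False using eigenvector_nonvanish[OF I(1) u(2) h(1)] h(3) by blast
  qed
qed

lemma irreducible_components_exist:
  fixes I :: "('n::finite, 'k::alg_closed_field) mpoly set"
  assumes zd: "zero_dim_scheme I s"
  obtains Qs ss where "irreducible_components I Qs" "list_all2 zero_dim_scheme Qs ss" "sum_list ss = s"
proof -
  note I = zero_dim_schemeD[OF zd]
  obtain P where P: "finite P" "P \<subseteq> support I"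
    "\<And>p q. p \<in> P \<Longrightarrow> q \<in> P \<Longrightarrow> p \<noteq> q \<Longrightarrow> \<not> proportional p q"
    "\<And>q. q \<in> support I \<Longrightarrow> \<exists>p\<in>P. proportional p q"
    using finitely_many_points[OF I(1,3)] by metis
  have P0: "p \<noteq> (\<lambda>_. 0)" if "p \<in> P" for p using P(2) that support_nonzero by blast
  let ?C = "component I"
  have supp: "support (?C p) = {q. proportional p q}" if "p \<in> P" for p
    using support_component[OF I(1,3)] P(2) that by blast
  have C: "hom_ideal (?C p)" "saturated (?C p)" "bounded_hilbert (?C p)" "I \<subseteq> ?C p" if "p \<in> P" for p
    using hom_ideal_component[OF I(1) P0[OF that]] saturated_component[OF I(1) P0[OF that]]
      component_superset[OF I(1) P0[OF that]] bounded_hilbert_superset[OF I(1,3)] by auto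
  have dis: "support (?C p) \<inter> support (?C q) = {}" if "p \<in> P" "q \<in> P" "p \<noteq> q" for p q
    using supp P(3) that proportional_sym proportional_trans by blast
  have inj: "inj_on ?C P"
  proof (rule inj_onI, rule ccontr)
    fix p q assume pq: "p \<in> P" "q \<in> P" "?C p = ?C q" "p \<noteq> q"
    then have "support (?C p) = {}" using dis[OF pq(1,2,4)] by simp
    then show False using supp[OF pq(1)] proportional_refl by blast
  qed
  have "\<exists>n. zero_dim_scheme (?C p) n" if pP: "p \<in> P" for p
  proof -
    obtain l where l: "l \<in> forms 1" "\<And>q. q \<in> support (?C p) \<Longrightarrow> peval l q \<noteq> 0"
      using nonvanishing_linear_form[OF C(1,3)[OF pP]] by blast
    interpret C: graded_regular "?C p" l by unfold_locales (use C[OF pP] l in auto)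
    show ?thesis
      using C.zero_dim_scheme_exists component_proper[OF I(1) P0[OF pP]] P(2) pP by blast
  qed
  then obtain n where n: "\<And>p. p \<in> P \<Longrightarrow> zero_dim_scheme (?C p) (n p)" by metis
  obtain ps where ps: "set ps = P" "distinct ps" using finite_distinct_list[OF P(1)] by blast
  have Inter: "I = \<Inter>(?C ` P)" by (rule Inter_components[OF I(1-3) P(2,4)])
  have "irreducible_components I (map ?C ps)"
    unfolding irreducible_components_def
  proof (intro conjI ballI)
    show "I = \<Inter>(set (map ?C ps))" using Inter ps by simp
    fix Q assume "Q \<in> set (map ?C ps)"
    then obtain p where p: "p \<in> P" "Q = ?C p" using ps by auto
    show "hom_ideal Q" "saturated Q" using C p by auto
    show "single_point Q" unfolding single_point_iff using supp[OF p(1)] P0[OF p(1)] p(2) by blast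
  next
    show "sorted_wrt (\<lambda>Q Q'. support Q \<inter> support Q' = {}) (map ?C ps)"
    proof -
      have "support (?C (ps ! i)) \<inter> support (?C (ps ! k)) = {}" if ik: "i < k" "k < length ps" for i k
      proof -
        have "ps ! i \<noteq> ps ! k" using ik ps(2) by (simp add: nth_eq_iff_index_eq)
        moreover have "ps ! i \<in> P" "ps ! k \<in> P" using ik ps(1) by auto
        ultimately show ?thesis by (intro dis)
      qed
      then show ?thesis by (simp add: sorted_wrt_iff_nth_less)
    qed
  qed
  moreover have "list_all2 zero_dim_scheme (map ?C ps) (map n ps)"
    using n ps by (auto simp: list_all2_map1 list_all2_map2 intro!: list.rel_refl_strong)
  moreover have "sum_list (map n ps) = s"
  proof -
    have disC: "support Q \<inter> support Q' = {}" if "Q \<in> ?C ` P" "Q' \<in> ?C ` P" "Q \<noteq> Q'" for Q Q'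
      using that dis by blast
    have hC: "hom_ideal Q" "I \<subseteq> Q" if "Q \<in> ?C ` P" for Q using that C by blast+
    obtain N where N: "\<And>d. d \<ge> N \<Longrightarrow> hilbert (\<Inter>(?C ` P)) d = (\<Sum>Q\<in>?C ` P. hilbert Q d)"
    proof (rule sum_hilbert_components[OF I(1,3) finite_imageI[OF P(1), of ?C] hC disC])
      fix N assume "\<And>d. d \<ge> N \<Longrightarrow> hilbert (\<Inter>(?C ` P)) d = (\<Sum>Q\<in>?C ` P. hilbert Q d)"
      then show thesis by (rule that)
    qed
    have "\<forall>\<^sub>F d in sequentially. \<forall>p\<in>P. hilbert (?C p) d = n p"
      using n P(1) by (intro eventually_ball_finite) (auto simp: zero_dim_scheme_def)
    moreover have "\<forall>\<^sub>F d in sequentially. hilbert I d = s"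
      using zd by (simp add: zero_dim_scheme_def)
    moreover have "\<forall>\<^sub>F d in sequentially. d \<ge> N" by (rule eventually_ge_at_top)
    ultimately have "\<forall>\<^sub>F d in sequentially. s = (\<Sum>p\<in>P. n p)"
    proof eventually_elim
      case (elim d)
      have "s = (\<Sum>Q\<in>?C ` P. hilbert Q d)" using elim N[of d] Inter by simp
      also have "\<dots> = (\<Sum>p\<in>P. hilbert (?C p) d)" using inj by (simp add: sum.reindex)
      finally show ?case using elim by simp
    qed
    then have "s = (\<Sum>p\<in>P. n p)" by simp
    then show ?thesis using ps by (simp add: sum_list_distinct_conv_sum_set)
  qed
  ultimately show thesis by (rule that)
qed

section \<open>The pairing between forms and divided power forms\<close>

text \<open>
  The perfect pairing of \<open>R\<^sub>j\<close> with \<open>\<Gamma>\<^sub>j\<close> in which monomials and divided power monomials are dual bases.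
\<close>

definition pairing :: "('a \<Rightarrow>\<^sub>0 'k::field) \<Rightarrow> ('a \<Rightarrow>\<^sub>0 'k) \<Rightarrow> 'k" where
  "pairing h F = (\<Sum>u\<in>Poly_Mapping.keys h. coef h u * coef F u)"

lemma pairing_superset:
  "finite A \<Longrightarrow> Poly_Mapping.keys h \<subseteq> A \<Longrightarrow> pairing h F = (\<Sum>u\<in>A. coef h u * coef F u)"
  unfolding pairing_def by (rule sum.mono_neutral_left) (auto simp: in_keys_iff)

lemma pairing_add_left: "pairing (g + h) F = pairing g F + pairing h F"
proof -
  let ?A = "Poly_Mapping.keys g \<union> Poly_Mapping.keys h"
  have "Poly_Mapping.keys (g + h) \<subseteq> ?A" by (rule keys_add)
  then have "pairing (g + h) F = (\<Sum>u\<in>?A. coef (g + h) u * coef F u)"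
    by (intro pairing_superset) auto
  also have "\<dots> = (\<Sum>u\<in>?A. coef g u * coef F u) + (\<Sum>u\<in>?A. coef h u * coef F u)"
    by (simp add: lookup_add distrib_right sum.distrib)
  also have "\<dots> = pairing g F + pairing h F"
    by (subst (1 2) pairing_superset[of ?A]) auto
  finally show ?thesis .
qed

lemma pairing_0 [simp]: "pairing 0 F = 0"
  by (simp add: pairing_def)

lemma pairing_0_right [simp]: "pairing h 0 = 0"
  by (simp add: pairing_def)

lemma pairing_cscale_left: "pairing (cscale c h) F = c * pairing h F"
  by (subst pairing_superset[of "Poly_Mapping.keys h"])
    (auto simp: in_keys_iff pairing_def sum_distrib_left mult.assoc)

lemma pairing_diff_left: "pairing (g - h) F = pairing g F - pairing h F"
  by (metis add_diff_cancel_right' diff_add_cancel pairing_add_left)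

lemma pairing_sum_left: "pairing (sum f A) F = (\<Sum>a\<in>A. pairing (f a) F)"
  by (induction A rule: infinite_finite_induct) (auto simp: pairing_add_left)

lemma pairing_add_right: "pairing h (F + G) = pairing h F + pairing h G"
  by (simp add: pairing_def lookup_add distrib_left sum.distrib)

lemma pairing_cscale_right: "pairing h (cscale c F) = c * pairing h F"
  by (simp add: pairing_def sum_distrib_left mult_ac)

lemma pairing_sum_right: "pairing h (sum f A) = (\<Sum>a\<in>A. pairing h (f a))"
  by (induction A rule: infinite_finite_induct) (auto simp: pairing_add_right)

lemma pairing_monomial: "pairing (monomial u c) F = c * coef F u"
  by (subst pairing_superset[of "{u}"]) auto

text \<open>
  In equal degrees a monomial contracts a divided power monomial to zero unless the exponents agree.
\<close>

lemma contract_eq_pairing: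
  fixes h F :: "'n::finite expo \<Rightarrow>\<^sub>0 'k::field"
  assumes h: "h \<in> forms j" and F: "F \<in> forms j"
  shows "contract h F = monomial 0 (pairing h F)"
proof -
  have le: "(\<forall>i. coef K i \<le> coef U i) \<longleftrightarrow> U = K"
    if "expo_degree K = j" "expo_degree U = j" for K U :: "'n expo"
  proof
    assume a: "\<forall>i. coef K i \<le> coef U i"
    then have "U = K + (U - K)"
      by (intro poly_mapping_eqI) (simp add: lookup_add lookup_minus)
    then have "expo_degree U = expo_degree K + expo_degree (U - K)" by (metis expo_degree_add)
    then have "expo_degree (U - K) = 0" using that by simp
    then have "coef U i - coef K i = 0" for i
      by (simp add: expo_degree_def lookup_minus)
    then show "U = K" using a by (intro poly_mapping_eqI) (simp add: antisym)
  qed simp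
  have "contract h F = (\<Sum>K\<in>Poly_Mapping.keys h. \<Sum>U\<in>Poly_Mapping.keys F.
     if U = K then monomial 0 (coef h K * coef F K) else 0)"
    unfolding contract_def
    using h F by (intro sum.cong refl) (auto simp: forms_def le)
  also have "\<dots> = (\<Sum>K\<in>Poly_Mapping.keys h. monomial 0 (coef h K * coef F K))"
    by (intro sum.cong refl) (auto simp: in_keys_iff)
  also have "(\<Sum>K\<in>A. monomial 0 (c K)) = monomial 0 (\<Sum>K\<in>A. c K)" for A and c :: "'n expo \<Rightarrow> 'k"
    by (induction A rule: infinite_finite_induct) (auto simp: single_add)
  finally show ?thesis unfolding pairing_def .
qed

lemma perp_iff: "F \<in> perp I j \<longleftrightarrow> F \<in> forms j \<and> (\<forall>h\<in>I \<inter> forms j. pairing h F = 0)"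
proof -
  have "contract h F = 0 \<longleftrightarrow> pairing h F = 0" if "h \<in> forms j" "F \<in> forms j" for h
    using contract_eq_pairing[OF that] by (metis lookup_single_eq lookup_zero single_zero)
  then show ?thesis unfolding perp_def by blast
qed

lemma perp_pairing: "F \<in> perp I j \<Longrightarrow> h \<in> I \<Longrightarrow> h \<in> forms j \<Longrightarrow> pairing h F = 0"
  by (simp add: perp_iff)

lemma perp_antimono: "I \<subseteq> J \<Longrightarrow> perp J j \<subseteq> perp I j"
  unfolding perp_iff subset_iff by blast

lemma subspace_perp: "cvec.subspace (perp I j)"
  by (rule cvec.subspaceI)
    (auto simp: perp_iff pairing_add_right pairing_cscale_right forms_add forms_cscale)

lemma perp_pairing_cong:
  assumes "F \<in> perp I j" "g - h \<in> I" "g \<in> forms j" "h \<in> forms j"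
  shows "pairing g F = pairing h F"
  using perp_pairing[OF assms(1,2) forms_diff[OF assms(3,4)]] by (simp add: pairing_diff_left)

text \<open>
  A functional on \<open>R\<^sub>j\<close> that vanishes on \<open>I\<^sub>j\<close> but not at \<open>e\<close> is the pairing with some \<open>F\<close>, whose
  coefficients are the values of the functional at the monomials.
\<close>

lemma perp_separates:
  fixes I :: "('n::finite, 'k::field) mpoly set"
  assumes I: "hom_ideal I" and e: "e \<in> forms j" "e \<notin> I"
  obtains F where "F \<in> perp I j" "pairing e F \<noteq> 0"
proof -
  interpret vp: vector_space_pair "cscale :: 'k \<Rightarrow> ('n, 'k) mpoly \<Rightarrow> _" "(*) :: 'k \<Rightarrow> 'k \<Rightarrow> 'k"
    by unfold_locales (auto simp: algebra_simps)
  obtain B where B: "cvec.independent B" "cvec.span B = I \<inter> forms j"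
    using basis_of_fin_dim[OF subspace_Int_forms[OF I] fin_dim_subset[OF fin_dim_forms Int_lower2]]
    by metis
  have "e \<notin> cvec.span B" using e B(2) by simp
  then have "cvec.independent (insert e B)" using B(1) by (rule cvec.independent_insertI)
  then obtain g where g: "Vector_Spaces.linear cscale (*) g" "\<forall>x\<in>insert e B. g x = (if x = e then 1 else 0)"
    using vp.linear_independent_extend[of "insert e B" "\<lambda>x. if x = e then 1 else 0"] by blast
  have eB: "e \<notin> B" using \<open>e \<notin> cvec.span B\<close> cvec.span_base by blast
  have "g x = 0" if "x \<in> B" for x using g(2) eB that by auto
  then have g0: "g x = 0" if "x \<in> I \<inter> forms j" for x
    using vp.linear_eq_0_on_span[OF g(1), of B x] that B(2) by auto
  have ga: "g (x + y) = g x + g y" and gs: "g (cscale c x) = c * g x" for x y c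
    using g(1) by (auto simp: Vector_Spaces.linear_iff)
  have g00: "g 0 = 0" using gs[of 0 0] by simp
  have gsum: "g (sum f A) = (\<Sum>a\<in>A. g (f a))" for f and A :: "'n expo set"
    by (induction A rule: infinite_finite_induct) (auto simp: ga g00)
  let ?E = "{u :: 'n expo. expo_degree u = j}"
  define F where "F = (\<Sum>u\<in>?E. monomial u (g (monomial u 1)))"
  have cF: "coef F u = (if u \<in> ?E then g (monomial u 1) else 0)" for u
  proof -
    have "coef F u = (\<Sum>v\<in>?E. if v = u then g (monomial u 1) else 0)"
      unfolding F_def lookup_sum by (rule sum.cong) (auto simp: lookup_single when_def)
    also have "\<dots> = (if u \<in> ?E then g (monomial u 1) else 0)"
      using finite_expo_degree by (rule sum.delta)
    finally show ?thesis .
  qed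
  have pF: "pairing h F = g h" if "h \<in> forms j" for h
  proof -
    have "pairing h F = (\<Sum>u\<in>Poly_Mapping.keys h. g (cscale (coef h u) (monomial u 1)))"
      unfolding pairing_def by (rule sum.cong) (use that in \<open>auto simp: cF gs forms_def\<close>)
    also have "\<dots> = g (\<Sum>u\<in>Poly_Mapping.keys h. monomial u (coef h u))"
      by (simp add: gsum cscale_eq_mult mult_single)
    also have "\<dots> = g h" by (simp flip: sum_monomials)
    finally show ?thesis .
  qed
  have "F \<in> forms j" by (auto simp: forms_iff cF split: if_splits)
  then have "F \<in> perp I j" using g0 pF by (simp add: perp_iff)
  moreover have "pairing e F \<noteq> 0" using pF[OF e(1)] g(2) by simp
  ultimately show thesis by (rule that)
qed

text \<open>
  Comaximality decomposes each monomial \<open>x\<^sup>u\<close> as an element of \<open>Q\<close> plus an element \<open>b\<close> of the other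
  ideals; \<open>b\<close> is the image of \<open>x\<^sup>u\<close> under the idempotent of \<open>Q\<close>.  The summand of \<open>F\<close> at \<open>Q\<close> is \<open>F\<close>
  composed with this idempotent.
\<close>

lemma perp_summands_exist:
  fixes S :: "('n::finite, 'k::field) mpoly set set"
  assumes S: "finite S" "\<And>Q. Q \<in> S \<Longrightarrow> hom_ideal Q"
    and co: "\<And>Q. Q \<in> S \<Longrightarrow> forms j \<subseteq> ideal_plus Q (\<Inter>(S - {Q}))"
    and F: "F \<in> perp (\<Inter>S) j"
  obtains G where "\<And>Q. Q \<in> S \<Longrightarrow> G Q \<in> perp Q j" "F = (\<Sum>Q\<in>S. G Q)"
proof -
  let ?E = "{u :: 'n expo. expo_degree u = j}"
  have R: "hom_ideal (\<Inter>(S - {Q}))" for Q using S by (intro hom_ideal_Inter) auto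
  have "\<forall>Q u. \<exists>b. Q \<in> S \<and> u \<in> ?E \<longrightarrow>
    monomial u 1 - b \<in> Q \<and> b \<in> \<Inter>(S - {Q}) \<and> b \<in> forms j"
  proof (intro allI)
    fix Q u
    show "\<exists>b. Q \<in> S \<and> u \<in> ?E \<longrightarrow> monomial u 1 - b \<in> Q \<and> b \<in> \<Inter>(S - {Q}) \<and> b \<in> forms j"
    proof (cases "Q \<in> S \<and> u \<in> ?E")
      case True
      then have m: "monomial u 1 \<in> (forms j :: ('n, 'k) mpoly set)" by (simp add: forms_monomial)
      then have "monomial u 1 \<in> ideal_plus Q (\<Inter>(S - {Q}))" using co True by blast
      then obtain a b where "a \<in> Q" "b \<in> \<Inter>(S - {Q})" "b \<in> forms j" "monomial u 1 = a + b"
        using ideal_plus_forms_split[OF S(2) R _ m] True by metis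
      then show ?thesis by (metis add_diff_cancel_right')
    qed blast
  qed
  then obtain b where b: "\<And>Q u. Q \<in> S \<Longrightarrow> u \<in> ?E \<Longrightarrow> monomial u 1 - b Q u \<in> Q"
    "\<And>Q u. Q \<in> S \<Longrightarrow> u \<in> ?E \<Longrightarrow> b Q u \<in> \<Inter>(S - {Q})"
    "\<And>Q u. Q \<in> S \<Longrightarrow> u \<in> ?E \<Longrightarrow> b Q u \<in> forms j"
    by metis
  define G where "G Q = (\<Sum>u\<in>?E. monomial u (pairing (b Q u) F))" for Q
  have cG: "coef (G Q) u = (if u \<in> ?E then pairing (b Q u) F else 0)" for Q u
  proof -
    have "coef (G Q) u = (\<Sum>v\<in>?E. if v = u then pairing (b Q u) F else 0)"
      unfolding G_def lookup_sum by (rule sum.cong) (auto simp: lookup_single when_def)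
    also have "\<dots> = (if u \<in> ?E then pairing (b Q u) F else 0)"
      using finite_expo_degree by (rule sum.delta)
    finally show ?thesis .
  qed
  have "G Q \<in> perp Q j" if Q: "Q \<in> S" for Q
    unfolding perp_iff
  proof (intro conjI ballI)
    show "G Q \<in> forms j" by (auto simp: forms_iff cG split: if_splits)
    fix r assume r: "r \<in> Q \<inter> forms j"
    define r' where "r' = (\<Sum>u\<in>Poly_Mapping.keys r. cscale (coef r u) (b Q u))"
    have kr: "u \<in> ?E" if "u \<in> Poly_Mapping.keys r" for u using r that by (auto simp: forms_def)
    have "r = (\<Sum>u\<in>Poly_Mapping.keys r. cscale (coef r u) (monomial u 1))"
      by (subst sum_monomials) (simp add: cscale_eq_mult mult_single)
    then have "r - r' = (\<Sum>u\<in>Poly_Mapping.keys r. cscale (coef r u) (monomial u 1)) - r'" by simp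
    also have "\<dots> = (\<Sum>u\<in>Poly_Mapping.keys r. cscale (coef r u) (monomial u 1 - b Q u))"
      by (simp add: r'_def cvec.scale_right_diff_distrib sum_subtractf)
    also have "\<dots> \<in> Q" by (intro ideal_sum[OF S(2)[OF Q]] ideal_cscale[OF S(2)[OF Q]] b(1)[OF Q] kr)
    finally have "r' \<in> Q" using r ideal_add_iff[OF S(2)[OF Q]] by blast
    moreover have "r' \<in> \<Inter>(S - {Q})"
      unfolding r'_def by (intro ideal_sum[OF R] ideal_cscale[OF R] b(2)[OF Q] kr)
    ultimately have "r' \<in> \<Inter>S" by auto
    moreover have "r' \<in> forms j"
      unfolding r'_def by (intro forms_sum forms_cscale b(3)[OF Q] kr)
    ultimately have "pairing r' F = 0" by (rule perp_pairing[OF F])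
    moreover have "pairing r (G Q) = pairing r' F"
      unfolding r'_def pairing_sum_left pairing_cscale_left
      unfolding pairing_def[of r] by (rule sum.cong) (use kr in \<open>auto simp: cG\<close>)
    ultimately show "pairing r (G Q) = 0" by simp
  qed
  moreover have "F = (\<Sum>Q\<in>S. G Q)"
  proof (rule poly_mapping_eqI)
    fix u
    show "coef F u = coef (\<Sum>Q\<in>S. G Q) u"
    proof (cases "u \<in> ?E")
      case False
      then have "coef F u = 0" using F by (auto simp: perp_iff forms_iff)
      then show ?thesis using False by (simp add: lookup_sum cG)
    next
      case True
      let ?d = "monomial u 1 - (\<Sum>Q\<in>S. b Q u)"
      have "?d \<in> Q" if Q: "Q \<in> S" for Q
      proof -
        have d: "?d = (monomial u 1 - b Q u) - (\<Sum>Q'\<in>S - {Q}. b Q' u)"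
          using S(1) Q by (simp add: sum.remove[of S Q])
        have "b Q' u \<in> Q" if "Q' \<in> S - {Q}" for Q'
          using b(2)[of Q' u] that True Q by auto
        then show ?thesis
          unfolding d by (intro ideal_diff[OF S(2)[OF Q]] ideal_sum[OF S(2)[OF Q]] b(1)[OF Q True])
      qed
      then have "?d \<in> \<Inter>S" by blast
      moreover have "?d \<in> forms j"
        using True b(3) by (intro forms_diff forms_sum forms_monomial) auto
      ultimately have "pairing ?d F = 0" by (rule perp_pairing[OF F])
      then show ?thesis
        using True by (simp add: lookup_sum cG pairing_diff_left pairing_monomial pairing_sum_left)
    qed
  qed
  ultimately show thesis by (rule that)
qed

text \<open>
  A form of all other ideals pairs to zero with all other summands, so its pairing with the summand at
  \<open>Q\<close> is determined by the sum; modulo \<open>Q\<close> every form of degree \<open>j\<close> is such a form.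
\<close>

lemma perp_summands_unique:
  fixes S :: "('n::finite, 'k::field) mpoly set set"
  assumes S: "finite S" "\<And>Q. Q \<in> S \<Longrightarrow> hom_ideal Q"
    and co: "\<And>Q. Q \<in> S \<Longrightarrow> forms j \<subseteq> ideal_plus Q (\<Inter>(S - {Q}))"
    and G: "\<And>Q. Q \<in> S \<Longrightarrow> G Q \<in> perp Q j" and H: "\<And>Q. Q \<in> S \<Longrightarrow> H Q \<in> perp Q j"
    and eq: "(\<Sum>Q\<in>S. G Q) = (\<Sum>Q\<in>S. H Q)" and Q: "Q \<in> S"
  shows "G Q = H Q"
proof -
  define D where "D Q = G Q - H Q" for Q
  have D: "D Q \<in> perp Q j" if "Q \<in> S" for Q
    unfolding D_def by (intro cvec.subspace_diff[OF subspace_perp] G H that)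
  have sD: "(\<Sum>Q\<in>S. D Q) = 0" by (simp add: D_def sum_subtractf eq)
  have R: "hom_ideal (\<Inter>(S - {Q}))" using S by (intro hom_ideal_Inter) auto
  have "pairing r (D Q) = 0" if r: "r \<in> forms j" for r
  proof -
    obtain a b where ab: "a \<in> Q" "a \<in> forms j" "b \<in> \<Inter>(S - {Q})" "b \<in> forms j" "r = a + b"
      using ideal_plus_forms_split[OF S(2)[OF Q] R _ r] co[OF Q] r by blast
    have "0 = (\<Sum>Q'\<in>S. pairing b (D Q'))"
      using sD pairing_sum_right[of b D S] by (simp add: pairing_def)
    also have "\<dots> = pairing b (D Q) + (\<Sum>Q'\<in>S - {Q}. pairing b (D Q'))"
      using S(1) Q by (rule sum.remove)
    also have "(\<Sum>Q'\<in>S - {Q}. pairing b (D Q')) = 0"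
      using ab(3,4) D by (intro sum.neutral) (auto intro: perp_pairing)
    finally have "pairing b (D Q) = 0" by simp
    moreover have "pairing a (D Q) = 0" by (rule perp_pairing[OF D[OF Q] ab(1,2)])
    ultimately show ?thesis by (simp add: ab(5) pairing_add_left)
  qed
  then have "coef (D Q) u = 0" if "expo_degree u = j" for u
    using forms_monomial[OF that] by (metis mult_1 pairing_monomial)
  moreover have "coef (D Q) u = 0" if "expo_degree u \<noteq> j" for u
    using D[OF Q] that by (auto simp: perp_iff forms_iff)
  ultimately have "D Q = 0" by (metis poly_mapping_eqI lookup_zero)
  then show ?thesis by (simp add: D_def)
qed


section \<open>Local rings and eigenvectors\<close>

lemma fracsE:
  assumes "(f, g) \<in> fracs p"
  obtains d where "f \<in> forms d" "g \<in> forms d" "peval g p \<noteq> 0"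
  using assms by (auto simp: fracs_def)

lemma fracsI: "f \<in> forms d \<Longrightarrow> g \<in> forms d \<Longrightarrow> peval g p \<noteq> 0 \<Longrightarrow> (f, g) \<in> fracs p"
  by (auto simp: fracs_def)

lemma fracs_mult: "(f, g) \<in> fracs p \<Longrightarrow> (f', g') \<in> fracs p \<Longrightarrow> (f * f', g * g') \<in> fracs p"
  by (elim fracsE, rule fracsI) (auto intro: forms_mult simp: peval_mult)

context
  fixes I :: "('n::finite, 'k::field) mpoly set" and p :: "'n \<Rightarrow> 'k"
  assumes I: "hom_ideal I"
begin

lemma frac_relI:
  "(f, g) \<in> fracs p \<Longrightarrow> (f', g') \<in> fracs p \<Longrightarrow> h \<in> forms e \<Longrightarrow> peval h p \<noteq> 0 \<Longrightarrow>
    h * (f * g' - f' * g) \<in> I \<Longrightarrow> ((f, g), (f', g')) \<in> frac_rel I p"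
  by (auto simp: frac_rel_def)

lemma frac_relE:
  assumes "((f, g), (f', g')) \<in> frac_rel I p"
  obtains e h where "(f, g) \<in> fracs p" "(f', g') \<in> fracs p" "h \<in> forms e" "peval h p \<noteq> 0"
    "h * (f * g' - f' * g) \<in> I"
  using assms by (auto simp: frac_rel_def)

lemma equiv_frac_rel: "equiv (fracs p) (frac_rel I p)"
proof (rule equivI)
  show "frac_rel I p \<subseteq> fracs p \<times> fracs p" by (auto simp: frac_rel_def)
  show "refl_on (fracs p) (frac_rel I p)"
    by (auto simp: refl_on_def frac_rel_def ideal_0[OF I] intro!: exI[of _ 0] bexI[of _ 1])
  show "sym (frac_rel I p)"
  proof (rule symI)
    fix x y assume "(x, y) \<in> frac_rel I p"
    then obtain f g f' g' where xy: "x = (f, g)" "y = (f', g')" "((f, g), (f', g')) \<in> frac_rel I p"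
      by (cases x, cases y) auto
    from xy(3) obtain e h where h: "(f, g) \<in> fracs p" "(f', g') \<in> fracs p" "h \<in> forms e" "peval h p \<noteq> 0"
      "h * (f * g' - f' * g) \<in> I" by (rule frac_relE)
    have "0 - h * (f * g' - f' * g) \<in> I" by (intro ideal_diff[OF I] ideal_0[OF I] h)
    then have "h * (f' * g - f * g') \<in> I" by (simp add: algebra_simps)
    then show "(y, x) \<in> frac_rel I p" unfolding xy by (rule frac_relI[OF h(2,1,3,4)])
  qed
  show "trans (frac_rel I p)"
  proof (rule transI)
    fix x y z assume "(x, y) \<in> frac_rel I p" "(y, z) \<in> frac_rel I p"
    then obtain f g f' g' f'' g'' where xy: "x = (f, g)" "y = (f', g')" "z = (f'', g'')"
      "((f, g), (f', g')) \<in> frac_rel I p" "((f', g'), (f'', g'')) \<in> frac_rel I p"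
      by (cases x, cases y, cases z) auto
    from xy(4) obtain e h where h: "(f, g) \<in> fracs p" "(f', g') \<in> fracs p" "h \<in> forms e" "peval h p \<noteq> 0"
      "h * (f * g' - f' * g) \<in> I" by (rule frac_relE)
    from xy(5) obtain d k where k: "(f'', g'') \<in> fracs p" "k \<in> forms d" "peval k p \<noteq> 0"
      "k * (f' * g'' - f'' * g') \<in> I" by (rule frac_relE)
    from h(2) obtain c where c: "g' \<in> forms c" "peval g' p \<noteq> 0" by (rule fracsE)
    have "k * g'' * (h * (f * g' - f' * g)) + h * g * (k * (f' * g'' - f'' * g')) \<in> I"
      by (intro ideal_add[OF I] ideal_mult[OF I] h k)
    also have "k * g'' * (h * (f * g' - f' * g)) + h * g * (k * (f' * g'' - f'' * g'))
      = (h * k * g') * (f * g'' - f'' * g)" by (simp add: algebra_simps)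
    finally show "(x, z) \<in> frac_rel I p"
      unfolding xy using h k c
      by (intro frac_relI[of _ _ _ _ "h * k * g'" "e + d + c"] forms_mult) (auto simp: peval_mult)
  qed
qed

definition frac_class :: "('n, 'k) mpoly \<Rightarrow> ('n, 'k) mpoly \<Rightarrow> (('n, 'k) mpoly \<times> ('n, 'k) mpoly) set" where
  "frac_class f g = frac_rel I p `` {(f, g)}"

lemma frac_class_eq_iff:
  "(f, g) \<in> fracs p \<Longrightarrow> (f', g') \<in> fracs p \<Longrightarrow>
    frac_class f g = frac_class f' g' \<longleftrightarrow> ((f, g), (f', g')) \<in> frac_rel I p"
  unfolding frac_class_def by (rule eq_equiv_class_iff[OF equiv_frac_rel])

lemma frac_class_carrier: "(f, g) \<in> fracs p \<Longrightarrow> frac_class f g \<in> carrier (local_ring I p)"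
  by (auto simp: local_ring_def frac_class_def intro: quotientI)

lemma carrierE:
  assumes "x \<in> carrier (local_ring I p)"
  obtains f g where "(f, g) \<in> fracs p" "x = frac_class f g"
  using assms by (auto simp: local_ring_def frac_class_def elim!: quotientE)

lemma frac_class_mult:
  assumes fg: "(f, g) \<in> fracs p" and fg': "(f', g') \<in> fracs p"
  shows "frac_class f g \<otimes>\<^bsub>local_ring I p\<^esub> frac_class f' g' = frac_class (f * f') (g * g')"
proof -
  have "frac_class (a * a') (b * b') = frac_class (f * f') (g * g')"
    if "(a, b) \<in> frac_class f g" "(a', b') \<in> frac_class f' g'" for a b a' b'
  proof -
    from that have r: "((f, g), (a, b)) \<in> frac_rel I p" "((f', g'), (a', b')) \<in> frac_rel I p"
      by (auto simp: frac_class_def)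
    from r(1) obtain e h where h: "(a, b) \<in> fracs p" "h \<in> forms e" "peval h p \<noteq> 0"
      "h * (f * b - a * g) \<in> I" by (rule frac_relE)
    from r(2) obtain d k where k: "(a', b') \<in> fracs p" "k \<in> forms d" "peval k p \<noteq> 0"
      "k * (f' * b' - a' * g') \<in> I" by (rule frac_relE)
    have "k * f' * b' * (h * (f * b - a * g)) + h * a * g * (k * (f' * b' - a' * g')) \<in> I"
      by (intro ideal_add[OF I] ideal_mult[OF I] h k)
    also have "k * f' * b' * (h * (f * b - a * g)) + h * a * g * (k * (f' * b' - a' * g'))
      = (h * k) * ((f * f') * (b * b') - (a * a') * (g * g'))" by (simp add: algebra_simps)
    finally have "((f * f', g * g'), (a * a', b * b')) \<in> frac_rel I p"
      by (intro frac_relI[OF _ _ forms_mult[OF h(2) k(2)]] fracs_mult fg fg' h(1) k(1))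
        (use h k in \<open>auto simp: peval_mult\<close>)
    then show ?thesis
      using frac_class_eq_iff fracs_mult fg fg' h(1) k(1) by metis
  qed
  moreover have "(f, g) \<in> frac_class f g" "(f', g') \<in> frac_class f' g'"
    using equiv_class_self[OF equiv_frac_rel] fg fg' by (auto simp: frac_class_def)
  moreover have "frac_class f g \<otimes>\<^bsub>local_ring I p\<^esub> frac_class f' g'
    = (\<Union>(a, b)\<in>frac_class f g. \<Union>(a', b')\<in>frac_class f' g'. frac_class (a * a') (b * b'))"
    by (simp add: local_ring_def frac_class_def)
  ultimately show ?thesis by fast
qed

lemma local_ring_zero: "\<zero>\<^bsub>local_ring I p\<^esub> = frac_class 0 1"
  by (simp add: local_ring_def frac_class_def)

lemma local_ring_one: "\<one>\<^bsub>local_ring I p\<^esub> = frac_class 1 1"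
  by (simp add: local_ring_def frac_class_def)

lemma frac_class_zero_iff:
  assumes "(f, g) \<in> fracs p"
  shows "frac_class f g = \<zero>\<^bsub>local_ring I p\<^esub> \<longleftrightarrow> f \<in> component I p"
proof -
  have "(0, 1) \<in> fracs p" by (rule fracsI[of _ 0]) auto
  then have "frac_class f g = frac_class 0 1 \<longleftrightarrow> ((f, g), (0, 1)) \<in> frac_rel I p"
    using frac_class_eq_iff[OF assms] by blast
  also have "\<dots> \<longleftrightarrow> f \<in> component I p"
    using assms \<open>(0, 1) \<in> fracs p\<close> by (auto simp: frac_rel_def component_def)
  finally show ?thesis by (simp add: local_ring_zero)
qed

lemma frac_class_unit_iff:
  assumes "(f, g) \<in> fracs p" and p: "p \<in> support I"
  shows "frac_class f g \<in> Units (local_ring I p) \<longleftrightarrow> peval f p \<noteq> 0"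
proof
  have one: "(1, 1) \<in> fracs p" by (rule fracsI[of _ 0]) auto
  obtain d where d: "f \<in> forms d" "g \<in> forms d" "peval g p \<noteq> 0" using assms(1) by (rule fracsE)
  show "frac_class f g \<in> Units (local_ring I p)" if "peval f p \<noteq> 0"
  proof -
    have gf: "(g, f) \<in> fracs p" using d that by (intro fracsI)
    have "((f * g, g * f), (1, 1)) \<in> frac_rel I p" "((g * f, f * g), (1, 1)) \<in> frac_rel I p"
      using fracs_mult[OF assms(1) gf] fracs_mult[OF gf assms(1)] one ideal_0[OF I]
      by (auto intro!: frac_relI[of _ _ _ _ 1 0] simp: mult.commute)
    then have "frac_class f g \<otimes>\<^bsub>local_ring I p\<^esub> frac_class g f = \<one>\<^bsub>local_ring I p\<^esub>"
      "frac_class g f \<otimes>\<^bsub>local_ring I p\<^esub> frac_class f g = \<one>\<^bsub>local_ring I p\<^esub>"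
      using frac_class_eq_iff[OF fracs_mult[OF assms(1) gf] one]
        frac_class_eq_iff[OF fracs_mult[OF gf assms(1)] one]
      by (simp_all add: frac_class_mult[OF assms(1) gf] frac_class_mult[OF gf assms(1)] local_ring_one)
    then show ?thesis
      unfolding Units_def using frac_class_carrier assms(1) gf by blast
  qed
  assume "frac_class f g \<in> Units (local_ring I p)"
  then obtain x where x: "x \<in> carrier (local_ring I p)"
    "frac_class f g \<otimes>\<^bsub>local_ring I p\<^esub> x = \<one>\<^bsub>local_ring I p\<^esub>"
    by (auto simp: Units_def)
  from x(1) obtain f' g' where fg': "(f', g') \<in> fracs p" "x = frac_class f' g'" by (rule carrierE)
  have "((f * f', g * g'), (1, 1)) \<in> frac_rel I p"
    using x(2) frac_class_eq_iff[OF fracs_mult[OF assms(1) fg'(1)] one]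
    by (simp add: fg' frac_class_mult[OF assms(1) fg'(1)] local_ring_one)
  then obtain e h where h: "peval h p \<noteq> 0" "h * (f * f' * 1 - 1 * (g * g')) \<in> I" by (rule frac_relE)
  then have "peval (h * (f * f' * 1 - 1 * (g * g'))) p = 0" using support_vanish[OF p] by blast
  then have "peval f p * peval f' p = peval g p * peval g' p"
    using h(1) by (simp add: peval_mult peval_minus)
  moreover have "peval g' p \<noteq> 0" using fg'(1) by (auto simp: fracs_def)
  ultimately show "peval f p \<noteq> 0" using d(3) by auto
qed

text \<open>
  The maximal ideal consists of the fractions whose numerator vanishes at \<open>p\<close>, and such numerators
  kill an eigenvector at \<open>p\<close>.
\<close>

lemma eigenvector_socle:
  assumes u: "eigenvector I p d u" and x: "x \<in> forms d" "peval x p \<noteq> 0"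
  shows "frac_class u x \<in> socle (local_ring I p)" "frac_class u x \<noteq> \<zero>\<^bsub>local_ring I p\<^esub>"
proof -
  have p: "p \<in> support I" by (rule eigenvector_support[OF I u])
  have ux: "(u, x) \<in> fracs p" using u x by (auto simp: eigenvector_def intro: fracsI)
  have "y \<otimes>\<^bsub>local_ring I p\<^esub> frac_class u x = \<zero>\<^bsub>local_ring I p\<^esub>"
    if "y \<in> max_ideal (local_ring I p)" for y
  proof -
    from that have "y \<in> carrier (local_ring I p)" by (simp add: max_ideal_def)
    then obtain f g where fg: "(f, g) \<in> fracs p" "y = frac_class f g" by (rule carrierE)
    obtain e where f: "f \<in> forms e" using fg(1) by (rule fracsE)
    have "peval f p = 0"
      using that frac_class_unit_iff[OF fg(1) p] by (auto simp: max_ideal_def fg(2))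
    then have "f * u \<in> I" by (rule eigenvector_vanish[OF I u f])
    then have "f * u \<in> component I p" using component_superset[OF I support_nonzero[OF p]] by blast
    then show ?thesis
      using frac_class_zero_iff[OF fracs_mult[OF fg(1) ux]] by (simp add: fg(2) frac_class_mult[OF fg(1) ux])
  qed
  then show "frac_class u x \<in> socle (local_ring I p)"
    using frac_class_carrier[OF ux] by (simp add: socle_def)
  have "u \<notin> component I p"
    using eigenvector_nonvanish[OF I u] by (auto elim: componentE)
  then show "frac_class u x \<noteq> \<zero>\<^bsub>local_ring I p\<^esub>" using frac_class_zero_iff[OF ux] by simp
qed

text \<open>
  The classes of \<open>u\<close> and \<open>v\<close> are multiples \<open>a e\<close> and \<open>b e\<close> of the generator of the socle.  Here \<open>a\<close> is
  a unit, since the maximal ideal kills \<open>e\<close>, so \<open>v\<close> is the multiple of \<open>u\<close> by the fraction \<open>b/a\<close>;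
  on an eigenvector, a fraction acts as its value at \<open>p\<close>.
\<close>

lemma gorenstein_eigenvectors_proportional:
  assumes sat: "saturated I" and gor: "artin_gorenstein (local_ring I p)"
    and u: "eigenvector I p d u" and v: "eigenvector I p d v"
  obtains c where "v - cscale c u \<in> I"
proof -
  let ?A = "local_ring I p"
  have p: "p \<in> support I" by (rule eigenvector_support[OF I u])
  obtain i where i: "p i \<noteq> 0" using support_nonzero[OF p] by (rule nonzero_coordinate)
  let ?x = "var i ^ d"
  have x: "?x \<in> forms d" "peval ?x p \<noteq> 0"
    using i forms_linear_power[OF forms_var] by (auto simp: peval_power)
  have uf: "u \<in> forms d" and vf: "v \<in> forms d" using u v by (auto simp: eigenvector_def)
  have ux: "(u, ?x) \<in> fracs p" "(v, ?x) \<in> fracs p" using uf vf x by (auto intro: fracsI)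
  obtain e where e: "e \<in> socle ?A" "socle ?A = {a \<otimes>\<^bsub>?A\<^esub> e | a. a \<in> carrier ?A}"
    using gor unfolding artin_gorenstein_def by blast
  obtain a where a: "a \<in> carrier ?A" "frac_class u ?x = a \<otimes>\<^bsub>?A\<^esub> e"
    using eigenvector_socle(1)[OF u x] e(2) by blast
  obtain b where b: "b \<in> carrier ?A" "frac_class v ?x = b \<otimes>\<^bsub>?A\<^esub> e"
    using eigenvector_socle(1)[OF v x] e(2) by blast
  have aU: "a \<in> Units ?A"
  proof (rule ccontr)
    assume "a \<notin> Units ?A"
    then have "a \<in> max_ideal ?A" using a(1) by (simp add: max_ideal_def)
    then have "a \<otimes>\<^bsub>?A\<^esub> e = \<zero>\<^bsub>?A\<^esub>" using e(1) by (simp add: socle_def)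
    then show False using eigenvector_socle(2)[OF u x] a(2) by simp
  qed
  obtain m n where mn: "(m, n) \<in> fracs p" "e = frac_class m n"
    using e(1) by (auto simp: socle_def elim: carrierE)
  obtain f g where fg: "(f, g) \<in> fracs p" "a = frac_class f g" using a(1) by (rule carrierE)
  obtain f' g' where fg': "(f', g') \<in> fracs p" "b = frac_class f' g'" using b(1) by (rule carrierE)
  have fp: "peval f p \<noteq> 0" using aU frac_class_unit_iff[OF fg(1) p] by (simp add: fg(2))
  obtain d1 where d1: "f \<in> forms d1" "g \<in> forms d1" "peval g p \<noteq> 0" using fg(1) by (rule fracsE)
  obtain d2 where d2: "f' \<in> forms d2" "g' \<in> forms d2" "peval g' p \<noteq> 0" using fg'(1) by (rule fracsE)
  obtain d3 where d3: "n \<in> forms d3" "peval n p \<noteq> 0" using mn(1) by (rule fracsE)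
  have "((u, ?x), (f * m, g * n)) \<in> frac_rel I p"
    using a(2) frac_class_eq_iff[OF ux(1) fracs_mult[OF fg(1) mn(1)]]
    by (simp add: fg(2) mn(2) frac_class_mult[OF fg(1) mn(1)])
  then obtain e1 h1 where h1: "h1 \<in> forms e1" "peval h1 p \<noteq> 0" "h1 * (u * (g * n) - f * m * ?x) \<in> I"
    by (rule frac_relE)
  have "((v, ?x), (f' * m, g' * n)) \<in> frac_rel I p"
    using b(2) frac_class_eq_iff[OF ux(2) fracs_mult[OF fg'(1) mn(1)]]
    by (simp add: fg'(2) mn(2) frac_class_mult[OF fg'(1) mn(1)])
  then obtain e2 h2 where h2: "h2 \<in> forms e2" "peval h2 p \<noteq> 0" "h2 * (v * (g' * n) - f' * m * ?x) \<in> I"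
    by (rule frac_relE)
  define w where "w = h1 * h2 * n"
  have w: "w \<in> forms (e1 + e2 + d3)" "peval w p \<noteq> 0"
    unfolding w_def using h1 h2 d3 by (auto intro: forms_mult simp: peval_mult)
  \<comment> \<open>Eliminate the numerator \<open>m\<close> of the socle generator from the two relations.\<close>
  have "h2 * f' * (h1 * (u * (g * n) - f * m * ?x)) - h1 * f * (h2 * (v * (g' * n) - f' * m * ?x)) \<in> I"
    by (intro ideal_diff[OF I] ideal_mult[OF I] h1 h2)
  also have "h2 * f' * (h1 * (u * (g * n) - f * m * ?x)) - h1 * f * (h2 * (v * (g' * n) - f' * m * ?x))
    = w * ((f' * g) * u - (f * g') * v)" by (simp add: w_def algebra_simps)
  finally have wI: "w * ((f' * g) * u - (f * g') * v) \<in> I" .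
  \<comment> \<open>The relation cross-multiplied, with all coefficients replaced by their values at \<open>p\<close>.\<close>
  define z where "z = cscale (peval (f' * g) p) u - cscale (peval (f * g') p) v"
  have fg1: "f' * g \<in> forms (d1 + d2)" "f * g' \<in> forms (d1 + d2)"
    using forms_mult[OF d2(1) d1(2)] forms_mult[OF d1(1) d2(2)] by (simp_all add: add.commute)
  have "cscale (p i ^ (d1 + d2)) ((f' * g) * u) - cscale (peval (f' * g) p) (var i ^ (d1 + d2) * u) \<in> I"
    "cscale (p i ^ (d1 + d2)) ((f * g') * v) - cscale (peval (f * g') p) (var i ^ (d1 + d2) * v) \<in> I"
    using eigenvector_mult_form[OF I eigenvector_rel[OF I u] fg1(1)]
      eigenvector_mult_form[OF I eigenvector_rel[OF I v] fg1(2)] by auto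
  from ideal_mult[OF I ideal_diff[OF I this], of w]
  have "cscale (p i ^ (d1 + d2)) (w * ((f' * g) * u - (f * g') * v)) - w * var i ^ (d1 + d2) * z \<in> I"
    by (simp add: z_def right_diff_distrib cscale_mult_right cvec.scale_right_diff_distrib mult.assoc algebra_simps)
  then have wz: "(w * var i ^ (d1 + d2)) * z \<in> I"
    using ideal_add_iff[OF I] ideal_cscale[OF I wI] by blast
  have zI: "z \<in> I"
  proof (rule ccontr)
    assume "z \<notin> I"
    then have "\<exists>g\<in>forms N. g * z \<notin> I" for N by (rule saturated_nonmember[OF sat])
    moreover have "z \<in> forms d" unfolding z_def by (intro forms_diff forms_cscale uf vf)
    moreover have "cscale (p k) (var l * z) - cscale (p l) (var k * z) \<in> I" for k l
    proof -
      have "cscale (peval (f' * g) p) (cscale (p k) (var l * u) - cscale (p l) (var k * u))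
        - cscale (peval (f * g') p) (cscale (p k) (var l * v) - cscale (p l) (var k * v)) \<in> I"
        by (intro ideal_diff[OF I] ideal_cscale[OF I] eigenvector_rel[OF I u] eigenvector_rel[OF I v])
      then show ?thesis
        by (simp add: z_def right_diff_distrib cscale_mult_right cvec.scale_right_diff_distrib
            mult.commute algebra_simps)
    qed
    ultimately have "eigenvector I p d z"
      unfolding eigenvector_def using support_nonzero[OF p] by blast
    moreover have "w * var i ^ (d1 + d2) \<in> forms (e1 + e2 + d3 + (d1 + d2))"
      by (intro forms_mult w forms_linear_power forms_var)
    moreover have "peval (w * var i ^ (d1 + d2)) p \<noteq> 0" using w i by (simp add: peval_mult peval_power)
    ultimately show False using eigenvector_nonvanish[OF I] wz by blast
  qed
  let ?c = "peval (f * g') p"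
  have c: "?c \<noteq> 0" using fp d2 by (simp add: peval_mult)
  have "cscale (- inverse ?c) z \<in> I" using zI by (rule ideal_cscale[OF I])
  then have "v - cscale (inverse ?c * peval (f' * g) p) u \<in> I"
    using c by (simp add: z_def cvec.scale_right_diff_distrib)
  then show thesis by (rule that)
qed

end

section \<open>Nondegenerate divided power forms\<close>

lemma eigenvector_proportional:
  fixes I :: "('n::finite, 'k::field) mpoly set"
  assumes I: "hom_ideal I" and u: "eigenvector I p d u" and pq: "proportional p q"
  shows "eigenvector I q d u"
proof -
  obtain c where c: "c \<noteq> 0" "q = (\<lambda>i. c * p i)" using pq by (auto simp: proportional_def)
  have "cscale (q i) (var k * u) - cscale (q k) (var i * u) \<in> I" for i k
    using ideal_cscale[OF I eigenvector_rel[OF I u], of c i k]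
    by (simp add: c(2) cvec.scale_right_diff_distrib)
  moreover have "q \<noteq> (\<lambda>_. 0)"
    using support_proportional[OF I eigenvector_support[OF I u] pq] by (rule support_nonzero)
  ultimately show ?thesis using u by (simp add: eigenvector_def)
qed

text \<open>
  Since \<open>l\<close> is regular, the relations of \<open>l\<^sup>m v\<close> can be divided by \<open>l\<^sup>m\<close>.
\<close>

lemma (in graded_regular) eigenvector_lower:
  assumes u: "eigenvector I p d u" and v: "v \<in> forms e" "u - l ^ m * v \<in> I"
  shows "eigenvector I p e v"
proof -
  have "v \<notin> I"
    using ideal_add_iff[OF I v(2)] regular_iff eigenvector_not_in[OF I u] by blast
  then have "\<exists>g\<in>forms N. g * v \<notin> I" for N by (rule saturated_nonmember[OF sat])
  moreover have "cscale (p i) (var k * v) - cscale (p k) (var i * v) \<in> I" for i k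
  proof -
    have "(cscale (p i) (var k * u) - cscale (p k) (var i * u))
        - (cscale (p i) (var k * (u - l ^ m * v)) - cscale (p k) (var i * (u - l ^ m * v))) \<in> I"
      by (intro ideal_diff[OF I] ideal_cscale[OF I] ideal_mult[OF I] v(2) eigenvector_rel[OF I u])
    also have "(cscale (p i) (var k * u) - cscale (p k) (var i * u))
        - (cscale (p i) (var k * (u - l ^ m * v)) - cscale (p k) (var i * (u - l ^ m * v)))
      = l ^ m * (cscale (p i) (var k * v) - cscale (p k) (var i * v))"
      by (simp add: right_diff_distrib cscale_mult_right cvec.scale_right_diff_distrib mult.left_commute)
    finally show ?thesis by (simp add: regular_iff)
  qed
  ultimately show ?thesis using v(1) u by (simp add: eigenvector_def)
qed

text \<open>
  For \<open>t = \<tau>\<close> and \<open>j \<ge> 2\<tau>\<close>, the functional of \<open>F\<close> on the ring of functions of the scheme vanishes on no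
  nonzero ideal; equivalently, the catalecticant of \<open>F\<close> in degrees \<open>t\<close> and \<open>j - t\<close> has no kernel
  modulo \<open>I\<close>.
\<close>

definition nondegenerate :: "('n::finite, 'k::field) mpoly set \<Rightarrow> nat \<Rightarrow> nat \<Rightarrow> ('n, 'k) dpoly \<Rightarrow> bool" where
  "nondegenerate I t j F \<longleftrightarrow>
    (\<forall>f\<in>forms t. (\<forall>g\<in>forms (j - t). pairing (f * g) F = 0) \<longrightarrow> f \<in> I)"

context zero_dim
begin

abbreviation "t \<equiv> scheme_tau I s"

text \<open>
  By the Gorenstein property it suffices to avoid one hyperplane for each of the finitely many points.
\<close>

lemma nonvanishing_on_eigenvectors:
  assumes gor: "locally_gorenstein I"
  obtains F where "F \<in> perp I j" "\<And>p u. eigenvector I p j u \<Longrightarrow> pairing u F \<noteq> 0"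
proof -
  obtain P where P: "finite P" "P \<subseteq> support I" "\<And>q. q \<in> support I \<Longrightarrow> \<exists>p\<in>P. proportional p q"
    using finitely_many_points[OF I bounded] by metis
  \<comment> \<open>Points without an eigenvector in degree \<open>j\<close> impose no condition.\<close>
  define A where "A = {p \<in> P. \<exists>e. eigenvector I p j e}"
  have "\<exists>e. eigenvector I p j e" if "p \<in> A" for p using that by (simp add: A_def)
  then obtain e where e: "\<And>p. p \<in> A \<Longrightarrow> eigenvector I p j (e p)" by metis
  have ef: "e p \<in> forms j" if "p \<in> A" for p using e[OF that] by (simp add: eigenvector_def)
  have "finite A" using P(1) by (simp add: A_def)
  moreover have "\<exists>F\<in>perp I j. pairing (e p) F \<noteq> 0" if "p \<in> A" for p
    using perp_separates[OF I ef[OF that] eigenvector_not_in[OF I e[OF that]]] by blast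
  ultimately obtain F where F: "F \<in> perp I j" "\<And>p. p \<in> A \<Longrightarrow> pairing (e p) F \<noteq> 0"
    using common_nonzero_vector[OF subspace_perp[of I j], of A "\<lambda>p F. pairing (e p) F"]
    by (metis pairing_add_right pairing_cscale_right)
  have "pairing u F \<noteq> 0" if u: "eigenvector I p j u" for p u
  proof -
    obtain q where q: "q \<in> P" "proportional q p" using P(3)[OF eigenvector_support[OF I u]] by blast
    have uq: "eigenvector I q j u"
      by (rule eigenvector_proportional[OF I u proportional_sym[OF q(2)]])
    then have qA: "q \<in> A" using q by (auto simp: A_def)
    have "artin_gorenstein (local_ring I q)"
      using gor q(1) P(2) by (auto simp: locally_gorenstein_def)
    then obtain c where c: "u - cscale c (e q) \<in> I"
      using gorenstein_eigenvectors_proportional[OF I sat _ e[OF qA] uq] by blast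
    have "c \<noteq> 0" using c eigenvector_not_in[OF I u] by auto
    moreover have "u \<in> forms j" using u by (simp add: eigenvector_def)
    then have "pairing u F = pairing (cscale c (e q)) F"
      by (rule perp_pairing_cong[OF F(1) c _ forms_cscale[OF ef[OF qA]]])
    ultimately show ?thesis using F(2)[OF qA] by (simp add: pairing_cscale_left)
  qed
  with F(1) show thesis by (rule that)
qed

text \<open>
  If \<open>F\<close> pairs to zero with all multiples of \<open>f \<notin> I\<close> in degree \<open>j\<close>, then some multiple of \<open>f\<close> is an
  eigenvector.  Multiplying or dividing by a power of \<open>l\<close> modulo \<open>I\<close> brings its degree to \<open>j\<close>, where
  it contradicts the choice of \<open>F\<close>.
\<close>

lemma nondegenerate_exists:
  assumes gor: "locally_gorenstein I" and j: "2 * t \<le> j"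
  obtains F where "F \<in> perp I j" "nondegenerate I t j F"
proof -
  obtain F where F: "F \<in> perp I j" "\<And>p u. eigenvector I p j u \<Longrightarrow> pairing u F \<noteq> 0"
    using nonvanishing_on_eigenvectors[OF gor] by blast
  have "f \<in> I" if f: "f \<in> forms t" "\<forall>g\<in>forms (j - t). pairing (f * g) F = 0" for f
  proof (rule ccontr)
    assume "f \<notin> I"
    then have "\<exists>g\<in>forms N. g * f \<notin> I" for N by (rule saturated_nonmember[OF sat])
    then obtain p r N where r: "r \<in> forms N" "eigenvector I p (N + t) (r * f)"
      using eigenvector_exists[OF I bounded f(1)] by metis
    have "\<exists>r'. r' \<in> forms (j - t) \<and> eigenvector I p j (r' * f)"
    \<comment> \<open>Move the eigenvector to degree \<open>j\<close>, up by a factor or down by a division.\<close>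
    proof (cases "N \<le> j - t")
      case True
      let ?m = "j - t - N"
      have "peval (l ^ ?m) p \<noteq> 0"
        using l_nz[OF eigenvector_support[OF I r(2)]] by (simp add: peval_power)
      then have "eigenvector I p (?m + (N + t)) (l ^ ?m * (r * f))"
        by (rule eigenvector_times[OF I r(2) l_power_form])
      moreover have "?m + (N + t) = j" using True j by simp
      moreover have e: "?m + N = j - t" using True by simp
      have "l ^ ?m * r \<in> forms (j - t)"
        using forms_mult[OF l_power_form[of ?m] r(1)] unfolding e .
      ultimately show ?thesis by (metis mult.assoc)
    next
      case False
      let ?m = "N - (j - t)"
      have N: "N = (j - t) + ?m" using False by simp
      have "hilbert I ((j - t) + ?m) \<le> hilbert I (j - t)"
        using hilbert_le hilbert_eq_degree[of "j - t"] j by simp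
      then obtain r' where r': "r' \<in> forms (j - t)" "r - l ^ ?m * r' \<in> I"
        using lower_degree r(1) N by metis
      have "r' * f \<in> forms j" using forms_mult[OF r'(1) f(1)] j by simp
      moreover have "r * f - l ^ ?m * (r' * f) \<in> I"
        using ideal_mult_right[OF I r'(2), of f] by (simp add: left_diff_distrib mult.assoc)
      ultimately have "eigenvector I p j (r' * f)" by (rule eigenvector_lower[OF r(2)])
      with r'(1) show ?thesis by blast
    qed
    then obtain r' where "r' \<in> forms (j - t)" "eigenvector I p j (r' * f)" by blast
    then show False using F(2) f(2) by (metis mult.commute)
  qed
  with F(1) show thesis using that unfolding nondegenerate_def by blast
qed

end

text \<open>
  The linear polynomial in the coefficients of \<open>F\<close> whose value is the pairing of \<open>h\<close> with \<open>F\<close>.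
\<close>

definition linear_poly :: "('a \<Rightarrow>\<^sub>0 'k::field) \<Rightarrow> ('a, 'k) mpoly" where
  "linear_poly h = (\<Sum>u\<in>Poly_Mapping.keys h. cscale (coef h u) (var u))"

lemma peval_linear_poly: "peval (linear_poly h) (coef F) = pairing h F"
  by (simp add: linear_poly_def peval_sum pairing_def)

lemma comm_ring_hom_peval: "comm_ring_hom (\<lambda>f. peval f x)"
  by unfold_locales (simp_all add: peval_add peval_mult)

text \<open>
  With bases \<open>b\<close> and \<open>b'\<close> of \<open>R/I\<close> in the degrees \<open>t\<close> and \<open>j - t\<close>, both of dimension \<open>s\<close>, nondegeneracy
  means that the square matrix of the values of \<open>F\<close> at the products \<open>b\<^sub>a b'\<^sub>c\<close> is invertible.  Its
  determinant is a polynomial in the coefficients of \<open>F\<close>.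
\<close>

lemma (in zero_dim) nondegenerate_open:
  assumes j: "2 * t \<le> j"
  shows "zariski_open_in (perp I j) {F \<in> perp I j. nondegenerate I t j F}"
proof -
  have s1: "hilbert I t = s" and s2: "hilbert I (j - t) = s" using j by (auto intro: hilbert_eq_degree)
  obtain b where b: "\<And>i. i < s \<Longrightarrow> b i \<in> forms t" "indep_mod I {..<s} b" "spans_mod I {..<s} b (forms t)"
    using hilbert_basis[OF I, of t] s1 by metis
  obtain b' where b': "\<And>i. i < s \<Longrightarrow> b' i \<in> forms (j - t)" "spans_mod I {..<s} b' (forms (j - t))"
    using hilbert_basis[OF I, of "j - t"] s2 by metis
  define M where "M F = mat s s (\<lambda>(c, a). pairing (b a * b' c) F)" for F
  define D where "D = mat s s (\<lambda>(c, a). linear_poly (b a * b' c))"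
  have MC: "M F \<in> carrier_mat s s" for F by (simp add: M_def)
  have det: "peval (det D) (coef F) = det (M F)" for F
  proof -
    interpret comm_ring_hom "\<lambda>f. peval f (coef F)" by (rule comm_ring_hom_peval)
    have "map_mat (\<lambda>f. peval f (coef F)) D = M F"
      by (rule eq_matI) (auto simp: D_def M_def peval_linear_poly)
    then show ?thesis using hom_det[of D] by simp
  qed
  have MV: "(M F *\<^sub>v v) $ c = pairing ((\<Sum>a<s. cscale (v $ a) (b a)) * b' c) F"
    if "c < s" "v \<in> carrier_vec s" for F v c
    using that
    by (simp add: M_def scalar_prod_def sum_distrib_right cscale_mult_left pairing_sum_left
        pairing_cscale_left lessThan_atLeast0, intro sum.cong refl mult.commute)
  have "nondegenerate I t j F \<longleftrightarrow> det (M F) \<noteq> 0" if F: "F \<in> perp I j" for F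
  proof
    assume nd: "nondegenerate I t j F"
    show "det (M F) \<noteq> 0"
    proof
      assume "det (M F) = 0"
      then obtain v where v: "v \<in> carrier_vec s" "v \<noteq> 0\<^sub>v s" "M F *\<^sub>v v = 0\<^sub>v s"
        using det_0_iff_vec_prod_zero[OF MC] by blast
      let ?f = "\<Sum>a<s. cscale (v $ a) (b a)"
      have f: "?f \<in> forms t" by (rule lincomb_forms[OF I]) (use b(1) in auto)
      have fb: "pairing (?f * b' c) F = 0" if "c < s" for c
        using MV[OF that v(1), of F] v(3) that by simp
      have "pairing (?f * g) F = 0" if g: "g \<in> forms (j - t)" for g
      proof -
        obtain y where y: "g - (\<Sum>c<s. cscale (y c) (b' c)) \<in> I"
          using b'(2) g unfolding spans_mod_def by blast
        let ?g = "\<Sum>c<s. cscale (y c) (b' c)"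
        have g': "?g \<in> forms (j - t)" by (rule lincomb_forms[OF I]) (use b'(1) in auto)
        have "?f * g - ?f * ?g \<in> I"
          using ideal_mult[OF I y, of ?f] by (simp add: right_diff_distrib)
        then have "pairing (?f * g) F = pairing (?f * ?g) F"
          using forms_mult[OF f g] forms_mult[OF f g'] j by (intro perp_pairing_cong[OF F]) auto
        also have "\<dots> = (\<Sum>c<s. y c * pairing (?f * b' c) F)"
          unfolding sum_distrib_left[of ?f] cscale_mult_right pairing_sum_left pairing_cscale_left ..
        also have "\<dots> = 0" using fb by simp
        finally show ?thesis .
      qed
      then have "?f \<in> I" using nd f unfolding nondegenerate_def by blast
      then have "v $ a = 0" if "a < s" for a
        using b(2) that unfolding indep_mod_def by blast
      then have "v = 0\<^sub>v s" using v(1) by (intro eq_vecI) auto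
      with v(2) show False by simp
    qed
  next
    assume d: "det (M F) \<noteq> 0"
    show "nondegenerate I t j F"
      unfolding nondegenerate_def
    proof (intro ballI impI)
      fix f assume f: "f \<in> forms t" "\<forall>g\<in>forms (j - t). pairing (f * g) F = 0"
      obtain x where x: "f - (\<Sum>a<s. cscale (x a) (b a)) \<in> I"
        using b(3) f(1) unfolding spans_mod_def by blast
      let ?f = "\<Sum>a<s. cscale (x a) (b a)"
      have f': "?f \<in> forms t" by (rule lincomb_forms[OF I]) (use b(1) in auto)
      let ?v = "vec s x"
      have row: "(M F *\<^sub>v ?v) $ c = 0" if c: "c < s" for c
      proof -
        have "(M F *\<^sub>v ?v) $ c = pairing (?f * b' c) F"
          using MV[OF c, of ?v F] by simp
        also have "\<dots> = pairing (f * b' c) F"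
        proof (rule perp_pairing_cong[OF F, symmetric])
          show "f * b' c - ?f * b' c \<in> I"
            using ideal_mult_right[OF I x, of "b' c"] by (simp add: left_diff_distrib)
          show "f * b' c \<in> forms j" "?f * b' c \<in> forms j"
            using forms_mult[OF f(1) b'(1)[OF c]] forms_mult[OF f' b'(1)[OF c]] j by auto
        qed
        also have "\<dots> = 0" using f(2) b'(1)[OF c] by blast
        finally show ?thesis .
      qed
      have "M F *\<^sub>v ?v = 0\<^sub>v s" by (rule eq_vecI) (simp_all add: row, simp add: M_def)
      then have "?v = 0\<^sub>v s" using d det_0_iff_vec_prod_zero[OF MC[of F]] vec_carrier by blast
      then have "x a = 0" if "a < s" for a using that by (metis index_vec index_zero_vec(1))
      then have "?f = 0" by simp
      then show "f \<in> I" using x by simp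
    qed
  qed
  then have "perp I j - {F \<in> perp I j. nondegenerate I t j F}
      = {F \<in> perp I j. \<forall>q\<in>{det D}. peval q (coef F) = 0}"
    by (auto simp: det)
  then show ?thesis unfolding zariski_open_in_def by blast
qed


section \<open>Recovering the scheme\<close>

text \<open>
  Modulo \<open>I\<close>, a factor \<open>l\<^bsup>i-t\<^esup>\<close> can be moved from \<open>f\<close> to the cofactor, since all pieces of degree between
  \<open>t\<close> and \<open>j - t\<close> are identified by multiplication with \<open>l\<close>.
\<close>

lemma (in zero_dim) nondegenerate_raise:
  assumes F: "F \<in> perp I j" "nondegenerate I t j F" and i: "t \<le> i" "i + t \<le> j"
    and f: "f \<in> forms i" "\<And>g. g \<in> forms (j - i) \<Longrightarrow> pairing (f * g) F = 0"
  shows "f \<in> I"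
proof -
  let ?m = "i - t"
  have ti: "i = t + ?m" "j - t = (j - i) + ?m" using i by auto
  have h: "hilbert I d = s" if "t \<le> d" for d by (rule hilbert_eq_degree[OF that])
  obtain f0 where f0: "f0 \<in> forms t" "f - l ^ ?m * f0 \<in> I"
    using lower_degree[of t ?m f] f(1) ti(1) h i by (metis order_refl)
  have "pairing (f0 * g) F = 0" if g: "g \<in> forms (j - t)" for g
  proof -
    have "hilbert I ((j - i) + ?m) \<le> hilbert I (j - i)" using h i by simp
    moreover have "g \<in> forms ((j - i) + ?m)" using g ti(2) by simp
    ultimately obtain g0 where g0: "g0 \<in> forms (j - i)" "g - l ^ ?m * g0 \<in> I"
      by (rule lower_degree)
    have "f0 * (g - l ^ ?m * g0) - g0 * (f - l ^ ?m * f0) \<in> I"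
      by (intro ideal_diff[OF I] ideal_mult[OF I] f0 g0)
    then have "f0 * g - f * g0 \<in> I" by (simp add: algebra_simps)
    then have "pairing (f0 * g) F = pairing (f * g0) F"
      using forms_mult[OF f0(1) g] forms_mult[OF f(1) g0(1)] i
      by (intro perp_pairing_cong[OF F(1)]) auto
    then show ?thesis using f(2)[OF g0(1)] by simp
  qed
  then have "f0 \<in> I" using F(2) f0(1) unfolding nondegenerate_def by blast
  then show ?thesis using ideal_add_iff[OF I f0(2)] ideal_mult[OF I] by blast
qed

text \<open>
  Since \<open>R\<^bsub>d+1\<^esub> = I\<^bsub>d+1\<^esub> + l R\<^sub>d\<close>, every form of degree \<open>d + 2\<close> is a sum of linear multiples of elements of
  \<open>I\<^bsub>d+1\<^esub>\<close> and of a multiple \<open>l h\<close>; if the form is in \<open>I\<close>, then so is \<open>h\<close>.  So \<open>I\<close> has no new generators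
  in degree \<open>d + 2\<close>.
\<close>

lemma (in graded_regular) generated_in_lower_degree:
  assumes J: "hom_ideal J" "I \<inter> forms (d + 1) \<subseteq> J" and h: "hilbert I (d + 1) \<le> hilbert I d"
  shows "I \<inter> forms (d + 2) \<subseteq> J"
proof
  fix f assume f: "f \<in> I \<inter> forms (d + 2)"
  then have "f \<in> forms (Suc (d + 1))" by simp
  then have "\<exists>a h. a \<in> I \<inter> J \<and> h \<in> forms (d + 1) \<and> f = a + l * h"
  proof (induction rule: forms_Suc_induct)
    case zero
    show ?case using ideal_0[OF I] ideal_0[OF J(1)] by (intro exI[of _ 0]) auto
  next
    case (add f g)
    then obtain a h a' h' where "a \<in> I \<inter> J" "h \<in> forms (d + 1)" "f = a + l * h"
      "a' \<in> I \<inter> J" "h' \<in> forms (d + 1)" "g = a' + l * h'" by blast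
    then show ?case
      using ideal_add[OF I] ideal_add[OF J(1)]
      by (intro exI[of _ "a + a'"] exI[of _ "h + h'"]) (auto simp: algebra_simps intro: forms_add)
  next
    case (mult k g)
    obtain w where w: "w \<in> forms d" "g - l ^ 1 * w \<in> I"
      using lower_degree[OF h mult] by blast
    have lw: "l * w \<in> forms (d + 1)" using forms_mult[OF l w(1)] by simp
    then have "g - l * w \<in> I \<inter> J" using w(2) J(2) forms_diff[OF mult lw] by auto
    then have "var k * (g - l * w) \<in> I \<inter> J" using ideal_mult[OF I] ideal_mult[OF J(1)] by blast
    moreover have "var k * w \<in> forms (d + 1)" using forms_mult[OF forms_var w(1)] by (simp add: add.commute)
    moreover have "var k * g = var k * (g - l * w) + l * (var k * w)" by (simp add: algebra_simps)
    ultimately show ?case by blast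
  qed
  then obtain a h where ah: "a \<in> I" "a \<in> J" "h \<in> forms (d + 1)" "f = a + l * h" by blast
  have "l ^ 1 * h \<in> I" using ideal_diff[OF I, of f a] f ah by simp
  then have "h \<in> I" using regular_iff[of 1 h] by blast
  then show "f \<in> J" using ah J by (auto intro: ideal_add ideal_mult)
qed

lemma saturated_subset:
  assumes A: "hom_ideal A" and B: "hom_ideal B" "saturated B"
    and sub: "\<And>n. A \<inter> forms (t + n) \<subseteq> B"
  shows "A \<subseteq> B"
proof
  fix f assume f: "f \<in> A"
  have "hom_part d f \<in> B" for d
  proof -
    have "g * hom_part d f \<in> B" if g: "g \<in> forms t" for g
      using sub[of d] forms_mult[OF g hom_part_in_forms[of d f]] ideal_mult[OF A ideal_hom_part[OF A f]]
      by blast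
    then show ?thesis using B(2) unfolding saturated_def by blast
  qed
  then show "f \<in> B" by (rule ideal_by_hom_parts[OF B(1)])
qed

text \<open>
  Every form of \<open>I'\<close> annihilates \<open>F\<close>, so \<open>I'\<^sub>i \<subseteq> I\<^sub>i\<close> for \<open>t \<le> i \<le> j - t\<close>.  As \<open>s' \<le> s\<close>, the Hilbert
  functions force equality there.  The bound on \<open>j\<close> makes this range contain the two degrees \<open>t\<close>
  and \<open>t + 1\<close>, and from them on both ideals are generated by linear multiples.
\<close>

lemma (in zero_dim) nondegenerate_determines_scheme:
  assumes F: "F \<in> perp I j" "nondegenerate I t j F" and j: "2 * t + 1 \<le> j"
    and zd': "zero_dim_scheme I' s'" and F': "F \<in> perp I' j" and s': "s' \<le> s"
  shows "s' = s \<and> I' = I"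
proof -
  obtain l' where "zero_dim I' l' s'" using zero_dim_exists[OF zd'] .
  then interpret Z: zero_dim I' l' s' .
  have sub: "I' \<inter> forms i \<subseteq> I" if i: "t \<le> i" "i + t \<le> j" for i
  proof
    fix f assume f: "f \<in> I' \<inter> forms i"
    have "pairing (f * g) F = 0" if "g \<in> forms (j - i)" for g
    proof (rule perp_pairing[OF F'])
      show "f * g \<in> I'" using f ideal_mult_right[OF Z.I] by blast
      show "f * g \<in> forms j" using forms_mult[of f i g "j - i"] f that i by simp
    qed
    then show "f \<in> I" using nondegenerate_raise[OF F i] f by blast
  qed
  have eq: "I \<inter> forms i = I' \<inter> forms i" "hilbert I' i = s" if i: "t \<le> i" "i + t \<le> j" for i
  proof -
    have "hilbert I' i \<le> hilbert I i"
      using Z.hilbert_le[of i] s' hilbert_eq_degree[OF i(1)] by simp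
    then show e: "I \<inter> forms i = I' \<inter> forms i"
      by (rule hilbert_eq_imp_eq[OF Z.I I sub[OF i]])
    then show "hilbert I' i = s" using hilbert_eq_degree[OF i(1)] by (simp add: hilbert_def)
  qed
  have ss: "s' = s" using eq(2)[of t] Z.hilbert_le[of t] s' j by simp
  have h': "hilbert I' d = s" if "t \<le> d" for d
    using Z.hilbert_mono[OF that] Z.hilbert_le[of d] eq(2)[of t] j ss by simp
  have "I \<inter> forms (t + n) = I' \<inter> forms (t + n) \<and> I \<inter> forms (t + n + 1) = I' \<inter> forms (t + n + 1)" for n
  proof (induction n)
    case 0
    show ?case using eq(1)[of t] eq(1)[of "t + 1"] j by simp
  next
    case (Suc n)
    have "I \<inter> forms (t + n + 2) \<subseteq> I'"
      by (rule generated_in_lower_degree[OF Z.I]) (use Suc hilbert_eq_degree in auto)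
    moreover have "I' \<inter> forms (t + n + 2) \<subseteq> I"
      by (rule Z.generated_in_lower_degree[OF I]) (use Suc h' in auto)
    ultimately show ?case using Suc by auto
  qed
  then have "I \<subseteq> I'" "I' \<subseteq> I"
    using saturated_subset[OF I Z.I Z.sat, of t] saturated_subset[OF Z.I I sat, of t] by blast+
  with ss show ?thesis by blast
qed


section \<open>Generalized additive decompositions\<close>

lemma irreducible_componentsD:
  assumes "irreducible_components I Qs" "list_all2 zero_dim_scheme Qs ss"
  shows "I = \<Inter>(set Qs)" "distinct Qs"
    "\<And>Q. Q \<in> set Qs \<Longrightarrow> hom_ideal Q \<and> saturated Q \<and> bounded_hilbert Q \<and> single_point Q"
    "\<And>Q Q'. Q \<in> set Qs \<Longrightarrow> Q' \<in> set Qs \<Longrightarrow> Q \<noteq> Q' \<Longrightarrow> support Q \<inter> support Q' = {}"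
proof -
  show "I = \<Inter>(set Qs)" using assms(1) by (simp add: irreducible_components_def)
  show Q: "hom_ideal Q \<and> saturated Q \<and> bounded_hilbert Q \<and> single_point Q" if Q: "Q \<in> set Qs" for Q
  proof -
    obtain i where "i < length Qs" "Q = Qs ! i" using Q by (auto simp: in_set_conv_nth)
    then have "zero_dim_scheme Q (ss ! i)" using assms(2) by (auto simp: list_all2_conv_all_nth)
    then show ?thesis using zero_dim_schemeD assms(1) Q by (auto simp: irreducible_components_def)
  qed
  have idx: "support (Qs ! i) \<inter> support (Qs ! k) = {}" if "i < k" "k < length Qs" for i k
    using assms(1) that by (auto simp: irreducible_components_def sorted_wrt_iff_nth_less)
  show "support Q \<inter> support Q' = {}" if QQ: "Q \<in> set Qs" "Q' \<in> set Qs" "Q \<noteq> Q'" for Q Q'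
  proof -
    obtain i k where ik: "i < length Qs" "Q = Qs ! i" "k < length Qs" "Q' = Qs ! k"
      using QQ by (metis in_set_conv_nth)
    then have "i < k \<or> k < i" using QQ(3) by (metis linorder_neqE_nat)
    then show ?thesis using idx ik by blast
  qed
  show "distinct Qs"
    unfolding distinct_conv_nth
  proof (intro allI impI notI)
    fix i k assume ik: "i < length Qs" "k < length Qs" "i \<noteq> k" "Qs ! i = Qs ! k"
    then have "support (Qs ! i) = {}" using idx[of i k] idx[of k i] by (metis Int_absorb linorder_neqE_nat)
    moreover have "single_point (Qs ! i)" using Q ik(1) nth_mem by blast
    ultimately show False using proportional_refl unfolding single_point_iff by blast
  qed
qed

lemma sum_hilbert_le_sum_list:
  fixes Qs :: "('n::finite, 'k::alg_closed_field) mpoly set list"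
  assumes "list_all2 zero_dim_scheme Qs ss"
  shows "(\<Sum>Q\<leftarrow>Qs. hilbert Q d) \<le> sum_list ss"
  using assms
proof induction
  case (Cons Q Qs s ss)
  obtain l where "zero_dim Q l s" using zero_dim_exists[OF Cons(1)] .
  then interpret zero_dim Q l s .
  show ?case using Cons.IH hilbert_le[of d] by simp
qed simp

text \<open>
  The Hilbert functions of the components are bounded by their degrees, which sum to at most the value
  of the Hilbert function of \<open>I\<close> at \<open>d\<close>.
\<close>

lemma components_comaximal:
  fixes Qs :: "('n::finite, 'k::alg_closed_field) mpoly set list"
  assumes c: "irreducible_components I Qs" "list_all2 zero_dim_scheme Qs ss"
    and h: "sum_list ss \<le> hilbert I d" and Q: "Q \<in> set Qs"
  shows "forms d \<subseteq> ideal_plus Q (\<Inter>(set Qs - {Q}))"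
proof (rule comaximal_if_hilbert_sum[OF finite_set _ _ Q])
  note C = irreducible_componentsD[OF c]
  show "hom_ideal Q" if "Q \<in> set Qs" for Q using C(3)[OF that] by blast
  have "(\<Sum>Q\<in>set Qs. hilbert Q d) = (\<Sum>Q\<leftarrow>Qs. hilbert Q d)"
    using C(2) by (simp add: sum_list_distinct_conv_sum_set)
  also have "\<dots> \<le> sum_list ss" by (rule sum_hilbert_le_sum_list[OF c(2)])
  finally show "(\<Sum>Q\<in>set Qs. hilbert Q d) \<le> hilbert (\<Inter>(set Qs)) d" using h C(1) by simp
qed

text \<open>
  A component is determined by \<open>I\<close> and its point, and the points are those of the support of \<open>I\<close>.
\<close>

lemma irreducible_components_subset:
  fixes I :: "('n::finite, 'k::alg_closed_field) mpoly set"
  assumes c: "irreducible_components I Qs" "list_all2 zero_dim_scheme Qs ss"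
    and c': "irreducible_components I Qs'" "list_all2 zero_dim_scheme Qs' ss'"
  shows "set Qs \<subseteq> set Qs'"
proof
  note C = irreducible_componentsD[OF c] and C' = irreducible_componentsD[OF c']
  fix Q assume Q: "Q \<in> set Qs"
  obtain p where p: "p \<in> support Q" using C(3)[OF Q] proportional_refl unfolding single_point_iff by blast
  have "p \<in> support I" using p Q C(1) support_antimono[of I Q] by blast
  also have "support I = (\<Union>Q\<in>set Qs'. support Q)"
    unfolding C'(1) by (rule support_Inter) (use C'(3) in auto)
  finally obtain Q' where Q': "Q' \<in> set Qs'" "p \<in> support Q'" by blast
  have "Q = component I p"
    unfolding C(1) by (rule irreducible_component_unique) (use C(3,4) Q p in auto)
  moreover have "Q' = component I p"
    unfolding C'(1) by (rule irreducible_component_unique) (use C'(3,4) Q' in auto)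
  ultimately show "Q \<in> set Qs'" using Q'(1) by simp
qed

text \<open>
  Pairing the summands with distinct components makes decompositions comparable whose components are
  listed in different orders.
\<close>

lemma list_all2_summand_function:
  assumes "distinct Qs" "list_all2 R Fs Qs"
  obtains G where "Fs = map G Qs" "\<And>Q. Q \<in> set Qs \<Longrightarrow> R (G Q) Q"
proof -
  have len: "length Fs = length Qs" using assms(2) by (rule list_all2_lengthD)
  define G where "G Q = the (map_of (zip Qs Fs) Q)" for Q
  have G: "G (Qs ! i) = Fs ! i" if "i < length Qs" for i
    using assms(1) len that by (simp add: G_def map_of_zip_nth)
  then have "Fs = map G Qs" by (intro nth_equalityI) (auto simp: len)
  moreover have "R (G Q) Q" if "Q \<in> set Qs" for Q
    using that assms(2) G by (auto simp: in_set_conv_nth list_all2_conv_all_nth)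
  ultimately show thesis by (rule that)
qed

lemma gad_perp:
  assumes "gad F j I ss Qs Fs" shows "F \<in> perp I j"
proof -
  have "G \<in> perp I j" if "G \<in> set Fs" for G
  proof -
    obtain i where i: "i < length Fs" "G = Fs ! i" using \<open>G \<in> set Fs\<close> by (auto simp: in_set_conv_nth)
    then have "G \<in> perp (Qs ! i) j" "i < length Qs"
      using assms by (auto simp: gad_def list_all2_conv_all_nth)
    moreover have "I \<subseteq> Qs ! i"
      using assms \<open>i < length Qs\<close> by (auto simp: gad_def irreducible_components_def)
    ultimately show ?thesis using perp_antimono by blast
  qed
  then have "sum_list Fs \<in> perp I j"
    by (induction Fs) (auto intro: cvec.subspace_0[OF subspace_perp] cvec.subspace_add[OF subspace_perp])
  then show ?thesis using assms by (simp add: gad_def)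
qed

lemma gad_exists:
  fixes I :: "('n::finite, 'k::alg_closed_field) mpoly set"
  assumes zd: "zero_dim_scheme I s" and h: "hilbert I j = s" and F: "F \<in> perp I j"
  obtains ss Qs Fs where "sum_list ss = s" "gad F j I ss Qs Fs"
proof -
  obtain Qs ss where c: "irreducible_components I Qs" "list_all2 zero_dim_scheme Qs ss" "sum_list ss = s"
    using irreducible_components_exist[OF zd] by blast
  note C = irreducible_componentsD[OF c(1,2)]
  have co: "forms j \<subseteq> ideal_plus Q (\<Inter>(set Qs - {Q}))" if "Q \<in> set Qs" for Q
    using components_comaximal[OF c(1,2) _ that] c(3) h by simp
  obtain G where G: "\<And>Q. Q \<in> set Qs \<Longrightarrow> G Q \<in> perp Q j" "F = (\<Sum>Q\<in>set Qs. G Q)"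
    using perp_summands_exist[OF finite_set _ co] C(1,3) F by metis
  have "gad F j I ss Qs (map G Qs)"
    unfolding gad_def
  proof (intro conjI)
    show "list_all2 (\<lambda>G Q. G \<in> perp Q j) (map G Qs) Qs"
      using G(1) by (simp add: list_all2_map1 list.rel_refl_strong)
    show "F = sum_list (map G Qs)" using G(2) C(2) by (simp add: sum_list_distinct_conv_sum_set)
  qed (use zd c in auto)
  with c(3) show thesis by (rule that)
qed

lemma gad_unique:
  fixes I :: "('n::finite, 'k::alg_closed_field) mpoly set"
  assumes h: "hilbert I j = s"
    and g: "gad F j I ss Qs Fs" "sum_list ss = s" and g': "gad F j I ss' Qs' Fs'" "sum_list ss' = s"
  shows "mset Fs' = mset Fs"
proof -
  have c: "irreducible_components I Qs" "list_all2 zero_dim_scheme Qs ss"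
    and c': "irreducible_components I Qs'" "list_all2 zero_dim_scheme Qs' ss'"
    using g(1) g'(1) by (auto simp: gad_def)
  note C = irreducible_componentsD[OF c] and C' = irreducible_componentsD[OF c']
  have set: "set Qs' = set Qs"
    using irreducible_components_subset[OF c c'] irreducible_components_subset[OF c' c] by blast
  then have ms: "mset Qs' = mset Qs" using C(2) C'(2) by (simp add: set_eq_iff_mset_eq_distinct)
  obtain G where G: "Fs = map G Qs" "\<And>Q. Q \<in> set Qs \<Longrightarrow> G Q \<in> perp Q j"
    using list_all2_summand_function[OF C(2), of "\<lambda>G Q. G \<in> perp Q j" Fs] g(1) unfolding gad_def by blast
  obtain G' where G': "Fs' = map G' Qs'" "\<And>Q. Q \<in> set Qs' \<Longrightarrow> G' Q \<in> perp Q j"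
    using list_all2_summand_function[OF C'(2), of "\<lambda>G Q. G \<in> perp Q j" Fs'] g'(1) unfolding gad_def by blast
  have "F = (\<Sum>Q\<in>set Qs. G Q)" "F = (\<Sum>Q\<in>set Qs'. G' Q)"
    using g(1) g'(1) C(2) C'(2) by (simp_all add: gad_def G(1) G'(1) sum_list_distinct_conv_sum_set)
  then have sum: "(\<Sum>Q\<in>set Qs. G' Q) = (\<Sum>Q\<in>set Qs. G Q)" using set by simp
  have co: "forms j \<subseteq> ideal_plus Q (\<Inter>(set Qs - {Q}))" if "Q \<in> set Qs" for Q
    using components_comaximal[OF c _ that] g(2) h by simp
  have "G' Q = G Q" if "Q \<in> set Qs" for Q
    by (rule perp_summands_unique[OF finite_set _ co _ _ sum that]) (use C(3) G(2) G'(2) set in auto)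
  then have "image_mset G' (mset Qs) = image_mset G (mset Qs)" by (intro image_mset_cong) simp
  then show ?thesis using ms by (simp add: G(1) G'(1))
qed

theorem theorem3p22:
  fixes I :: "('n::finite, 'k::alg_closed_field) mpoly set" and s j :: nat
  assumes "CHAR('k) = 0 \<or> CHAR('k) > j"
    and "zero_dim_scheme I s"
    and "locally_gorenstein I"
    and "j \<ge> max (scheme_tau I s + scheme_alpha I) (2 * scheme_tau I s + 1)"
  shows "\<exists>W. zariski_open_in (perp I j) W \<and> W \<noteq> {} \<and>
    (\<forall>F\<in>W.
       (\<exists>ss Qs Fs. sum_list ss = s \<and> gad F j I ss Qs Fs \<and>
          (\<forall>I' ss' Qs' Fs'. sum_list ss' = s \<and> gad F j I' ss' Qs' Fs' \<longrightarrow> mset Fs' = mset Fs)) \<and>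
       \<not> (\<exists>I' ss' Qs' Fs'. sum_list ss' < s \<and> gad F j I' ss' Qs' Fs'))"
proof -
  note zd = assms(2)
  obtain l where "zero_dim I l s" using zero_dim_exists[OF zd] .
  then interpret zero_dim I l s .
  have j: "2 * t + 1 \<le> j" using assms(4) by simp
  have h: "hilbert I j = s" using j by (intro hilbert_eq_degree) simp
  let ?W = "{F \<in> perp I j. nondegenerate I t j F}"
  have other: "s' = s \<and> I' = I" if "F \<in> ?W" "gad F j I' ss' Qs' Fs'" "sum_list ss' = s'" "s' \<le> s"
    for F I' ss' Qs' Fs' s'
    using nondegenerate_determines_scheme[of F j I' s'] that j gad_perp[OF that(2)]
    by (auto simp: gad_def)
  show ?thesis
  proof (intro exI[of _ ?W] conjI ballI)
    show "zariski_open_in (perp I j) ?W" using j by (intro nondegenerate_open) simp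
    show "?W \<noteq> {}" using nondegenerate_exists[OF assms(3), of j] j by auto
    fix F assume F: "F \<in> ?W"
    then obtain ss Qs Fs where g: "sum_list ss = s" "gad F j I ss Qs Fs"
      using gad_exists[OF zd h] by blast
    have "mset Fs' = mset Fs" if "sum_list ss' = s" "gad F j I' ss' Qs' Fs'" for I' ss' Qs' Fs'
    proof -
      have "I' = I" using other[OF F that(2,1)] by simp
      then show ?thesis using gad_unique[OF h g(2,1)] that by blast
    qed
    with g show "\<exists>ss Qs Fs. sum_list ss = s \<and> gad F j I ss Qs Fs \<and>
      (\<forall>I' ss' Qs' Fs'. sum_list ss' = s \<and> gad F j I' ss' Qs' Fs' \<longrightarrow> mset Fs' = mset Fs)"
      by blast
    show "\<not> (\<exists>I' ss' Qs' Fs'. sum_list ss' < s \<and> gad F j I' ss' Qs' Fs')"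
      using other[OF F] by (metis less_imp_le less_irrefl)
  qed
qed

end
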